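(* Let $n\geq1$ and $p<-2n-5$. Then there exists at least one positive smooth function $h$ on $\mathbb{S}^n$ which is not constant and satisfies $$\det(\nabla^2h+hI)=h^{p-1}\quad\text{on }\mathbb{S}^n.$$
   Context: $\mathbb{S}^n\subset\mathbb{R}^{n+1}$ is the unit sphere with round metric; $\nabla^2h$ denotes the covariant Hessian of $h$ in an orthonormal frame and $I$ the identity matrix. *)

theory Defs
  imports "HOL-Analysis.Analysis"
begin

fun Ck_on :: "nat \<Rightarrow> 'a::euclidean_space set \<Rightarrow> ('a \<Rightarrow> real) \<Rightarrow> bool" where
  "Ck_on 0 U f = continuous_on U f"
| "Ck_on (Suc k) U f =
     (\<exists>f'. (\<forall>x\<in>U. (f has_derivative f' x) (at x)) \<and> (\<forall>v. Ck_on k U (\<lambda>x. f' x v)))"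

definition smooth_on :: "'a::euclidean_space set \<Rightarrow> ('a \<Rightarrow> real) \<Rightarrow> bool" where
  "smooth_on U f \<longleftrightarrow> (\<forall>k. Ck_on k U f)"

definition smooth_on_sphere :: "('a::euclidean_space \<Rightarrow> real) \<Rightarrow> bool" where
  "smooth_on_sphere h \<longleftrightarrow>
     (\<exists>U H. open U \<and> sphere 0 1 \<subseteq> U \<and> smooth_on U H \<and> (\<forall>x\<in>sphere 0 1. H x = h x))"

(* Exponential map of the round unit sphere at x (|x| = 1) applied to t w,
for a tangent vector w (w orthogonal to x): the geodesic with initial velocity w. *)
definition sphere_exp :: "'a::euclidean_space \<Rightarrow> 'a \<Rightarrow> real \<Rightarrow> 'a" where
  "sphere_exp x w t = cos (t * norm w) *\<^sub>R x + sin (t * norm w) *\<^sub>R (w /\<^sub>R norm w)"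

(* Covariant Hessian quadratic form: (\<nabla>^2h)_x(w,w) = (h \<circ> \<gamma>)''(0) for the geodesic
\<gamma>(t) = exp_x(t w); the bilinear form is obtained by polarization. *)
definition sphere_hess_quad :: "('a::euclidean_space \<Rightarrow> real) \<Rightarrow> 'a \<Rightarrow> 'a \<Rightarrow> real" where
  "sphere_hess_quad h x w = deriv (deriv (\<lambda>t. h (sphere_exp x w t))) 0"

definition sphere_hess :: "('a::euclidean_space \<Rightarrow> real) \<Rightarrow> 'a \<Rightarrow> 'a \<Rightarrow> 'a \<Rightarrow> real" where
  "sphere_hess h x u v = (sphere_hess_quad h x (u + v) - sphere_hess_quad h x (u - v)) / 4"

definition hess_plus_id_matrix ::
  "(real^'m \<Rightarrow> real) \<Rightarrow> real^'m \<Rightarrow> ('n::finite \<Rightarrow> real^'m) \<Rightarrow> real^'n^'n" where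
  "hess_plus_id_matrix h x e =
     (\<chi> i j. sphere_hess h x (e i) (e j) + (if i = j then h x else 0))"

(* e is an orthonormal frame of the tangent space x-perp (when CARD('m) = CARD('n)+1,
n orthonormal vectors orthogonal to x automatically span x-perp). *)
definition tangent_orthonormal_frame :: "real^'m \<Rightarrow> ('n::finite \<Rightarrow> real^'m) \<Rightarrow> bool" where
  "tangent_orthonormal_frame x e \<longleftrightarrow>
     (\<forall>i. e i \<bullet> x = 0) \<and> (\<forall>i j. e i \<bullet> e j = (if i = j then 1 else 0))"

end

theory Submission
  imports Defs
begin

text \<open>
We look for a zonal solution \<open>h(x) = f(x \<bullet> a)\<close>. As a function of the angle \<open>\<theta>\<close> to the axis \<open>a\<close>, and with
\<open>q = h' / sin\<close>, the Hessian plus identity has the \<open>(n - 1)\<close>-fold eigenvalue \<open>g = h + q cos\<close> and the simple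
eigenvalue \<open>h'' + h\<close>, so the equation becomes the system \<open>h' = q sin\<close>, \<open>q' = (h^(p - 1) g^(1 - n) - g) / sin\<close>,
which is singular at both poles. It implies \<open>((g sin)^n)' = n h^(p - 1) sin^(n - 1) cos\<close>.

For every initial height \<open>a = h(0)\<close> there is a solution starting at the north pole, and \<open>a = 1\<close> gives the
constant one. Call \<open>a\<close> oscillating if \<open>q\<close> changes sign three times before the south pole. Linearising at
the constant solution gives an operator with eigenvalue parameter \<open>n + 1 - p\<close>; the hypothesis on \<open>p\<close>
says exactly that it exceeds the degree 3 eigenvalue \<open>3 (n + 2)\<close>, so by Sturm comparison all \<open>a < 1\<close>
close to 1 oscillate. On the other hand \<open>h'' + h > 0\<close> forces critical points of opposite kind to be more than
\<open>\<pi>/3\<close> apart when \<open>a\<close> is small, so small \<open>a\<close> do not oscillate.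

Let \<open>s < 1\<close> be the supremum of the non-oscillating values. Oscillation is an open condition, so for
\<open>a\<close> decreasing to \<open>s\<close> the third critical point must tend to the south pole. As the solutions are bounded
above and away from 0 up to their third critical point, the solution starting from \<open>s\<close> exists and is
bounded on all of \<open>[0, \<pi>)\<close>. Such a bounded solution is smooth at both poles, and it is not constant because
its initial value is less than 1.
\<close>

section \<open>Volterra equations\<close>

text \<open>A profile shot from the north pole is regular at the south pole only if it stays
  bounded, which is not visible at any fixed angle below pi. The third critical point makes it
  visible: there h is at least 1 and q = 0, so g = h, and the identity for (g sin)^n, integrated
  backwards from that angle, bounds g by constants independent of its distance from pi. For a < 1
  the pattern is fixed: at a critical point q' = (h^(p - n) - h) / sin, so q changes sign at heights
  above 1, below 1, above 1 in turn.

  Three fits both ends of the range of heights. The degree 3 zonal harmonic has two interior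
  critical points, so a larger eigenvalue forces a third. For small a, three gaps longer than pi/3
  do not fit below pi; two would.

  If h is read as the support function of a body of revolution, g is a principal radius of
  curvature, and g sin and h cos - h' sin are the distance from the axis and the height of the
  boundary point with normal angle \<theta>. Several upper bounds on h are read off from these two
  coordinates.\<close>

lemma continuous_on_Ico_if_Icc:
  fixes f :: "real \<Rightarrow> 'a::topological_space"
  assumes "\<And>b. 0 < b \<Longrightarrow> b < B \<Longrightarrow> continuous_on {0..b} f"
  shows "continuous_on {0..<B} f"
  unfolding continuous_on_eq_continuous_within
proof
  fix t assume t: "t \<in> {0..<B}"
  define b where "b = (t + B) / 2"
  have "continuous (at t within {0..b}) f"
    using assms[of b] t by (auto simp: b_def continuous_on_eq_continuous_within)
  moreover have "at t within {0..b} = at t within {0..<B}"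
    by (rule at_within_nhd[of _ "{..<b}"]) (use t in \<open>auto simp: b_def\<close>)
  ultimately show "continuous (at t within {0..<B}) f" by simp
qed

text \<open>Contraction with factor 1/2 in the Bielecki norm
  \<open>sup |u t| exp (- \<kappa> t)\<close>. The bounds \<open>M\<close> stand in for the norm, so
  no space of functions has to be set up.\<close>

definition weight_contraction :: "((real \<Rightarrow> real) \<Rightarrow> real \<Rightarrow> real) \<Rightarrow> real \<Rightarrow> real \<Rightarrow> bool" where
  "weight_contraction T \<kappa> b \<longleftrightarrow> 0 \<le> \<kappa> \<and>
     (\<forall>u v M. continuous_on {0..b} u \<longrightarrow> continuous_on {0..b} v \<longrightarrow>
        (\<forall>t\<in>{0..b}. \<bar>u t - v t\<bar> \<le> M * exp (\<kappa> * t)) \<longrightarrow>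
        (\<forall>t\<in>{0..b}. \<bar>T u t - T v t\<bar> \<le> M / 2 * exp (\<kappa> * t)))"

lemma weight_contractionD:
  assumes "weight_contraction T \<kappa> b" "continuous_on {0..b} u" "continuous_on {0..b} v"
    "\<And>t. t \<in> {0..b} \<Longrightarrow> \<bar>u t - v t\<bar> \<le> M * exp (\<kappa> * t)" "t \<in> {0..b}"
  shows "\<bar>T u t - T v t\<bar> \<le> M / 2 * exp (\<kappa> * t)"
  using assms unfolding weight_contraction_def by blast

text \<open>Picard iteration. The weight may depend on \<open>b\<close> while the iterates do not,
  so one sequence converges uniformly on every \<open>{0..b}\<close>; this yields a fixed point on
  the half-open interval even if \<open>\<kappa>\<close> is unbounded as \<open>b\<close> tends to
  \<open>B\<close>.\<close>

lemma weight_contraction_fixpoint: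
  assumes cont: "\<And>u. continuous_on {0..<B} u \<Longrightarrow> continuous_on {0..<B} (T u)"
    and contr: "\<And>b. 0 < b \<Longrightarrow> b < B \<Longrightarrow> \<exists>\<kappa>. weight_contraction T \<kappa> b"
  obtains u where "continuous_on {0..<B} u" "\<And>t. t \<in> {0..<B} \<Longrightarrow> T u t = u t"
proof -
  define U where "U k = (T ^^ k) (\<lambda>_. 0)" for k
  have U_Suc: "U (Suc k) = T (U k)" for k by (simp add: U_def)
  have contU: "continuous_on {0..<B} (U k)" for k
    by (induction k) (auto simp: U_Suc cont, simp add: U_def)
  define u where "u t = (\<Sum>i. U (Suc i) t - U i t)" for t
  have lim: "uniform_limit {0..b} U u sequentially" if b: "0 < b" "b < B" for b
  proof -
    obtain \<kappa> where \<kappa>: "weight_contraction T \<kappa> b" using contr b by blast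
    have sub: "{0..b} \<subseteq> {0..<B}" using b by auto
    have cU: "continuous_on {0..b} (U k)" for k using contU sub continuous_on_subset by blast
    have \<kappa>0: "0 \<le> \<kappa>" using \<kappa> by (simp add: weight_contraction_def)
    have "compact ((\<lambda>t. U 1 t - U 0 t) ` {0..b})"
      by (intro compact_continuous_image continuous_intros cU) auto
    then obtain M0 where M0: "\<And>t. t \<in> {0..b} \<Longrightarrow> \<bar>U 1 t - U 0 t\<bar> \<le> M0"
      by (meson compact_imp_bounded bounded_real image_eqI)
    have M0nn: "0 \<le> M0" using order_trans[OF abs_ge_zero M0[of 0]] b by simp
    have step: "\<bar>U (Suc k) t - U k t\<bar> \<le> M0 / 2 ^ k * exp (\<kappa> * t)" if "t \<in> {0..b}" for k t
      using that
    proof (induction k arbitrary: t)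
      case 0
      have "\<bar>U (Suc 0) t - U 0 t\<bar> \<le> M0 * 1" using M0[OF 0] by simp
      also have "\<dots> \<le> M0 * exp (\<kappa> * t)"
        by (rule mult_left_mono) (use 0 \<kappa>0 M0nn in auto)
      finally show ?case by simp
    next
      case (Suc k)
      have "\<bar>T (U (Suc k)) t - T (U k) t\<bar> \<le> M0 / 2 ^ k / 2 * exp (\<kappa> * t)"
        by (rule weight_contractionD[OF \<kappa> cU cU]) (use Suc in auto)
      then show ?case by (simp add: U_Suc field_simps)
    qed
    have bnd: "norm (U (Suc k) t - U k t) \<le> M0 * exp (\<kappa> * b) * (1/2) ^ k" if "t \<in> {0..b}" for k t
    proof -
      have "M0 / 2 ^ k * exp (\<kappa> * t) \<le> M0 / 2 ^ k * exp (\<kappa> * b)"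
        using that \<kappa>0 M0nn by (intro mult_left_mono) (auto intro: mult_left_mono)
      then show ?thesis using step[OF that, of k] by (simp add: power_divide field_simps)
    qed
    have "uniform_limit {0..b} (\<lambda>n t. \<Sum>i<n. U (Suc i) t - U i t) u sequentially"
      unfolding u_def
      by (rule Weierstrass_m_test[OF bnd]) (auto intro!: summable_mult summable_geometric)
    moreover have "(\<lambda>n t. \<Sum>i<n. U (Suc i) t - U i t) = U"
    proof (intro ext)
      fix n t
      have "(\<Sum>i<n. U (Suc i) t - U i t) = U n t - U 0 t"
        by (rule sum_lessThan_telescope)
      then show "(\<Sum>i<n. U (Suc i) t - U i t) = U n t" by (simp add: U_def)
    qed
    ultimately show ?thesis by simp
  qed
  have cu: "continuous_on {0..b} u" if "0 < b" "b < B" for b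
    by (rule uniform_limit_theorem[OF _ lim[OF that]])
       (use that in \<open>auto intro!: always_eventually continuous_on_subset[OF contU]\<close>)
  have "continuous_on {0..<B} u" by (rule continuous_on_Ico_if_Icc[OF cu])
  moreover have "T u t = u t" if t: "t \<in> {0..<B}" for t
  proof -
    define b where "b = (t + B) / 2"
    have b: "0 < b" "b < B" "t \<in> {0..b}" using t by (auto simp: b_def)
    obtain \<kappa> where \<kappa>: "weight_contraction T \<kappa> b" using contr b by blast
    have \<kappa>0: "0 \<le> \<kappa>" using \<kappa> by (simp add: weight_contraction_def)
    have cU: "continuous_on {0..b} (U k)" for k
      by (rule continuous_on_subset[OF contU]) (use b in auto)
    have "(\<lambda>k. U (Suc k) t) \<longlonglongrightarrow> T u t"
    proof (rule metric_LIMSEQ_I)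
      fix r :: real assume r: "0 < r"
      \<comment> \<open>Dividing by the weight at \<open>t\<close> makes the contraction bound at
        \<open>t\<close> come out as \<open>r / 2\<close>.\<close>
      define e where "e = r / exp (\<kappa> * t)"
      have e: "0 < e" using r by (simp add: e_def)
      from uniform_limitD[OF lim[OF b(1,2)] e]
      obtain n0 where n0: "\<And>k s. k \<ge> n0 \<Longrightarrow> s \<in> {0..b} \<Longrightarrow> \<bar>U k s - u s\<bar> < e"
        unfolding eventually_sequentially dist_real_def by blast
      show "\<exists>no. \<forall>k\<ge>no. dist (U (Suc k) t) (T u t) < r"
      proof (intro exI allI impI)
        fix k assume k: "k \<ge> n0"
        have "\<bar>T (U k) t - T u t\<bar> \<le> e / 2 * exp (\<kappa> * t)"
        proof (rule weight_contractionD[OF \<kappa> cU cu[OF b(1,2)] _ b(3)])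
          fix s assume s: "s \<in> {0..b}"
          have "\<bar>U k s - u s\<bar> \<le> e * 1" using n0[OF k s] by simp
          also have "\<dots> \<le> e * exp (\<kappa> * s)" using e s \<kappa>0 by (intro mult_left_mono) auto
          finally show "\<bar>U k s - u s\<bar> \<le> e * exp (\<kappa> * s)" .
        qed
        then show "dist (U (Suc k) t) (T u t) < r"
          using r by (simp add: e_def dist_real_def U_Suc)
      qed
    qed
    moreover have "(\<lambda>k. U (Suc k) t) \<longlonglongrightarrow> u t"
      using tendsto_uniform_limitI[OF lim[OF b(1,2)] b(3)] LIMSEQ_Suc by blast
    ultimately show ?thesis by (rule LIMSEQ_unique)
  qed
  ultimately show ?thesis by (rule that)
qed

text \<open>Where the weighted difference is largest, the contraction bounds the difference of the
  images by half of it, so the other half is at most \<open>\<delta>\<close>. With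
  \<open>\<delta> = 0\<close> this is uniqueness of fixed points; with \<open>\<delta>\<close> the
  distance of two data it is Lipschitz dependence.\<close>

lemma weight_contraction_diff:
  assumes \<kappa>: "weight_contraction T \<kappa> b" and b: "0 \<le> b"
    and u: "continuous_on {0..b} u" and v: "continuous_on {0..b} v"
    and d: "\<And>t. t \<in> {0..b} \<Longrightarrow> \<bar>u t - v t\<bar> \<le> \<bar>T u t - T v t\<bar> + \<delta>"
    and t: "t \<in> {0..b}"
  shows "\<bar>u t - v t\<bar> \<le> 2 * \<delta> * exp (\<kappa> * t)"
proof -
  have \<kappa>0: "0 \<le> \<kappa>" using \<kappa> by (simp add: weight_contraction_def)
  have "\<exists>x\<in>{0..b}. \<forall>y\<in>{0..b}. \<bar>u y - v y\<bar> * exp (- \<kappa> * y) \<le> \<bar>u x - v x\<bar> * exp (- \<kappa> * x)"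
    by (rule continuous_attains_sup) (use b in \<open>auto intro!: continuous_intros u v\<close>)
  then obtain x where x: "x \<in> {0..b}"
    and max: "\<And>y. y \<in> {0..b} \<Longrightarrow> \<bar>u y - v y\<bar> * exp (- \<kappa> * y) \<le> \<bar>u x - v x\<bar> * exp (- \<kappa> * x)"
    by blast
  define M where "M = \<bar>u x - v x\<bar> * exp (- \<kappa> * x)"
  have M: "\<bar>u y - v y\<bar> \<le> M * exp (\<kappa> * y)" if "y \<in> {0..b}" for y
    using max[OF that] by (simp add: M_def exp_minus field_simps)
  have "\<bar>u x - v x\<bar> \<le> M / 2 * exp (\<kappa> * x) + \<delta>"
    using weight_contractionD[OF \<kappa> u v M x] d[OF x] by simp
  moreover have "\<bar>u x - v x\<bar> = M * exp (\<kappa> * x)" by (simp add: M_def exp_minus field_simps)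
  ultimately have a: "M * exp (\<kappa> * x) \<le> 2 * \<delta>" by simp
  have "0 \<le> M" by (simp add: M_def)
  then have "M * 1 \<le> M * exp (\<kappa> * x)" using x \<kappa>0 by (intro mult_left_mono) auto
  then have "M \<le> 2 * \<delta>" using a by simp
  then have "M * exp (\<kappa> * t) \<le> 2 * \<delta> * exp (\<kappa> * t)" by simp
  then show ?thesis using M[OF t] by linarith
qed

text \<open>Integrating \<open>exp (\<kappa> t)\<close> gains a factor \<open>1 / \<kappa>\<close>,
  and \<open>\<kappa> = 2 (L + 1)\<close> beats the Lipschitz constant. The Lipschitz hypothesis is
  posed in the weighted norm because \<open>\<Psi> u t\<close> may depend on the history of
  \<open>u\<close>.\<close>

lemma integral_contraction:
  assumes b: "0 < b" and L: "0 \<le> L"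
    and cont: "\<And>u. continuous_on {0..b} u \<Longrightarrow> continuous_on {0..b} (\<Psi> u)"
    and lip: "\<And>u v M \<kappa> t. continuous_on {0..b} u \<Longrightarrow> continuous_on {0..b} v \<Longrightarrow> 0 \<le> \<kappa> \<Longrightarrow> 0 \<le> M \<Longrightarrow>
       (\<And>t. t \<in> {0..b} \<Longrightarrow> \<bar>u t - v t\<bar> \<le> M * exp (\<kappa> * t)) \<Longrightarrow> t \<in> {0..b} \<Longrightarrow>
       \<bar>\<Psi> u t - \<Psi> v t\<bar> \<le> L * M * exp (\<kappa> * t)"
  shows "\<exists>\<kappa>. \<forall>a. weight_contraction (\<lambda>u \<theta>. a + integral {0..\<theta>} (\<Psi> u)) \<kappa> b"
proof -
  define \<kappa> where "\<kappa> = 2 * (L + 1)"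
  have \<kappa>: "0 < \<kappa>" using L by (simp add: \<kappa>_def)
  have "weight_contraction (\<lambda>u \<theta>. a + integral {0..\<theta>} (\<Psi> u)) \<kappa> b" for a
    unfolding weight_contraction_def
  proof (intro conjI allI impI ballI)
    fix u v M \<theta>
    assume u: "continuous_on {0..b} u" and v: "continuous_on {0..b} v"
      and uv: "\<forall>t\<in>{0..b}. \<bar>u t - v t\<bar> \<le> M * exp (\<kappa> * t)" and t: "\<theta> \<in> {0..b}"
    have "0 \<le> \<bar>u 0 - v 0\<bar>" by simp
    also have "\<dots> \<le> M" using uv b by (auto dest!: bspec[of _ _ 0])
    finally have M: "0 \<le> M" .
    have c1: "continuous_on {0..\<theta>} (\<Psi> w)" if "continuous_on {0..b} w" for w
      by (rule continuous_on_subset[OF cont[OF that]]) (use t in auto)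
    have s: "\<bar>\<Psi> u t - \<Psi> v t\<bar> \<le> L * M * exp (\<kappa> * t)" if "t \<in> {0..b}" for t
      by (rule lip[OF u v]) (use uv that \<kappa> M in auto)
    have "\<bar>integral {0..\<theta>} (\<Psi> u) - integral {0..\<theta>} (\<Psi> v)\<bar> = norm (integral {0..\<theta>} (\<lambda>t. \<Psi> u t - \<Psi> v t))"
      by (subst Henstock_Kurzweil_Integration.integral_diff)
         (auto intro!: integrable_continuous_real c1 u v)
    also have "\<dots> \<le> integral {0..\<theta>} (\<lambda>t. L * M * exp (\<kappa> * t))"
      by (rule integral_norm_bound_integral)
         (use t s in \<open>auto intro!: integrable_continuous_real continuous_intros c1 u v\<close>)
    also have "\<dots> = L * M / \<kappa> * exp (\<kappa> * \<theta>) - L * M / \<kappa> * exp (\<kappa> * 0)"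
    proof (rule integral_unique, rule fundamental_theorem_of_calculus)
      show "((\<lambda>t. L * M / \<kappa> * exp (\<kappa> * t)) has_vector_derivative L * M * exp (\<kappa> * x)) (at x within {0..\<theta>})" for x
        unfolding has_real_derivative_iff_has_vector_derivative[symmetric]
        using \<kappa> by (auto intro!: derivative_eq_intros)
    qed (use t in auto)
    also have "\<dots> \<le> L * M / \<kappa> * exp (\<kappa> * \<theta>)" using L M \<kappa> by simp
    also have "\<dots> \<le> M / 2 * exp (\<kappa> * \<theta>)"
    proof (rule mult_right_mono)
      have "L * M \<le> (L + 1) * M" using M by (simp add: algebra_simps)
      then show "L * M / \<kappa> \<le> M / 2" using \<kappa> by (simp add: \<kappa>_def field_simps)
    qed simp
    finally show "\<bar>a + integral {0..\<theta>} (\<Psi> u) - (a + integral {0..\<theta>} (\<Psi> v))\<bar> \<le> M / 2 * exp (\<kappa> * \<theta>)" by simp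
  qed (use \<kappa> in simp)
  then show ?thesis by blast
qed

section \<open>Averages against powers of the sine\<close>

text \<open>From \<open>sin \<theta> = 2 sin (\<theta> / 2) cos (\<theta> / 2)\<close> and
  \<open>y cos y \<le> sin y\<close>; the slope \<open>c\<close> degenerates only as
  \<open>b\<close> tends to pi.\<close>

lemma sin_ge_linear:
  assumes "0 \<le> b" "b < pi"
  obtains c where "0 < c" "\<And>\<theta>. \<theta> \<in> {0..b} \<Longrightarrow> c * \<theta> \<le> sin \<theta>"
proof
  show "0 < (cos (b / 2))\<^sup>2" using assms cos_gt_zero_pi[of "b/2"] by simp
  fix \<theta> assume t: "\<theta> \<in> {0..b}"
  have c0: "0 < cos (b/2)" "cos (b/2) \<le> cos (\<theta>/2)"
    using assms t cos_gt_zero_pi[of "b/2"] by (auto intro!: cos_monotone_0_pi_le)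
  have tan: "\<theta>/2 * cos (\<theta>/2) \<le> sin (\<theta>/2)"
  proof (cases "\<theta> = 0")
    case False
    have "(\<lambda>x. sin x - x * cos x) 0 \<le> (\<lambda>x. sin x - x * cos x) (\<theta>/2)"
      by (rule DERIV_nonneg_imp_nondecreasing[where f="\<lambda>x. sin x - x * cos x"])
         (use t assms in \<open>auto intro!: exI derivative_eq_intros mult_nonneg_nonneg sin_ge_zero\<close>)
    then show ?thesis by simp
  qed simp
  have "(cos (b/2))\<^sup>2 \<le> (cos (\<theta>/2))\<^sup>2" using c0 by (intro power_mono) auto
  then have "(cos (b/2))\<^sup>2 * \<theta> \<le> (cos (\<theta>/2))\<^sup>2 * \<theta>" using t by (intro mult_right_mono) auto
  also have "\<dots> = 2 * ((\<theta>/2 * cos (\<theta>/2)) * cos (\<theta>/2))" by (simp add: power2_eq_square)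
  also have "\<dots> \<le> 2 * (sin (\<theta>/2) * cos (\<theta>/2))"
    using tan c0 by (intro mult_left_mono mult_right_mono) auto
  also have "\<dots> = sin \<theta>" using sin_double[of "\<theta>/2"] by simp
  finally show "(cos (b/2))\<^sup>2 * \<theta> \<le> sin \<theta>" .
qed

text \<open>The solution \<open>Y\<close> of \<open>(Y sin^n)' = f sin^(n - 1)\<close> that stays
  bounded at the north pole. The value at \<open>0\<close> is its limit there, so continuity of
  \<open>f\<close> is inherited up to the pole.\<close>

definition sin_avg :: "nat \<Rightarrow> (real \<Rightarrow> real) \<Rightarrow> real \<Rightarrow> real" where
  "sin_avg n f \<theta> = (if \<theta> = 0 then f 0 / n else integral {0..\<theta>} (\<lambda>t. sin t ^ (n - 1) * f t) / sin \<theta> ^ n)"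

lemma sin_avg_mult:
  assumes "1 \<le> n" "0 \<le> \<theta>" "\<theta> < pi"
  shows "sin \<theta> ^ n * sin_avg n f \<theta> = integral {0..\<theta>} (\<lambda>t. sin t ^ (n - 1) * f t)"
  using assms sin_gt_zero[of \<theta>] by (auto simp: sin_avg_def)

lemma sin_avg_deriv:
  assumes n: "1 \<le> n" and f: "continuous_on {0..b} f" and t: "0 < \<theta>" "\<theta> < b" and b: "b \<le> pi"
  shows "((\<lambda>x. sin x ^ n * sin_avg n f x) has_real_derivative sin \<theta> ^ (n - 1) * f \<theta>) (at \<theta>)"
proof -
  have "((\<lambda>x. integral {0..x} (\<lambda>t. sin t ^ (n - 1) * f t)) has_real_derivative sin \<theta> ^ (n - 1) * f \<theta>)
     (at \<theta> within {0..b})"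
    by (rule integral_has_real_derivative) (use t in \<open>auto intro!: continuous_intros f\<close>)
  then have "((\<lambda>x. integral {0..x} (\<lambda>t. sin t ^ (n - 1) * f t)) has_real_derivative sin \<theta> ^ (n - 1) * f \<theta>)
     (at \<theta>)"
    using t by (simp add: at_within_Icc_at)
  then show ?thesis
    by (rule has_field_derivative_transform_within_open[where S="{0<..<b}"])
       (use t n b in \<open>auto simp: sin_avg_mult\<close>)
qed

text \<open>Away from \<open>0\<close> this is a quotient of continuous functions; at
  \<open>0\<close> l'Hospital reduces it to the limit of \<open>f / (n cos)\<close>.\<close>

lemma sin_avg_cont:
  assumes n: "1 \<le> n" and f: "continuous_on {0..b} f" and b: "0 < b" "b < pi"
  shows "continuous_on {0..b} (sin_avg n f)"
  unfolding continuous_on_eq_continuous_within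
proof
  define I where "I x = integral {0..x} (\<lambda>t. sin t ^ (n - 1) * f t)" for x
  have fi: "continuous_on {0..b} (\<lambda>t. sin t ^ (n - 1) * f t)"
    by (intro continuous_intros f)
  have I: "continuous_on {0..b} I"
    unfolding I_def by (rule indefinite_integral_continuous_1) (rule integrable_continuous_real[OF fi])
  fix t assume t: "t \<in> {0..b}"
  show "continuous (at t within {0..b}) (sin_avg n f)"
  proof (cases "t = 0")
    case False
    have "continuous_on {0<..b} (\<lambda>\<theta>. I \<theta> / sin \<theta> ^ n)"
    proof (intro continuous_intros continuous_on_subset[OF I])
      show "\<forall>x\<in>{0<..b}. sin x ^ n \<noteq> 0" using b sin_gt_zero by force
    qed auto
    then have "continuous_on {0<..b} (sin_avg n f)"
      by (rule continuous_on_eq) (auto simp: sin_avg_def I_def)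
    then have "continuous (at t within {0<..b}) (sin_avg n f)"
      using False t by (auto simp: continuous_on_eq_continuous_within)
    moreover have "at t within {0<..b} = at t within {0..b}"
      by (rule at_within_nhd[of _ "{0<..}"]) (use t False in auto)
    ultimately show ?thesis by simp
  next
    case True
    have at: "at 0 within {0..b} = at_right (0::real)" using b by (simp add: at_within_Icc_at_right)
    have f0: "(f \<longlongrightarrow> f 0) (at_right 0)"
      using f b by (auto simp: continuous_on_def at[symmetric])
    have "((\<lambda>x. I x / sin x ^ n) \<longlongrightarrow> f 0 / n) (at_right 0)"
    proof (rule lhopital_right_0)
      have "(I \<longlongrightarrow> I 0) (at_right 0)" using I b by (auto simp: continuous_on_def at[symmetric])
      then show "(I \<longlongrightarrow> 0) (at_right 0)" by (simp add: I_def)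
      show "((\<lambda>x::real. sin x ^ n) \<longlongrightarrow> 0) (at_right 0)"
        by (rule tendsto_eq_intros refl)+ (use n in auto)
      have ev: "eventually (\<lambda>x. 0 < x \<and> x < b \<and> x < pi/2) (at_right 0)"
        using eventually_at_right_real[OF b(1)] eventually_at_right_real[of 0 "pi/2"]
        by (auto elim: eventually_elim2)
      show "eventually (\<lambda>x::real. sin x ^ n \<noteq> 0) (at_right 0)"
        using ev by eventually_elim (use sin_gt_zero b in force)
      show "eventually (\<lambda>x. real n * sin x ^ (n - 1) * cos x \<noteq> 0) (at_right 0)"
        using ev
      proof eventually_elim
        case (elim x)
        then have "sin x > 0" "cos x > 0" using sin_gt_zero[of x] cos_gt_zero[of x] b by auto
        then show ?case using n by simp
      qed
      show "eventually (\<lambda>x. DERIV I x :> sin x ^ (n - 1) * f x) (at_right 0)"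
        using ev
      proof eventually_elim
        case (elim x)
        have "(I has_real_derivative sin x ^ (n - 1) * f x) (at x within {0..b})"
          unfolding I_def by (rule integral_has_real_derivative[OF fi]) (use elim in auto)
        then show ?case using elim by (simp add: at_within_Icc_at)
      qed
      show "eventually (\<lambda>x. DERIV (\<lambda>x. sin x ^ n) x :> real n * sin x ^ (n - 1) * cos x) (at_right 0)"
        by (intro always_eventually allI) (auto intro!: derivative_eq_intros)
      have "((\<lambda>x. f x / (real n * cos x)) \<longlongrightarrow> f 0 / n) (at_right 0)"
        by (rule tendsto_eq_intros f0 refl)+ (use n in auto)
      then show "((\<lambda>x. sin x ^ (n - 1) * f x / (real n * sin x ^ (n - 1) * cos x)) \<longlongrightarrow> f 0 / n) (at_right 0)"
      proof (rule Lim_transform_eventually)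
        show "eventually (\<lambda>x. f x / (real n * cos x) = sin x ^ (n - 1) * f x / (real n * sin x ^ (n - 1) * cos x)) (at_right 0)"
          using ev
        proof eventually_elim
          case (elim x)
          then have "sin x > 0" using sin_gt_zero[of x] b by auto
          then show ?case by simp
        qed
      qed
    qed
    then have "(sin_avg n f \<longlongrightarrow> sin_avg n f 0) (at_right 0)"
    proof (rule Lim_transform_eventually[THEN tendsto_eq_rhs])
      show "eventually (\<lambda>x. I x / sin x ^ n = sin_avg n f x) (at_right 0)"
        using eventually_at_right_less[of 0]
        by eventually_elim (auto simp: sin_avg_def I_def)
    qed (simp add: sin_avg_def)
    then show ?thesis using True by (simp add: continuous_within at)
  qed
qed

lemma sin_avg_cont_Ico:
  assumes "1 \<le> n" "continuous_on {0..<pi} f"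
  shows "continuous_on {0..<pi} (sin_avg n f)"
  by (rule continuous_on_Ico_if_Icc, rule sin_avg_cont)
     (use assms in \<open>auto elim: continuous_on_subset\<close>)

text \<open>The numerator is at most \<open>\<theta>^n M\<close> and \<open>sin\<close> is at least
  linear on \<open>{0..b}\<close>, so the singular denominator costs only a constant depending on
  \<open>b\<close>.\<close>

lemma sin_avg_bound:
  assumes n: "1 \<le> n" and b: "0 \<le> b" "b < pi"
  obtains C where "0 < C"
    "\<And>f M \<theta>. \<theta> \<in> {0..b} \<Longrightarrow> continuous_on {0..\<theta>} f \<Longrightarrow> (\<And>t. t \<in> {0..\<theta>} \<Longrightarrow> \<bar>f t\<bar> \<le> M)
      \<Longrightarrow> \<bar>sin_avg n f \<theta>\<bar> \<le> C * M"
proof -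
  obtain c where c: "0 < c" "\<And>\<theta>. \<theta> \<in> {0..b} \<Longrightarrow> c * \<theta> \<le> sin \<theta>" using sin_ge_linear[OF b] by blast
  \<comment> \<open>The summand 1 covers the value \<open>f 0 / n\<close> at the pole.\<close>
  define C where "C = 1 / c ^ n + 1"
  have C: "1 \<le> C" "1 / c ^ n \<le> C" using c by (auto simp: C_def)
  have "\<bar>sin_avg n f \<theta>\<bar> \<le> C * M"
    if t: "\<theta> \<in> {0..b}" and f: "continuous_on {0..\<theta>} f" and M: "\<And>t. t \<in> {0..\<theta>} \<Longrightarrow> \<bar>f t\<bar> \<le> M" for f M \<theta>
  proof (cases "\<theta> = 0")
    case True
    have "\<bar>f 0\<bar> \<le> M" using M[of 0] t by auto
    moreover have "\<bar>f 0 / n\<bar> \<le> \<bar>f 0\<bar>" using n mult_right_mono[of 1 "real n" "\<bar>f 0\<bar>"] by (simp add: divide_le_eq mult.commute)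
    moreover have "M \<le> C * M" using C(1) \<open>\<bar>f 0\<bar> \<le> M\<close> mult_right_mono[of 1 C M] by auto
    ultimately show ?thesis using True by (simp add: sin_avg_def)
  next
    case False
    then have t0: "0 < \<theta>" using t by auto
    have M0: "0 \<le> M" using M[of 0] t by force
    have s0: "0 < sin \<theta>" using sin_gt_zero t t0 b by auto
    have "norm (integral {0..\<theta>} (\<lambda>t. sin t ^ (n - 1) * f t)) \<le> \<theta> ^ (n - 1) * M * (\<theta> - 0)"
    proof (rule integral_bound)
      show "continuous_on {0..\<theta>} (\<lambda>t. sin t ^ (n - 1) * f t)" by (intro continuous_intros f)
      fix s assume s: "s \<in> {0..\<theta>}"
      have "0 \<le> sin s" using s t b by (intro sin_ge_zero) auto
      moreover have "sin s \<le> \<theta>" using sin_x_le_x[of s] s by auto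
      ultimately have "sin s ^ (n - 1) \<le> \<theta> ^ (n - 1)" by (intro power_mono)
      then show "norm (sin s ^ (n - 1) * f s) \<le> \<theta> ^ (n - 1) * M"
        using M[OF s] \<open>0 \<le> sin s\<close> t0 by (auto simp: abs_mult power_abs intro!: mult_mono)
    qed (use t0 in auto)
    also have "\<theta> ^ (n - 1) * M * (\<theta> - 0) = \<theta> ^ n * M"
      using n by (cases n) auto
    finally have "\<bar>sin_avg n f \<theta>\<bar> \<le> \<theta> ^ n * M / sin \<theta> ^ n"
      using False s0 by (simp add: sin_avg_def abs_divide power_abs divide_right_mono)
    also have "\<dots> \<le> \<theta> ^ n * M / (c * \<theta>) ^ n"
      using c t t0 M0 by (intro divide_left_mono power_mono) (auto intro!: mult_pos_pos zero_less_power s0)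
    also have "\<dots> = 1 / c ^ n * M" using t0 by (simp add: power_mult_distrib)
    also have "\<dots> \<le> C * M" using C M0 by (intro mult_right_mono)
    finally show ?thesis .
  qed
  then show ?thesis using that[of C] C by auto
qed

lemma sin_avg_cong:
  assumes "\<And>t. t \<in> {0..\<theta>} \<Longrightarrow> f t = f' t" "0 \<le> \<theta>"
  shows "sin_avg n f \<theta> = sin_avg n f' \<theta>"
  using assms by (auto simp: sin_avg_def intro!: arg_cong2[where f="(/)"] integral_cong)

lemma sin_avg_diff:
  assumes "continuous_on {0..\<theta>} f" "continuous_on {0..\<theta>} f'" "0 \<le> \<theta>"
  shows "sin_avg n (\<lambda>t. f t - f' t) \<theta> = sin_avg n f \<theta> - sin_avg n f' \<theta>"
proof (cases "\<theta> = 0")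
  case False
  have "integral {0..\<theta>} (\<lambda>t. sin t ^ (n - 1) * f t - sin t ^ (n - 1) * f' t)
      = integral {0..\<theta>} (\<lambda>t. sin t ^ (n - 1) * f t) - integral {0..\<theta>} (\<lambda>t. sin t ^ (n - 1) * f' t)"
    by (intro Henstock_Kurzweil_Integration.integral_diff integrable_continuous_real continuous_intros assms)
  then show ?thesis using False by (simp add: sin_avg_def diff_divide_distrib right_diff_distrib)
qed (simp add: sin_avg_def diff_divide_distrib)

lemma sin_avg_cmult: "sin_avg n (\<lambda>t. c * f t) \<theta> = c * sin_avg n f \<theta>"
proof -
  have "(\<lambda>t. sin t ^ (n - 1) * (c * f t)) = (\<lambda>t. c * (sin t ^ (n - 1) * f t))" by (simp add: mult_ac)
  then show ?thesis by (simp add: sin_avg_def)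
qed

text \<open>Two solutions multiplied by \<open>sin^n\<close> differ by a constant, which is
  \<open>0\<close> at the pole; the singular solutions, multiples of \<open>1 / sin^n\<close>, are
  excluded by continuity of \<open>Y\<close>. The value at \<open>0\<close> itself follows as a
  limit.\<close>

lemma sin_avg_unique:
  assumes n: "1 \<le> n" and b: "0 < b" "b < pi" and f: "continuous_on {0..b} f" and Y: "continuous_on {0..b} Y"
    and d: "\<And>\<theta>. 0 < \<theta> \<Longrightarrow> \<theta> < b \<Longrightarrow> ((\<lambda>x. sin x ^ n * Y x) has_real_derivative sin \<theta> ^ (n - 1) * f \<theta>) (at \<theta>)"
    and t: "\<theta> \<in> {0..b}"
  shows "Y \<theta> = sin_avg n f \<theta>"
proof -
  have eq: "Y x = sin_avg n f x" if x: "0 < x" "x \<le> b" for x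
  proof -
    have "(\<lambda>x. sin x ^ n * Y x - sin x ^ n * sin_avg n f x) x = (\<lambda>x. sin x ^ n * Y x - sin x ^ n * sin_avg n f x) 0"
    proof (rule DERIV_isconst2[OF b(1)])
      show "continuous_on {0..b} (\<lambda>x. sin x ^ n * Y x - sin x ^ n * sin_avg n f x)"
        by (intro continuous_intros Y sin_avg_cont[OF n f b])
      fix y assume "0 < y" "y < b"
      then show "DERIV (\<lambda>x. sin x ^ n * Y x - sin x ^ n * sin_avg n f x) y :> 0"
        using DERIV_diff[OF d[of y] sin_avg_deriv[OF n f, of y]] b by auto
    qed (use x in auto)
    moreover have "sin x > 0" using x b by (intro sin_gt_zero) auto
    moreover have "(0::real) ^ n = 0" using n by simp
    ultimately show ?thesis by simp
  qed
  have "continuous_on {0..b} (\<lambda>x. Y x - sin_avg n f x)" by (intro continuous_intros Y sin_avg_cont[OF n f b])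
  then have "((\<lambda>x. Y x - sin_avg n f x) \<longlongrightarrow> Y 0 - sin_avg n f 0) (at_right 0)"
    using b by (auto simp: continuous_on_def at_within_Icc_at_right dest!: bspec[of _ _ 0])
  moreover have "((\<lambda>x. Y x - sin_avg n f x) \<longlongrightarrow> 0) (at_right 0)"
    by (rule tendsto_eventually) (use eventually_at_right_real[OF b(1)] in eventually_elim, use eq in auto)
  ultimately have "Y 0 - sin_avg n f 0 = 0" by (rule tendsto_unique[rotated]) simp
  then show ?thesis using eq[of \<theta>] t by (cases "\<theta> = 0") auto
qed

text \<open>The operator integrates \<open>(sin^n (u' / sin))' = sin^(n - 1) \<Phi> u\<close> twice
  from the pole with \<open>u 0 = a\<close>. The factor \<open>sin t\<close> is at most 1, and the
  average loses only the constant of \<open>sin_avg_bound\<close>.\<close>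

lemma sin_avg_volterra_contraction:
  assumes n: "1 \<le> n" and b: "0 < b" "b < pi" and L: "0 \<le> L"
    and cont: "\<And>u. continuous_on {0..b} u \<Longrightarrow> continuous_on {0..b} (\<Phi> u)"
    and lip: "\<And>u v M \<kappa> t. continuous_on {0..b} u \<Longrightarrow> continuous_on {0..b} v \<Longrightarrow> 0 \<le> \<kappa> \<Longrightarrow> 0 \<le> M \<Longrightarrow>
       (\<And>t. t \<in> {0..b} \<Longrightarrow> \<bar>u t - v t\<bar> \<le> M * exp (\<kappa> * t)) \<Longrightarrow> t \<in> {0..b} \<Longrightarrow>
       \<bar>\<Phi> u t - \<Phi> v t\<bar> \<le> L * M * exp (\<kappa> * t)"
  shows "\<exists>\<kappa>. \<forall>a. weight_contraction (\<lambda>u \<theta>. a + integral {0..\<theta>} (\<lambda>t. sin t * sin_avg n (\<Phi> u) t)) \<kappa> b"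
proof -
  obtain C where C: "0 < C"
    "\<And>f M \<theta>. \<theta> \<in> {0..b} \<Longrightarrow> continuous_on {0..\<theta>} f \<Longrightarrow> (\<And>t. t \<in> {0..\<theta>} \<Longrightarrow> \<bar>f t\<bar> \<le> M)
      \<Longrightarrow> \<bar>sin_avg n f \<theta>\<bar> \<le> C * M"
    using sin_avg_bound[OF n, of b] b by auto
  show ?thesis
  proof (rule integral_contraction[OF b(1), of "C * L" "\<lambda>u t. sin t * sin_avg n (\<Phi> u) t"])
    show "continuous_on {0..b} (\<lambda>t. sin t * sin_avg n (\<Phi> u) t)" if "continuous_on {0..b} u" for u
      by (intro continuous_intros sin_avg_cont[OF n cont[OF that] b])
    fix u v M \<kappa> and t :: real
    assume u: "continuous_on {0..b} u" and v: "continuous_on {0..b} v" and \<kappa>: "0 \<le> \<kappa>" and M: "0 \<le> M"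
      and uv: "\<And>t. t \<in> {0..b} \<Longrightarrow> \<bar>u t - v t\<bar> \<le> M * exp (\<kappa> * t)" and t: "t \<in> {0..b}"
    have "\<bar>sin_avg n (\<lambda>s. \<Phi> u s - \<Phi> v s) t\<bar> \<le> C * (L * M * exp (\<kappa> * t))"
    proof (rule C(2)[OF t])
      show "continuous_on {0..t} (\<lambda>s. \<Phi> u s - \<Phi> v s)"
        by (rule continuous_on_subset[of "{0..b}"]) (use t u v in \<open>auto intro!: continuous_intros cont\<close>)
      fix s assume s: "s \<in> {0..t}"
      have "\<bar>\<Phi> u s - \<Phi> v s\<bar> \<le> L * M * exp (\<kappa> * s)"
        by (rule lip[OF u v \<kappa> M uv]) (use s t in auto)
      also have "\<dots> \<le> L * M * exp (\<kappa> * t)"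
        using s \<kappa> L M by (intro mult_left_mono) (auto intro: mult_left_mono)
      finally show "\<bar>\<Phi> u s - \<Phi> v s\<bar> \<le> L * M * exp (\<kappa> * t)" .
    qed
    moreover have "sin_avg n (\<lambda>s. \<Phi> u s - \<Phi> v s) t = sin_avg n (\<Phi> u) t - sin_avg n (\<Phi> v) t"
      by (rule sin_avg_diff) (use t u v in \<open>auto intro: continuous_on_subset[OF cont]\<close>)
    moreover have "\<bar>sin t\<bar> * \<bar>sin_avg n (\<Phi> u) t - sin_avg n (\<Phi> v) t\<bar> \<le> 1 * \<bar>sin_avg n (\<Phi> u) t - sin_avg n (\<Phi> v) t\<bar>"
      by (intro mult_right_mono) auto
    ultimately show "\<bar>sin t * sin_avg n (\<Phi> u) t - sin t * sin_avg n (\<Phi> v) t\<bar> \<le> C * L * M * exp (\<kappa> * t)"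
      by (simp add: abs_mult right_diff_distrib[symmetric] mult_ac)
  qed (use C(1) L in simp)
qed

lemma sin_avg_volterra_cont:
  assumes n: "1 \<le> n" and f: "continuous_on {0..<pi} f"
  shows "continuous_on {0..<pi} (\<lambda>\<theta>. a + integral {0..\<theta>} (\<lambda>t. sin t * sin_avg n f t))"
proof (rule continuous_on_Ico_if_Icc)
  fix b :: real assume b: "0 < b" "b < pi"
  have "continuous_on {0..b} (sin_avg n f)"
    by (rule continuous_on_subset[OF sin_avg_cont_Ico[OF n f]]) (use b in auto)
  then show "continuous_on {0..b} (\<lambda>\<theta>. a + integral {0..\<theta>} (\<lambda>t. sin t * sin_avg n f t))"
    by (intro continuous_intros indefinite_integral_continuous_1 integrable_continuous_real)
qed

section \<open>The profile equation\<close>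

lemma powr_lipschitz:
  fixes x y e r :: real
  assumes "0 < e" "e \<le> x" "e \<le> y" "r \<le> 1"
  shows "\<bar>x powr r - y powr r\<bar> \<le> \<bar>r\<bar> * e powr (r - 1) * \<bar>x - y\<bar>"
proof -
  have *: "\<bar>x powr r - y powr r\<bar> \<le> \<bar>r\<bar> * e powr (r - 1) * \<bar>x - y\<bar>" if xy: "e \<le> y" "y < x" for x y
  proof -
    have "\<exists>z. z > y \<and> z < x \<and> x powr r - y powr r = (x - y) * (r * z powr (r - 1))"
      by (rule MVT2[OF xy(2)]) (use assms(1) xy in \<open>auto intro!: derivative_eq_intros simp: powr_diff\<close>)
    then obtain z where z: "y < z" "z < x" "x powr r - y powr r = (x - y) * (r * z powr (r - 1))" by blast
    have "z powr (r - 1) \<le> e powr (r - 1)"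
      by (rule powr_mono2') (use assms xy z in auto)
    then have "\<bar>x - y\<bar> * (\<bar>r\<bar> * z powr (r - 1)) \<le> \<bar>x - y\<bar> * (\<bar>r\<bar> * e powr (r - 1))"
      by (intro mult_left_mono) auto
    then show ?thesis using z(3) by (simp add: abs_mult mult_ac)
  qed
  consider "x = y" | "y < x" | "x < y" by linarith
  then show ?thesis using *[of y x] *[of x y] assms by cases (auto simp: abs_minus_commute)
qed

lemma max_powr_lipschitz:
  fixes x y e r :: real
  assumes "0 < e" "r \<le> 1"
  shows "\<bar>max x e powr r - max y e powr r\<bar> \<le> \<bar>r\<bar> * e powr (r - 1) * \<bar>x - y\<bar>"
proof -
  have "\<bar>max x e powr r - max y e powr r\<bar> \<le> \<bar>r\<bar> * e powr (r - 1) * \<bar>max x e - max y e\<bar>"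
    by (rule powr_lipschitz) (use assms in auto)
  also have "\<dots> \<le> \<bar>r\<bar> * e powr (r - 1) * \<bar>x - y\<bar>" by (intro mult_left_mono) auto
  finally show ?thesis .
qed

locale sphere_profile =
  fixes n :: nat and p :: real
  assumes n: "1 \<le> n" and p: "p < - 2 * real n - 5"
begin

text \<open>The system in integrated form: \<open>mean_source\<close> is \<open>g^n\<close>, and \<open>source\<close> is the right hand side of
  \<open>(q sin^n)' = sin^(n - 1) ((n - 1) g + h^(p - 1) g^(1 - n) - n h)\<close>. Both unknowns are truncated from below at
  \<open>e\<close>, which makes the nonlinearity globally Lipschitz.\<close>

definition mean_source :: "real \<Rightarrow> (real \<Rightarrow> real) \<Rightarrow> real \<Rightarrow> real" where
  "mean_source e h = sin_avg n (\<lambda>t. n * cos t * max (h t) e powr (p - 1))"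

definition reaction :: "real \<Rightarrow> real \<Rightarrow> real \<Rightarrow> real" where
  "reaction e x y = (real n - 1) * max y e powr (1 / n)
     + max x e powr (p - 1) * max y e powr ((1 - real n) / n) - real n * x"

definition source :: "real \<Rightarrow> (real \<Rightarrow> real) \<Rightarrow> real \<Rightarrow> real" where
  "source e h t = reaction e (h t) (mean_source e h t)"

lemma reaction_lipschitz:
  assumes e: "0 < e"
  obtains L where "0 < L" "\<And>x x' y y'. \<bar>reaction e x y - reaction e x' y'\<bar> \<le> L * (\<bar>x - x'\<bar> + \<bar>y - y'\<bar>)"
proof -
  define r1 r2 r3 where "r1 = 1 / real n" and "r2 = p - 1" and "r3 = (1 - real n) / real n"
  have r: "r1 \<le> 1" "r2 \<le> 1" "r3 \<le> 1" "r2 \<le> 0" "r3 \<le> 0"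
    using n p by (auto simp: r1_def r2_def r3_def divide_le_eq)
  define l where "l r = \<bar>r\<bar> * e powr (r - 1)" for r :: real
  have l0: "0 \<le> l r" for r by (simp add: l_def)
  have l: "\<bar>max x e powr r - max y e powr r\<bar> \<le> l r * \<bar>x - y\<bar>" if "r \<le> 1" for x y r
    using max_powr_lipschitz[OF e that] by (simp add: l_def)
  \<comment> \<open>The exponents \<open>p - 1\<close> and \<open>(1 - n) / n\<close> are not
    positive, so the truncated powers are bounded as well as Lipschitz; this makes their product
    Lipschitz on the whole plane.\<close>
  have bnd: "max x e powr r \<le> e powr r" if "r \<le> 0" for x r
    by (rule powr_mono2') (use e that in auto)
  define L where "L = (real n - 1) * l r1 + e powr r3 * l r2 + e powr r2 * l r3 + n"
  have "\<bar>reaction e x y - reaction e x' y'\<bar> \<le> L * (\<bar>x - x'\<bar> + \<bar>y - y'\<bar>)" for x x' y y'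
  proof -
    let ?f = "\<lambda>r x. max x e powr r"
    have "reaction e x y - reaction e x' y' = (real n - 1) * (?f r1 y - ?f r1 y')
       + (?f r2 x - ?f r2 x') * ?f r3 y + ?f r2 x' * (?f r3 y - ?f r3 y') - n * (x - x')"
      by (simp add: reaction_def r1_def r2_def r3_def algebra_simps)
    moreover have "\<bar>A + B + C - D\<bar> \<le> A' + B' + C' + D'"
      if "\<bar>A\<bar> \<le> A'" "\<bar>B\<bar> \<le> B'" "\<bar>C\<bar> \<le> C'" "\<bar>D\<bar> \<le> D'" for A B C D A' B' C' D' :: real
      using that by linarith
    moreover have "\<bar>(real n - 1) * (?f r1 y - ?f r1 y')\<bar> \<le> (real n - 1) * (l r1 * \<bar>y - y'\<bar>)"
      using l[OF r(1), of y y'] n by (auto simp: abs_mult intro!: mult_left_mono)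
    moreover have "\<bar>(?f r2 x - ?f r2 x') * ?f r3 y\<bar> \<le> (l r2 * \<bar>x - x'\<bar>) * e powr r3"
      using l[OF r(2), of x x'] bnd[OF r(5), of y] l0 by (auto simp: abs_mult intro!: mult_mono)
    moreover have "\<bar>?f r2 x' * (?f r3 y - ?f r3 y')\<bar> \<le> e powr r2 * (l r3 * \<bar>y - y'\<bar>)"
      using l[OF r(3), of y y'] bnd[OF r(4), of x'] l0 by (auto simp: abs_mult intro!: mult_mono)
    moreover have "\<bar>n * (x - x')\<bar> \<le> n * \<bar>x - x'\<bar>" by (simp add: abs_mult)
    ultimately have "\<bar>reaction e x y - reaction e x' y'\<bar> \<le> (real n - 1) * (l r1 * \<bar>y - y'\<bar>)
       + (l r2 * \<bar>x - x'\<bar>) * e powr r3 + e powr r2 * (l r3 * \<bar>y - y'\<bar>) + n * \<bar>x - x'\<bar>" by presburger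
    also have "\<dots> \<le> L * (\<bar>x - x'\<bar> + \<bar>y - y'\<bar>)"
    proof -
      have "0 \<le> (real n - 1) * l r1 * \<bar>x - x'\<bar> + e powr r3 * l r2 * \<bar>y - y'\<bar>
         + e powr r2 * l r3 * \<bar>x - x'\<bar> + n * \<bar>y - y'\<bar>"
        using n l0 by (intro add_nonneg_nonneg mult_nonneg_nonneg) auto
      also have "\<dots> = L * (\<bar>x - x'\<bar> + \<bar>y - y'\<bar>) - ((real n - 1) * (l r1 * \<bar>y - y'\<bar>)
         + (l r2 * \<bar>x - x'\<bar>) * e powr r3 + e powr r2 * (l r3 * \<bar>y - y'\<bar>) + n * \<bar>x - x'\<bar>)"
        by (simp add: L_def algebra_simps)
      finally show ?thesis by simp
    qed
    finally show ?thesis .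
  qed
  moreover have "0 \<le> (real n - 1) * l r1" "0 \<le> e powr r3 * l r2" "0 \<le> e powr r2 * l r3"
    using n l0 by simp_all
  then have "0 < L" using n unfolding L_def by linarith
  ultimately show ?thesis using that[of L] by blast
qed

lemma mean_source_cont:
  assumes "0 < e" "0 < b" "b < pi" "continuous_on {0..b} h"
  shows "continuous_on {0..b} (mean_source e h)"
  unfolding mean_source_def
  by (rule sin_avg_cont[OF n]) (use assms in \<open>auto intro!: continuous_intros\<close>)

lemma reaction_cont:
  assumes e: "0 < e" and f: "continuous_on S f" and g: "continuous_on S g"
  shows "continuous_on S (\<lambda>x. reaction e (f x) (g x))"
  unfolding reaction_def using e by (intro continuous_intros f g) auto

lemma source_cont:
  assumes "0 < e" "0 < b" "b < pi" "continuous_on {0..b} h"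
  shows "continuous_on {0..b} (source e h)"
  unfolding source_def by (intro reaction_cont mean_source_cont assms)

lemma source_cont_Ico:
  assumes "0 < e" "continuous_on {0..<pi} h"
  shows "continuous_on {0..<pi} (source e h)"
  by (rule continuous_on_Ico_if_Icc, rule source_cont)
     (use assms in \<open>auto elim: continuous_on_subset\<close>)

lemma mean_source_lipschitz:
  assumes e: "0 < e" and b: "0 < b" "b < pi"
  obtains L where "0 < L"
    "\<And>u v M \<theta>. continuous_on {0..b} u \<Longrightarrow> continuous_on {0..b} v \<Longrightarrow> \<theta> \<in> {0..b} \<Longrightarrow>
       (\<And>t. t \<in> {0..\<theta>} \<Longrightarrow> \<bar>u t - v t\<bar> \<le> M) \<Longrightarrow> \<bar>mean_source e u \<theta> - mean_source e v \<theta>\<bar> \<le> L * M"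
proof -
  obtain C where C: "0 < C"
    "\<And>f M \<theta>. \<theta> \<in> {0..b} \<Longrightarrow> continuous_on {0..\<theta>} f \<Longrightarrow> (\<And>t. t \<in> {0..\<theta>} \<Longrightarrow> \<bar>f t\<bar> \<le> M)
      \<Longrightarrow> \<bar>sin_avg n f \<theta>\<bar> \<le> C * M"
    using sin_avg_bound[OF n, of b] b by auto
  define l where "l = \<bar>p - 1\<bar> * e powr (p - 1 - 1)"
  have l: "0 < l" using e p by (auto simp: l_def)
  have "\<bar>mean_source e u \<theta> - mean_source e v \<theta>\<bar> \<le> (C * n * l) * M"
    if u: "continuous_on {0..b} u" and v: "continuous_on {0..b} v" and t: "\<theta> \<in> {0..b}"
    and uv: "\<And>t. t \<in> {0..\<theta>} \<Longrightarrow> \<bar>u t - v t\<bar> \<le> M" for u v M \<theta>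
  proof -
    let ?f = "\<lambda>h t. n * cos t * max (h t) e powr (p - 1)"
    have c: "continuous_on {0..\<theta>} (?f w)" if "continuous_on {0..b} w" for w
      by (rule continuous_on_subset[of "{0..b}"]) (use that t e in \<open>auto intro!: continuous_intros\<close>)
    have "mean_source e u \<theta> - mean_source e v \<theta> = sin_avg n (\<lambda>t. ?f u t - ?f v t) \<theta>"
      unfolding mean_source_def using t by (subst sin_avg_diff) (auto intro: c u v)
    also have "\<bar>\<dots>\<bar> \<le> C * (n * (l * M))"
    proof (rule C(2)[OF t])
      show "continuous_on {0..\<theta>} (\<lambda>t. ?f u t - ?f v t)" by (intro continuous_on_diff c u v)
      fix t assume t: "t \<in> {0..\<theta>}"
      have "?f u t - ?f v t = n * (cos t * (max (u t) e powr (p - 1) - max (v t) e powr (p - 1)))"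
        by (simp add: algebra_simps)
      also have "\<bar>\<dots>\<bar> = n * (\<bar>cos t\<bar> * \<bar>max (u t) e powr (p - 1) - max (v t) e powr (p - 1)\<bar>)"
        by (simp add: abs_mult)
      also have "\<dots> \<le> n * (1 * (l * M))"
      proof (intro mult_left_mono mult_mono)
        have "\<bar>max (u t) e powr (p - 1) - max (v t) e powr (p - 1)\<bar> \<le> l * \<bar>u t - v t\<bar>"
          unfolding l_def by (rule max_powr_lipschitz) (use e p in auto)
        also have "\<dots> \<le> l * M" using uv[OF t] l by (intro mult_left_mono) auto
        finally show "\<bar>max (u t) e powr (p - 1) - max (v t) e powr (p - 1)\<bar> \<le> l * M" .
      qed auto
      finally show "\<bar>?f u t - ?f v t\<bar> \<le> n * (l * M)" by simp
    qed
    finally show ?thesis by (simp add: mult_ac)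
  qed
  moreover have "0 < C * n * l" using C l n by simp
  ultimately show ?thesis using that by blast
qed

lemma source_lipschitz:
  assumes e: "0 < e" and b: "0 < b" "b < pi"
  obtains L where "0 < L"
    "\<And>u v M \<theta>. continuous_on {0..b} u \<Longrightarrow> continuous_on {0..b} v \<Longrightarrow> \<theta> \<in> {0..b} \<Longrightarrow>
       (\<And>t. t \<in> {0..\<theta>} \<Longrightarrow> \<bar>u t - v t\<bar> \<le> M) \<Longrightarrow> \<bar>source e u \<theta> - source e v \<theta>\<bar> \<le> L * M"
proof -
  obtain L1 where L1: "0 < L1" "\<And>x x' y y'. \<bar>reaction e x y - reaction e x' y'\<bar> \<le> L1 * (\<bar>x - x'\<bar> + \<bar>y - y'\<bar>)"
    using reaction_lipschitz[OF e] by blast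
  obtain L2 where L2: "0 < L2"
    "\<And>u v M \<theta>. continuous_on {0..b} u \<Longrightarrow> continuous_on {0..b} v \<Longrightarrow> \<theta> \<in> {0..b} \<Longrightarrow>
       (\<And>t. t \<in> {0..\<theta>} \<Longrightarrow> \<bar>u t - v t\<bar> \<le> M) \<Longrightarrow> \<bar>mean_source e u \<theta> - mean_source e v \<theta>\<bar> \<le> L2 * M"
    using mean_source_lipschitz[OF e b] by blast
  have "\<bar>source e u \<theta> - source e v \<theta>\<bar> \<le> L1 * (1 + L2) * M"
    if u: "continuous_on {0..b} u" and v: "continuous_on {0..b} v" and t: "\<theta> \<in> {0..b}"
    and uv: "\<And>t. t \<in> {0..\<theta>} \<Longrightarrow> \<bar>u t - v t\<bar> \<le> M" for u v M \<theta>
  proof -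
    have "\<bar>source e u \<theta> - source e v \<theta>\<bar> \<le> L1 * (\<bar>u \<theta> - v \<theta>\<bar> + \<bar>mean_source e u \<theta> - mean_source e v \<theta>\<bar>)"
      unfolding source_def by (rule L1)
    also have "\<dots> \<le> L1 * (M + L2 * M)"
      using L1(1) uv[of \<theta>] t by (intro mult_left_mono add_mono L2(2)[OF u v t uv]) auto
    finally show ?thesis by (simp add: algebra_simps)
  qed
  moreover have "0 < L1 * (1 + L2)" using L1 L2 by simp
  ultimately show ?thesis using that by blast
qed

text \<open>The equation \<open>h' = q sin\<close>, \<open>h 0 = a\<close> in integrated form, with
  \<open>q\<close> already solved for as an average.\<close>

definition profile_op :: "real \<Rightarrow> real \<Rightarrow> (real \<Rightarrow> real) \<Rightarrow> real \<Rightarrow> real" where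
  "profile_op e a h \<theta> = a + integral {0..\<theta>} (\<lambda>t. sin t * sin_avg n (source e h) t)"

lemma profile_op_contraction:
  assumes e: "0 < e" and b: "0 < b" "b < pi"
  obtains \<kappa> where "0 \<le> \<kappa>" "\<And>a. weight_contraction (profile_op e a) \<kappa> b"
proof -
  obtain L where L: "0 < L"
    "\<And>u v M \<theta>. continuous_on {0..b} u \<Longrightarrow> continuous_on {0..b} v \<Longrightarrow> \<theta> \<in> {0..b} \<Longrightarrow>
       (\<And>t. t \<in> {0..\<theta>} \<Longrightarrow> \<bar>u t - v t\<bar> \<le> M) \<Longrightarrow> \<bar>source e u \<theta> - source e v \<theta>\<bar> \<le> L * M"
    using source_lipschitz[OF e b] by blast
  have "\<exists>\<kappa>. \<forall>a. weight_contraction (\<lambda>u \<theta>. a + integral {0..\<theta>} (\<lambda>t. sin t * sin_avg n (source e u) t)) \<kappa> b"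
  proof (rule sin_avg_volterra_contraction[OF n b, of L])
    fix u v M \<kappa> t
    assume u: "continuous_on {0..b} u" and v: "continuous_on {0..b} v" and "0 \<le> (\<kappa>::real)" "0 \<le> M"
      and uv: "\<And>t. t \<in> {0..b} \<Longrightarrow> \<bar>u t - v t\<bar> \<le> M * exp (\<kappa> * t)" and t: "t \<in> {0..b}"
    have "\<bar>source e u t - source e v t\<bar> \<le> L * (M * exp (\<kappa> * t))"
    proof (rule L(2)[OF u v t])
      fix s assume s: "s \<in> {0..t}"
      have "\<bar>u s - v s\<bar> \<le> M * exp (\<kappa> * s)" using uv s t by auto
      also have "\<dots> \<le> M * exp (\<kappa> * t)" using s \<open>0 \<le> \<kappa>\<close> \<open>0 \<le> M\<close> by (intro mult_left_mono) (auto intro: mult_left_mono)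
      finally show "\<bar>u s - v s\<bar> \<le> M * exp (\<kappa> * t)" .
    qed
    then show "\<bar>source e u t - source e v t\<bar> \<le> L * M * exp (\<kappa> * t)" by (simp add: mult_ac)
  qed (use L e b in \<open>auto intro: source_cont\<close>)
  then obtain \<kappa> where "\<forall>a. weight_contraction (\<lambda>u \<theta>. a + integral {0..\<theta>} (\<lambda>t. sin t * sin_avg n (source e u) t)) \<kappa> b" ..
  then have \<kappa>: "weight_contraction (profile_op e a) \<kappa> b" for a
    by (simp add: profile_op_def[abs_def])
  moreover have "0 \<le> \<kappa>" using \<kappa>[of 0] by (simp add: weight_contraction_def)
  ultimately show ?thesis using that by blast
qed

text \<open>Since the truncated nonlinearity is globally Lipschitz, nothing stops the solution
  before the south pole.\<close>

lemma profile_op_fixpoint: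
  assumes "0 < e"
  shows "\<exists>h. continuous_on {0..<pi} h \<and> (\<forall>t\<in>{0..<pi}. profile_op e a h t = h t)"
proof -
  have c: "continuous_on {0..<pi} (profile_op e a u)" if "continuous_on {0..<pi} u" for u
    unfolding profile_op_def[abs_def]
    by (rule sin_avg_volterra_cont[OF n source_cont_Ico[OF assms that]])
  have k: "\<exists>\<kappa>. weight_contraction (profile_op e a) \<kappa> b" if "0 < b" "b < pi" for b
    using profile_op_contraction[OF assms that] by metis
  obtain u where "continuous_on {0..<pi} u" "\<And>t. t \<in> {0..<pi} \<Longrightarrow> profile_op e a u t = u t"
    by (rule weight_contraction_fixpoint[of pi "profile_op e a", OF c k]) (assumption+, rule that, auto)
  then show ?thesis by auto
qed

text \<open>Available for every \<open>a\<close> and on all of \<open>{0..<pi}\<close>, but tied to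
  the untruncated system only on intervals from \<open>0\<close> on which the truncation at
  \<open>e\<close> is inactive; see \<open>prof_is_sol\<close>.\<close>

definition prof :: "real \<Rightarrow> real \<Rightarrow> real \<Rightarrow> real" where
  "prof e a = (SOME h. continuous_on {0..<pi} h \<and> (\<forall>t\<in>{0..<pi}. profile_op e a h t = h t))"

definition slope :: "real \<Rightarrow> real \<Rightarrow> real \<Rightarrow> real" where
  "slope e a = sin_avg n (source e (prof e a))"

lemma prof_fix:
  assumes "0 < e"
  shows "continuous_on {0..<pi} (prof e a)" "t \<in> {0..<pi} \<Longrightarrow> profile_op e a (prof e a) t = prof e a t"
  using someI_ex[OF profile_op_fixpoint[OF assms, of a]] unfolding prof_def[symmetric] by auto

lemma prof_cont:
  assumes "0 < e" "b < pi"
  shows "continuous_on {0..b} (prof e a)"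
  by (rule continuous_on_subset[OF prof_fix(1)]) (use assms in auto)

lemma slope_cont_Ico:
  assumes "0 < e"
  shows "continuous_on {0..<pi} (slope e a)"
  unfolding slope_def by (rule sin_avg_cont_Ico[OF n source_cont_Ico[OF assms prof_fix(1)[OF assms]]])

lemma slope_cont:
  assumes "0 < e" "b < pi"
  shows "continuous_on {0..b} (slope e a)"
  by (rule continuous_on_subset[OF slope_cont_Ico]) (use assms in auto)

lemma prof_0: "0 < e \<Longrightarrow> prof e a 0 = a"
  using prof_fix(2)[of e 0 a] by (simp add: profile_op_def)

lemma prof_deriv:
  assumes e: "0 < e" and t: "0 < \<theta>" "\<theta> < pi"
  shows "(prof e a has_real_derivative slope e a \<theta> * sin \<theta>) (at \<theta>)"
proof -
  define b where "b = (\<theta> + pi) / 2"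
  have b: "0 < b" "\<theta> < b" "b < pi" using t by (auto simp: b_def)
  have "((\<lambda>x. a + integral {0..x} (\<lambda>t. sin t * sin_avg n (source e (prof e a)) t)) has_real_derivative
      0 + sin \<theta> * sin_avg n (source e (prof e a)) \<theta>) (at \<theta> within {0..b})"
    by (intro DERIV_add DERIV_const integral_has_real_derivative continuous_intros)
       (use b t slope_cont[OF e b(3)] in \<open>auto simp: slope_def\<close>)
  then have "((\<lambda>x. a + integral {0..x} (\<lambda>t. sin t * sin_avg n (source e (prof e a)) t)) has_real_derivative
      slope e a \<theta> * sin \<theta>) (at \<theta>)"
    using b t by (simp add: at_within_Icc_at slope_def mult.commute)
  then show ?thesis
    by (rule has_field_derivative_transform_within_open[where S="{0<..<pi}"])
       (use t prof_fix(2)[OF e] in \<open>auto simp: profile_op_def\<close>)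
qed

lemma prof_unique:
  assumes e: "0 < e" and b: "0 < b" "b < pi" and u: "continuous_on {0..b} u"
    and fp: "\<And>t. t \<in> {0..b} \<Longrightarrow> u t = profile_op e a u t" and t: "t \<in> {0..b}"
  shows "u t = prof e a t"
proof -
  obtain \<kappa> where \<kappa>: "\<And>a. weight_contraction (profile_op e a) \<kappa> b" using profile_op_contraction[OF e b] by blast
  have "\<bar>u t - prof e a t\<bar> \<le> 2 * 0 * exp (\<kappa> * t)"
  proof (rule weight_contraction_diff[OF \<kappa>[of a] less_imp_le[OF b(1)] u prof_cont[OF e b(2)] _ t])
    fix s assume "s \<in> {0..b}"
    then show "\<bar>u s - prof e a s\<bar> \<le> \<bar>profile_op e a u s - profile_op e a (prof e a) s\<bar> + 0"
      using fp prof_fix(2)[OF e] b by simp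
  qed
  then show ?thesis by simp
qed

lemma prof_lipschitz:
  assumes e: "0 < e" and b: "0 < b" "b < pi"
  obtains C where "0 < C"
    "\<And>a a' t. t \<in> {0..b} \<Longrightarrow> \<bar>prof e a t - prof e a' t\<bar> \<le> C * \<bar>a - a'\<bar>"
    "\<And>a a' t. t \<in> {0..b} \<Longrightarrow> \<bar>slope e a t - slope e a' t\<bar> \<le> C * \<bar>a - a'\<bar>"
    "\<And>a a' t. t \<in> {0..b} \<Longrightarrow> \<bar>mean_source e (prof e a) t - mean_source e (prof e a') t\<bar> \<le> C * \<bar>a - a'\<bar>"
proof -
  obtain \<kappa> where \<kappa>: "0 \<le> \<kappa>" "\<And>a. weight_contraction (profile_op e a) \<kappa> b"
    using profile_op_contraction[OF e b] by blast
  define C1 where "C1 = 2 * exp (\<kappa> * b)"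
  have 1: "\<bar>prof e a t - prof e a' t\<bar> \<le> C1 * \<bar>a - a'\<bar>" if t: "t \<in> {0..b}" for a a' t
  proof -
    have "\<bar>prof e a t - prof e a' t\<bar> \<le> 2 * \<bar>a - a'\<bar> * exp (\<kappa> * t)"
    proof (rule weight_contraction_diff[OF \<kappa>(2)[of 0] less_imp_le[OF b(1)] prof_cont[OF e b(2)] prof_cont[OF e b(2)] _ t])
      fix s assume s: "s \<in> {0..b}"
      \<comment> \<open>Profiles of different heights are fixed points of operators that differ by a
        constant, so both are compared under \<open>profile_op e 0\<close>, with the difference of
        the heights as defect.\<close>
      have "prof e a s - prof e a' s = (profile_op e 0 (prof e a) s - profile_op e 0 (prof e a') s) + (a - a')"
        using prof_fix(2)[OF e, of s a] prof_fix(2)[OF e, of s a'] b s by (simp add: profile_op_def)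
      then show "\<bar>prof e a s - prof e a' s\<bar> \<le> \<bar>profile_op e 0 (prof e a) s - profile_op e 0 (prof e a') s\<bar> + \<bar>a - a'\<bar>"
        by linarith
    qed
    also have "\<dots> \<le> 2 * \<bar>a - a'\<bar> * exp (\<kappa> * b)" using t \<kappa>(1) by (intro mult_left_mono) (auto intro: mult_left_mono)
    finally show ?thesis by (simp add: C1_def mult_ac)
  qed
  obtain L where L: "0 < L"
    "\<And>u v M \<theta>. continuous_on {0..b} u \<Longrightarrow> continuous_on {0..b} v \<Longrightarrow> \<theta> \<in> {0..b} \<Longrightarrow>
       (\<And>t. t \<in> {0..\<theta>} \<Longrightarrow> \<bar>u t - v t\<bar> \<le> M) \<Longrightarrow> \<bar>source e u \<theta> - source e v \<theta>\<bar> \<le> L * M"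
    using source_lipschitz[OF e b] by blast
  obtain L2 where L2: "0 < L2"
    "\<And>u v M \<theta>. continuous_on {0..b} u \<Longrightarrow> continuous_on {0..b} v \<Longrightarrow> \<theta> \<in> {0..b} \<Longrightarrow>
       (\<And>t. t \<in> {0..\<theta>} \<Longrightarrow> \<bar>u t - v t\<bar> \<le> M) \<Longrightarrow> \<bar>mean_source e u \<theta> - mean_source e v \<theta>\<bar> \<le> L2 * M"
    using mean_source_lipschitz[OF e b] by blast
  obtain K where K: "0 < K"
    "\<And>f M \<theta>. \<theta> \<in> {0..b} \<Longrightarrow> continuous_on {0..\<theta>} f \<Longrightarrow> (\<And>t. t \<in> {0..\<theta>} \<Longrightarrow> \<bar>f t\<bar> \<le> M)
      \<Longrightarrow> \<bar>sin_avg n f \<theta>\<bar> \<le> K * M"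
    using sin_avg_bound[OF n, of b] b by auto
  have C1: "0 < C1" by (simp add: C1_def)
  have 2: "\<bar>slope e a t - slope e a' t\<bar> \<le> K * L * C1 * \<bar>a - a'\<bar>" if t: "t \<in> {0..b}" for a a' t
  proof -
    have sc: "continuous_on {0..t} (source e (prof e a))" for a
      by (rule continuous_on_subset[OF source_cont[OF e b prof_cont[OF e b(2)]]]) (use t in auto)
    have "slope e a t - slope e a' t = sin_avg n (\<lambda>s. source e (prof e a) s - source e (prof e a') s) t"
      unfolding slope_def by (subst sin_avg_diff) (use t sc in auto)
    also have "\<bar>\<dots>\<bar> \<le> K * (L * (C1 * \<bar>a - a'\<bar>))"
      by (rule K(2)[OF t continuous_on_diff[OF sc sc]], rule L(2)[OF prof_cont[OF e b(2)] prof_cont[OF e b(2)]])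
         (use t 1 in auto)
    finally show ?thesis by (simp add: mult_ac)
  qed
  have 3: "\<bar>mean_source e (prof e a) t - mean_source e (prof e a') t\<bar> \<le> L2 * C1 * \<bar>a - a'\<bar>" if t: "t \<in> {0..b}" for a a' t
    using L2(2)[OF prof_cont[OF e b(2)] prof_cont[OF e b(2)] t, of a a' "C1 * \<bar>a - a'\<bar>"] 1 t by (auto simp: mult_ac)
  define C where "C = C1 + K * L * C1 + L2 * C1"
  have p3: "0 < K * L * C1" "0 < L2 * C1" using K L L2 C1 by auto
  have le: "C1 * x \<le> C * x" "K * L * C1 * x \<le> C * x" "L2 * C1 * x \<le> C * x" if "0 \<le> x" for x
    using that C1 p3 by (intro mult_right_mono; simp add: C_def)+
  show ?thesis
  proof (rule that[of C])
    show "0 < C" using C1 p3 by (simp add: C_def)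
    fix a a' t assume t: "t \<in> {0..b}"
    show "\<bar>prof e a t - prof e a' t\<bar> \<le> C * \<bar>a - a'\<bar>"
      using 1[OF t] le(1)[OF abs_ge_zero] by (rule order_trans)
    show "\<bar>slope e a t - slope e a' t\<bar> \<le> C * \<bar>a - a'\<bar>"
      using 2[OF t] le(2)[OF abs_ge_zero] by (rule order_trans)
    show "\<bar>mean_source e (prof e a) t - mean_source e (prof e a') t\<bar> \<le> C * \<bar>a - a'\<bar>"
      using 3[OF t] le(3)[OF abs_ge_zero] by (rule order_trans)
  qed
qed

end

lemma sin_pow_mult_deriv:
  assumes "1 \<le> n" "(f has_real_derivative f') (at x)"
  shows "((\<lambda>x. sin x ^ n * f x) has_real_derivative sin x ^ (n - 1) * (n * cos x * f x + sin x * f')) (at x)"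
proof -
  obtain m where m: "n = Suc m" using assms(1) by (cases n) auto
  show ?thesis by (rule derivative_eq_intros assms(2) refl)+ (simp add: m algebra_simps)
qed

lemma sin_pow_div_deriv:
  assumes n: "1 \<le> n" and x: "0 < x" "x < pi"
    and d: "((\<lambda>x. sin x ^ n * f x) has_real_derivative sin x ^ (n - 1) * d) (at x)"
  shows "(f has_real_derivative (d - n * cos x * f x) / sin x) (at x)"
proof -
  obtain m where m: "n = Suc m" using n by (cases n) auto
  have s: "0 < sin x" using x by (intro sin_gt_zero)
  have "((\<lambda>x. sin x ^ n * f x / sin x ^ n) has_real_derivative (d - n * cos x * f x) / sin x) (at x)"
    by (rule derivative_eq_intros d refl)+ (use s in \<open>auto simp: m field_simps\<close>)
  then show ?thesis
    by (rule has_field_derivative_transform_within_open[where S="{0<..<pi}"])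
       (use x sin_gt_zero in force)+
qed

context sphere_profile begin

abbreviation radius :: "(real \<Rightarrow> real) \<Rightarrow> (real \<Rightarrow> real) \<Rightarrow> real \<Rightarrow> real" where
  "radius h q x \<equiv> h x + q x * cos x"

abbreviation slope_rhs :: "(real \<Rightarrow> real) \<Rightarrow> (real \<Rightarrow> real) \<Rightarrow> real \<Rightarrow> real" where
  "slope_rhs h q x \<equiv> (h x powr (p - 1) * radius h q x powr (1 - real n) - radius h q x) / sin x"

text \<open>The equations are required only for \<open>0 < \<theta>\<close>, where the right-hand
  side makes sense; continuity of \<open>q\<close> at \<open>0\<close> is what rules out solutions
  singular at the pole.\<close>

definition is_sol :: "real \<Rightarrow> (real \<Rightarrow> real) \<Rightarrow> (real \<Rightarrow> real) \<Rightarrow> bool" where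
  "is_sol b h q \<longleftrightarrow> continuous_on {0..b} h \<and> continuous_on {0..b} q \<and>
     (\<forall>\<theta>\<in>{0..b}. 0 < h \<theta> \<and> 0 < radius h q \<theta>) \<and>
     (\<forall>\<theta>. 0 < \<theta> \<and> \<theta> < b \<longrightarrow> (h has_real_derivative q \<theta> * sin \<theta>) (at \<theta>) \<and>
        (q has_real_derivative slope_rhs h q \<theta>) (at \<theta>))"

lemma is_solD:
  assumes "is_sol b h q"
  shows "continuous_on {0..b} h" "continuous_on {0..b} q"
    "\<And>\<theta>. 0 \<le> \<theta> \<Longrightarrow> \<theta> \<le> b \<Longrightarrow> 0 < h \<theta>" "\<And>\<theta>. 0 \<le> \<theta> \<Longrightarrow> \<theta> \<le> b \<Longrightarrow> 0 < radius h q \<theta>"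
    "\<And>\<theta>. 0 < \<theta> \<Longrightarrow> \<theta> < b \<Longrightarrow> (h has_real_derivative q \<theta> * sin \<theta>) (at \<theta>)"
    "\<And>\<theta>. 0 < \<theta> \<Longrightarrow> \<theta> < b \<Longrightarrow> (q has_real_derivative slope_rhs h q \<theta>) (at \<theta>)"
  using assms by (auto simp: is_sol_def)

lemma is_sol_mono: "is_sol b h q \<Longrightarrow> b' \<le> b \<Longrightarrow> is_sol b' h q"
  by (auto simp: is_sol_def elim!: continuous_on_subset)

text \<open>In \<open>g'\<close> the term \<open>q sin\<close> from \<open>h'\<close> cancels the
  one from the derivative of \<open>cos\<close>, leaving \<open>q' cos\<close>; the factor
  \<open>g^(n - 1)\<close> then removes the power \<open>g^(1 - n)\<close>. The right-hand side
  contains neither \<open>q\<close> nor \<open>g\<close>, so bounds on \<open>h\<close> alone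
  control \<open>g\<close>.\<close>

lemma radius_power_deriv_at:
  assumes t: "0 < \<theta>" "\<theta> < pi"
    and dh: "(h has_real_derivative q \<theta> * sin \<theta>) (at \<theta>)"
    and dq: "(q has_real_derivative slope_rhs h q \<theta>) (at \<theta>)"
    and g0: "0 < radius h q \<theta>"
  shows "((\<lambda>x. sin x ^ n * radius h q x ^ n) has_real_derivative
     sin \<theta> ^ (n - 1) * (n * cos \<theta> * h \<theta> powr (p - 1))) (at \<theta>)"
proof -
  define g where "g = (\<lambda>x. radius h q x)"
  have s: "0 < sin \<theta>" using t by (intro sin_gt_zero) auto
  have g0: "0 < g \<theta>" using g0 by (simp add: g_def)
  obtain m where m: "n = Suc m" using n by (cases n) auto
  have gp: "g \<theta> ^ m * g \<theta> powr (1 - real n) = 1"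
    using g0 by (simp add: m powr_realpow[symmetric] powr_add[symmetric])
  have dg: "(g has_real_derivative cos \<theta> * (h \<theta> powr (p - 1) * g \<theta> powr (1 - real n) - g \<theta>) / sin \<theta>) (at \<theta>)"
    unfolding g_def by (rule derivative_eq_intros dh dq refl)+ (use s in \<open>simp add: field_simps\<close>)
  have d: "((\<lambda>x. (sin x * g x) ^ n) has_real_derivative
     n * (sin \<theta> * g \<theta>) ^ m * (cos \<theta> * g \<theta> + cos \<theta> * (h \<theta> powr (p - 1) * g \<theta> powr (1 - real n) - g \<theta>))) (at \<theta>)"
    by (rule derivative_eq_intros dg refl)+ (use s in \<open>simp add: m field_simps\<close>)
  have "n * (sin \<theta> * g \<theta>) ^ m * (cos \<theta> * g \<theta> + cos \<theta> * (h \<theta> powr (p - 1) * g \<theta> powr (1 - real n) - g \<theta>))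
      = n * sin \<theta> ^ m * cos \<theta> * h \<theta> powr (p - 1) * (g \<theta> ^ m * g \<theta> powr (1 - real n))"
    by (simp add: power_mult_distrib algebra_simps)
  also have "\<dots> = sin \<theta> ^ (n - 1) * (n * cos \<theta> * h \<theta> powr (p - 1))" using gp m by simp
  finally have "((\<lambda>x. (sin x * g x) ^ n) has_real_derivative sin \<theta> ^ (n - 1) * (n * cos \<theta> * h \<theta> powr (p - 1))) (at \<theta>)"
    using d by (simp only:)
  then show ?thesis by (simp only: g_def power_mult_distrib)
qed

lemma radius_power_deriv:
  assumes sol: "is_sol b h q" and b: "b \<le> pi" and t: "0 < \<theta>" "\<theta> < b"
  shows "((\<lambda>x. sin x ^ n * radius h q x ^ n) has_real_derivative
     sin \<theta> ^ (n - 1) * (n * cos \<theta> * h \<theta> powr (p - 1))) (at \<theta>)"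
  by (rule radius_power_deriv_at[OF _ _ is_solD(5,6)[OF sol t] is_solD(4)[OF sol]]) (use b t in auto)

lemma root_powr:
  assumes "0 < g"
  shows "(g ^ n) powr (1 / n) = g" "(g ^ n) powr ((1 - real n) / n) = g powr (1 - real n)"
  using assms n by (auto simp: powr_realpow[symmetric] powr_powr)

text \<open>Counterpart of \<open>prof_is_sol\<close>: above the truncation level, continuity at the
  pole forces \<open>g^n\<close> and \<open>q\<close> to be the averages, and uniqueness of the
  fixed point does the rest. Through it the dependence of \<open>prof\<close> on the height
  transfers to arbitrary solutions.\<close>

lemma is_sol_prof:
  assumes sol: "is_sol b h q" and b: "0 < b" "b < pi" and e: "0 < e"
    and lo: "\<And>\<theta>. \<theta> \<in> {0..b} \<Longrightarrow> e \<le> h \<theta>" "\<And>\<theta>. \<theta> \<in> {0..b} \<Longrightarrow> e \<le> radius h q \<theta> ^ n"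
    and t: "\<theta> \<in> {0..b}"
  shows "h \<theta> = prof e (h 0) \<theta>" "q \<theta> = slope e (h 0) \<theta>"
    "radius h q \<theta> ^ n = mean_source e (prof e (h 0)) \<theta>"
proof -
  define g where "g = (\<lambda>x. radius h q x)"
  note s = is_solD[OF sol]
  have Q: "g x ^ n = mean_source e h x" if x: "x \<in> {0..b}" for x
    unfolding mean_source_def
  proof (rule sin_avg_unique[OF n b _ _ _ x])
    show "continuous_on {0..b} (\<lambda>t. n * cos t * max (h t) e powr (p - 1))"
      using e by (intro continuous_intros s) auto
    show "continuous_on {0..b} (\<lambda>a. g a ^ n)" unfolding g_def by (intro continuous_intros s)
    fix y assume y: "0 < y" "y < b"
    have "max (h y) e = h y" using lo(1)[of y] y by (simp add: max_def)
    then show "((\<lambda>x. sin x ^ n * g x ^ n) has_real_derivative sin y ^ (n - 1) * (n * cos y * max (h y) e powr (p - 1))) (at y)"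
      using radius_power_deriv[OF sol _ y] b by (simp add: g_def)
  qed
  have src: "source e h x = (real n - 1) * g x + h x powr (p - 1) * g x powr (1 - real n) - n * h x"
    if x: "x \<in> {0..b}" for x
  proof -
    have "max (h x) e = h x" "max (g x ^ n) e = g x ^ n" using lo[OF x] by (auto simp: max_def g_def)
    moreover have "0 < g x" using s(4) x by (simp add: g_def)
    ultimately show ?thesis by (simp add: source_def Q[OF x, symmetric] reaction_def root_powr)
  qed
  have q: "q x = sin_avg n (source e h) x" if x: "x \<in> {0..b}" for x
  proof (rule sin_avg_unique[OF n b source_cont[OF e b s(1)] s(2) _ x])
    fix y assume y: "0 < y" "y < b"
    have sn: "0 < sin y" using y b by (intro sin_gt_zero) auto
    define A where "A = h y powr (p - 1) * g y powr (1 - real n)"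
    have e1: "source e h y = (real n - 1) * g y + A - n * h y"
      unfolding A_def by (rule src) (use y in auto)
    have e2: "g y = radius h q y" by (simp add: g_def)
    have "sin y * ((A - g y) / sin y) = A - g y" using sn by simp
    moreover have "n * cos y * q y + (A - g y) = source e h y"
      unfolding e1 e2 by (simp add: algebra_simps)
    ultimately have e3: "source e h y = n * cos y * q y + sin y * ((A - g y) / sin y)" by (simp only:)
    show "((\<lambda>x. sin x ^ n * q x) has_real_derivative sin y ^ (n - 1) * source e h y) (at y)"
      unfolding e3 unfolding A_def g_def by (rule sin_pow_mult_deriv[OF n s(6)[OF y]])
  qed
  have fp: "h x = profile_op e (h 0) h x" if x: "x \<in> {0..b}" for x
  proof -
    have "((\<lambda>t. q t * sin t) has_integral h x - h 0) {0..x}"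
    proof (rule fundamental_theorem_of_calculus_interior)
      show "continuous_on {0..x} h" by (rule continuous_on_subset[OF s(1)]) (use x in auto)
      show "(h has_vector_derivative q t * sin t) (at t)" if "t \<in> {0<..<x}" for t
        using s(5)[of t] that x by (simp add: has_real_derivative_iff_has_vector_derivative)
    qed (use x in auto)
    then have "integral {0..x} (\<lambda>t. q t * sin t) = h x - h 0" by (rule integral_unique)
    moreover have "integral {0..x} (\<lambda>t. q t * sin t) = integral {0..x} (\<lambda>t. sin t * sin_avg n (source e h) t)"
      by (rule integral_cong) (use x q in auto)
    ultimately show ?thesis by (simp add: profile_op_def)
  qed
  have hp: "h x = prof e (h 0) x" if "x \<in> {0..b}" for x
    by (rule prof_unique[OF e b s(1) fp that])
  have mp: "mean_source e h x = mean_source e (prof e (h 0)) x" if x: "x \<in> {0..b}" for x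
    unfolding mean_source_def by (rule sin_avg_cong, subst hp) (use x in auto)
  show "h \<theta> = prof e (h 0) \<theta>" by (rule hp[OF t])
  show "radius h q \<theta> ^ n = mean_source e (prof e (h 0)) \<theta>"
    using Q[OF t] mp[OF t] by (simp add: g_def)
  have "sin_avg n (source e h) \<theta> = slope e (h 0) \<theta>"
    unfolding slope_def source_def by (rule sin_avg_cong, subst hp, use t in force, subst mp) (use t in auto)
  then show "q \<theta> = slope e (h 0) \<theta>" using q[OF t] by simp
qed

text \<open>The fixed point equation does not contain the relation \<open>g = h + q cos\<close>; it holds because
  \<open>(h + q cos - g) sin^n\<close> is constant.\<close>

lemma prof_is_sol:
  assumes e: "0 < e" and b: "0 < b" "b < pi"
    and lo: "\<And>\<theta>. \<theta> \<in> {0..b} \<Longrightarrow> e \<le> prof e a \<theta>" "\<And>\<theta>. \<theta> \<in> {0..b} \<Longrightarrow> e \<le> mean_source e (prof e a) \<theta>"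
  shows "is_sol b (prof e a) (slope e a)"
    "\<And>\<theta>. \<theta> \<in> {0..b} \<Longrightarrow> (prof e a \<theta> + slope e a \<theta> * cos \<theta>) ^ n = mean_source e (prof e a) \<theta>"
proof -
  define h q Q where "h = prof e a" and "q = slope e a" and "Q = mean_source e h"
  define G where "G = (\<lambda>x. Q x powr (1 / n))"
  note lo' = lo[folded h_def, folded Q_def]
  have ch: "continuous_on {0..b} h" unfolding h_def by (rule prof_cont[OF e b(2)])
  have cq: "continuous_on {0..b} q" unfolding q_def by (rule slope_cont[OF e b(2)])
  have cQ: "continuous_on {0..b} Q" unfolding Q_def by (rule mean_source_cont[OF e b ch])
  have Q0: "0 < Q x" if "x \<in> {0..b}" for x using lo'(2)[OF that] e by simp
  have G0: "0 < G x" if "x \<in> {0..b}" for x using Q0[OF that] by (simp add: G_def)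
  have GQ: "G x ^ n = Q x" if "x \<in> {0..b}" for x
    using Q0[OF that] n by (simp add: G_def powr_powr powr_realpow[symmetric])
  have cG: "continuous_on {0..b} G" unfolding G_def using Q0 by (intro continuous_intros cQ) force
  obtain m where m: "n = Suc m" using n by (cases n) auto
  have s0: "0 < sin x" if "0 < x" "x \<le> b" for x using that b by (intro sin_gt_zero) auto
  have src: "source e h x = (real n - 1) * G x + h x powr (p - 1) * G x powr (1 - real n) - n * h x"
    if x: "x \<in> {0..b}" for x
  proof -
    have "max (h x) e = h x" "max (G x ^ n) e = G x ^ n" using lo'[OF x] GQ[OF x] by (auto simp: max_def)
    moreover have "0 < G x" using G0 x by simp
    ultimately show ?thesis using root_powr[of "G x"] GQ[OF x]
      by (simp add: source_def Q_def[symmetric] reaction_def)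
  qed
  have dh: "(h has_real_derivative q x * sin x) (at x)" if "0 < x" "x < b" for x
    unfolding h_def q_def by (rule prof_deriv[OF e]) (use that b in auto)
  have dq: "(q has_real_derivative (source e h x - n * cos x * q x) / sin x) (at x)" if x: "0 < x" "x < b" for x
  proof -
    have "((\<lambda>x. sin x ^ n * q x) has_real_derivative sin x ^ (n - 1) * source e h x) (at x)"
      using sin_avg_deriv[OF n source_cont[OF e b ch] x less_imp_le[OF b(2)]]
      by (simp add: q_def slope_def h_def)
    then show ?thesis by (rule sin_pow_div_deriv[OF n, rotated 2]) (use x b in auto)
  qed
  have dQ: "(Q has_real_derivative n * cos x * (h x powr (p - 1) - Q x) / sin x) (at x)" if x: "0 < x" "x < b" for x
  proof -
    have s: "0 < sin x" using s0 x by simp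
    have hm: "max (h x) e = h x" using lo'(1)[of x] x by (simp add: max_def)
    have c: "continuous_on {0..b} (\<lambda>t. n * cos t * max (h t) e powr (p - 1))"
      using e by (intro continuous_intros ch) auto
    have "((\<lambda>x. sin x ^ n * Q x) has_real_derivative sin x ^ (n - 1) * (n * cos x * h x powr (p - 1))) (at x)"
      using sin_avg_deriv[OF n c x less_imp_le[OF b(2)]] by (simp add: Q_def mean_source_def hm)
    then have "(Q has_real_derivative (n * cos x * h x powr (p - 1) - n * cos x * Q x) / sin x) (at x)"
      by (rule sin_pow_div_deriv[OF n, rotated 2]) (use x b in auto)
    then show ?thesis by (simp add: right_diff_distrib)
  qed
  \<comment> \<open>Obtained from the average \<open>Q\<close>, not from \<open>h + q cos\<close>;
    the two candidates for \<open>g\<close> differ by a solution of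
    \<open>D' = - n D cos / sin\<close>.\<close>
  have dG: "(G has_real_derivative cos x * (h x powr (p - 1) * G x powr (1 - real n) - G x) / sin x) (at x)"
    if x: "0 < x" "x < b" for x
  proof -
    have s: "0 < sin x" using s0 x by simp
    have "(G has_real_derivative (1 / n) * Q x powr (1 / n - 1) * (n * cos x * (h x powr (p - 1) - Q x) / sin x)) (at x)"
      unfolding G_def
      by (rule has_real_derivative_powr[THEN DERIV_chain2, OF _ dQ[OF x]]) (use Q0 x in auto)
    moreover have "Q x powr (1 / n - 1) = G x powr (1 - real n)"
      using Q0[of x] x n by (simp add: G_def powr_powr field_simps)
    moreover have "G x powr (1 - real n) * Q x = G x"
    proof -
      have "G x powr real n = Q x" using GQ[of x] G0[of x] x by (simp add: powr_realpow)
      moreover have "G x powr (1 - real n) * G x powr real n = G x"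
        unfolding powr_add[symmetric] using G0[of x] x by simp
      ultimately show ?thesis by simp
    qed
    moreover have "(1 / n) * G x powr (1 - real n) * (n * cos x * (h x powr (p - 1) - Q x) / sin x)
       = cos x * (h x powr (p - 1) * G x powr (1 - real n) - G x powr (1 - real n) * Q x) / sin x"
      using n by (simp add: algebra_simps)
    ultimately show ?thesis by (simp only:)
  qed
  have D: "radius h q x = G x" if x: "0 < x" "x \<le> b" for x
  proof -
    have "(\<lambda>x. sin x ^ n * (radius h q x - G x)) x = (\<lambda>x. sin x ^ n * (radius h q x - G x)) 0"
    proof (rule DERIV_isconst2[OF b(1)])
      show "continuous_on {0..b} (\<lambda>x. sin x ^ n * (radius h q x - G x))"
        by (intro continuous_intros ch cq cG)
      fix y assume y: "0 < y" "y < b"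
      have sn: "0 < sin y" using s0 y by simp
      have "((\<lambda>x. radius h q x - G x) has_real_derivative
          - (n * cos y * (radius h q y - G y) / sin y)) (at y)"
        by (rule derivative_eq_intros dh[OF y] dq[OF y] dG[OF y] refl)+
           (use y sn in \<open>simp add: src[of y] field_simps\<close>)
      from sin_pow_mult_deriv[OF n this] sn
      show "DERIV (\<lambda>x. sin x ^ n * (radius h q x - G x)) y :> 0" by simp
    qed (use x in auto)
    moreover have "(0::real) ^ n = 0" using n by simp
    ultimately show ?thesis using s0[OF x] by auto
  qed
  have D0: "radius h q 0 = G 0"
  proof -
    have "continuous_on {0..b} (\<lambda>x. radius h q x - G x)" by (intro continuous_intros ch cq cG)
    then have "((\<lambda>x. radius h q x - G x) \<longlongrightarrow> h 0 + q 0 * cos 0 - G 0) (at_right 0)"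
      using b by (auto simp: continuous_on_def at_within_Icc_at_right dest!: bspec[of _ _ 0])
    moreover have "((\<lambda>x. radius h q x - G x) \<longlongrightarrow> 0) (at_right 0)"
      by (rule tendsto_eventually) (use eventually_at_right_real[OF b(1)] in eventually_elim, use D in auto)
    ultimately have "radius h q 0 - G 0 = 0" by (rule tendsto_unique[rotated]) simp
    then show ?thesis by simp
  qed
  have Dall: "radius h q x = G x" if "x \<in> {0..b}" for x
    using D[of x] D0 that by (cases "x = 0") auto
  show "is_sol b (prof e a) (slope e a)"
    unfolding is_sol_def h_def[symmetric] q_def[symmetric]
  proof (intro conjI allI impI ballI)
    show "continuous_on {0..b} h" "continuous_on {0..b} q" by fact+
    show "0 < h x" "0 < radius h q x" if "x \<in> {0..b}" for x
      using lo'(1)[OF that] e G0[OF that] Dall[OF that] by auto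
    fix x assume x: "0 < x \<and> x < b"
    show "(h has_real_derivative q x * sin x) (at x)" using dh x by simp
    have "n * h x + n * (cos x * q x) = n * G x"
      using Dall[of x] x by (simp add: distrib_left[symmetric] mult.commute)
    then have "source e h x - n * cos x * q x = h x powr (p - 1) * G x powr (1 - real n) - G x"
      using src[of x] x by (simp add: algebra_simps)
    then show "(q has_real_derivative slope_rhs h q x) (at x)"
      using dq[of x] x Dall[of x] by simp
  qed
  show "(prof e a \<theta> + slope e a \<theta> * cos \<theta>) ^ n = mean_source e (prof e a) \<theta>" if "\<theta> \<in> {0..b}" for \<theta>
    using Dall[OF that] GQ[OF that] by (simp add: h_def q_def Q_def)
qed

text \<open>Joint continuity in height and angle: Lipschitz in the height uniformly on
  \<open>{0..b}\<close>, continuous in the angle. The angles may approach \<open>\<theta>\<close>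
  from above, so \<open>b\<close> is taken beyond \<open>\<theta>\<close>.\<close>

lemma prof_limit:
  assumes e: "0 < e" and t: "0 \<le> \<theta>" "\<theta> < pi" "\<And>k. 0 \<le> \<theta>s k" "\<theta>s \<longlonglongrightarrow> \<theta>" and a: "as \<longlonglongrightarrow> a"
  shows "(\<lambda>k. prof e (as k) (\<theta>s k)) \<longlonglongrightarrow> prof e a \<theta>"
    "(\<lambda>k. slope e (as k) (\<theta>s k)) \<longlonglongrightarrow> slope e a \<theta>"
    "(\<lambda>k. mean_source e (prof e (as k)) (\<theta>s k)) \<longlonglongrightarrow> mean_source e (prof e a) \<theta>"
proof -
  define b where "b = (\<theta> + pi) / 2"
  have b: "0 < b" "b < pi" "\<theta> < b" using t pi_gt_zero by (auto simp: b_def)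
  obtain C where C: "0 < C"
    "\<And>a a' t. t \<in> {0..b} \<Longrightarrow> \<bar>prof e a t - prof e a' t\<bar> \<le> C * \<bar>a - a'\<bar>"
    "\<And>a a' t. t \<in> {0..b} \<Longrightarrow> \<bar>slope e a t - slope e a' t\<bar> \<le> C * \<bar>a - a'\<bar>"
    "\<And>a a' t. t \<in> {0..b} \<Longrightarrow> \<bar>mean_source e (prof e a) t - mean_source e (prof e a') t\<bar> \<le> C * \<bar>a - a'\<bar>"
    using prof_lipschitz[OF e b(1,2)] by blast
  have ev: "eventually (\<lambda>k. \<theta>s k \<in> {0..b}) sequentially"
    using order_tendstoD(2)[OF t(4) b(3)] by eventually_elim (use t(3) in auto)
  have gen: "(\<lambda>k. F (as k) (\<theta>s k)) \<longlonglongrightarrow> F a \<theta>"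
    if F: "continuous_on {0..b} (F a)" "\<And>a a' t. t \<in> {0..b} \<Longrightarrow> \<bar>F a t - F a' t\<bar> \<le> C * \<bar>a - a'\<bar>" for F :: "real \<Rightarrow> real \<Rightarrow> real"
  proof -
    have 1: "(\<lambda>k. F a (\<theta>s k)) \<longlonglongrightarrow> F a \<theta>"
      by (rule continuous_on_tendsto_compose[OF F(1) t(4) _ ev]) (use b t in auto)
    have 2: "(\<lambda>k. F (as k) (\<theta>s k) - F a (\<theta>s k)) \<longlonglongrightarrow> 0"
    proof (rule Lim_null_comparison)
      show "eventually (\<lambda>k. norm (F (as k) (\<theta>s k) - F a (\<theta>s k)) \<le> C * \<bar>as k - a\<bar>) sequentially"
        using ev by eventually_elim (use F(2) in auto)
      show "(\<lambda>k. C * \<bar>as k - a\<bar>) \<longlonglongrightarrow> 0" by (rule tendsto_eq_intros a refl)+ simp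
    qed
    show ?thesis using tendsto_add[OF 1 2] by simp
  qed
  show "(\<lambda>k. prof e (as k) (\<theta>s k)) \<longlonglongrightarrow> prof e a \<theta>"
    by (rule gen[OF prof_cont[OF e b(2)] C(2)])
  show "(\<lambda>k. slope e (as k) (\<theta>s k)) \<longlonglongrightarrow> slope e a \<theta>"
    by (rule gen[OF slope_cont[OF e b(2)] C(3)])
  show "(\<lambda>k. mean_source e (prof e (as k)) (\<theta>s k)) \<longlonglongrightarrow> mean_source e (prof e a) \<theta>"
    by (rule gen[where F="\<lambda>a. mean_source e (prof e a)", OF mean_source_cont[OF e b(1,2) prof_cont[OF e b(2)]] C(4)])
qed

section \<open>A priori bounds\<close>

lemma is_sol_pos:
  assumes sol: "is_sol b h q" and b: "b < pi" and t: "0 \<le> \<theta>" "\<theta> \<le> b"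
  shows "0 < h \<theta>" "0 < radius h q \<theta>" "0 \<le> sin \<theta>" "0 < \<theta> \<Longrightarrow> 0 < sin \<theta>"
  using is_solD(3,4)[OF sol t] t b by (auto intro: sin_ge_zero sin_gt_zero)

text \<open>\<open>c sin^n\<close> is what \<open>(g sin)^n\<close> would be for the constant source
  \<open>c\<close> in place of \<open>h^(p - 1)\<close>; subtracting it leaves a derivative that has
  the sign of \<open>cos (h^(p - 1) - c)\<close>, up to a nonnegative factor.\<close>

lemma radius_power_diff_deriv:
  assumes sol: "is_sol b h q" and b: "b < pi" and x: "0 < x" "x < b"
  shows "((\<lambda>x. sin x ^ n * radius h q x ^ n - c * sin x ^ n) has_real_derivative
     n * sin x ^ (n - 1) * (cos x * (h x powr (p - 1) - c))) (at x)"
proof -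
  have "((\<lambda>x. sin x ^ n * radius h q x ^ n - c * sin x ^ n) has_real_derivative
     sin x ^ (n - 1) * (n * cos x * h x powr (p - 1)) - c * (n * sin x ^ (n - 1) * cos x)) (at x)"
    by (rule DERIV_diff, rule radius_power_deriv[OF sol])
       (use x b in \<open>auto intro!: derivative_eq_intros\<close>)
  then show ?thesis by (simp add: algebra_simps)
qed

text \<open>With \<open>radius_power_compare_ge\<close>, this turns a one-sided bound on
  \<open>h\<close> over an interval within one hemisphere into a bound on \<open>g\<close>. The sign
  of \<open>cos\<close> makes the two hemispheres use opposite bounds.\<close>

lemma radius_power_compare_le:
  assumes sol: "is_sol b h q" and b: "b < pi" and st: "0 \<le> s" "s \<le> t" "t \<le> b"
    and c: "\<And>x. s < x \<Longrightarrow> x < t \<Longrightarrow> 0 \<le> cos x * (h x powr (p - 1) - c)"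
  shows "sin s ^ n * radius h q s ^ n - c * sin s ^ n \<le> sin t ^ n * radius h q t ^ n - c * sin t ^ n"
proof (rule DERIV_nonneg_imp_increasing_open[OF st(2)])
  fix x assume x: "s < x" "x < t"
  have "0 \<le> n * sin x ^ (n - 1) * (cos x * (h x powr (p - 1) - c))"
    by (rule mult_nonneg_nonneg[OF _ c[OF x]]) (use is_sol_pos(3)[OF sol b, of x] x st in auto)
  moreover have "0 < x" "x < b" using x st by auto
  ultimately show "\<exists>y. ((\<lambda>x. sin x ^ n * radius h q x ^ n - c * sin x ^ n) has_real_derivative y) (at x) \<and> 0 \<le> y"
    using radius_power_diff_deriv[OF sol b, of x c] by blast
next
  show "continuous_on {s..t} (\<lambda>x. sin x ^ n * radius h q x ^ n - c * sin x ^ n)"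
    by (rule continuous_on_subset[of "{0..b}"], intro continuous_intros is_solD[OF sol]) (use st in auto)
qed

lemma radius_power_compare_ge:
  assumes sol: "is_sol b h q" and b: "b < pi" and st: "0 \<le> s" "s \<le> t" "t \<le> b"
    and c: "\<And>x. s < x \<Longrightarrow> x < t \<Longrightarrow> cos x * (h x powr (p - 1) - c) \<le> 0"
  shows "sin t ^ n * radius h q t ^ n - c * sin t ^ n \<le> sin s ^ n * radius h q s ^ n - c * sin s ^ n"
proof (rule DERIV_nonpos_imp_decreasing_open[OF st(2)])
  fix x assume x: "s < x" "x < t"
  have "n * sin x ^ (n - 1) * (cos x * (h x powr (p - 1) - c)) \<le> 0"
    by (rule mult_nonneg_nonpos[OF _ c[OF x]]) (use is_sol_pos(3)[OF sol b, of x] x st in auto)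
  moreover have "0 < x" "x < b" using x st by auto
  ultimately show "\<exists>y. ((\<lambda>x. sin x ^ n * radius h q x ^ n - c * sin x ^ n) has_real_derivative y) (at x) \<and> y \<le> 0"
    using radius_power_diff_deriv[OF sol b, of x c] by blast
next
  show "continuous_on {s..t} (\<lambda>x. sin x ^ n * radius h q x ^ n - c * sin x ^ n)"
    by (rule continuous_on_subset[of "{0..b}"], intro continuous_intros is_solD[OF sol]) (use st in auto)
qed

lemma powr_source_mono:
  "0 < m \<Longrightarrow> m \<le> x \<Longrightarrow> x powr (p - 1) \<le> m powr (p - 1)"
  using p by (intro powr_mono2') auto

text \<open>Since \<open>h'' + h > 0\<close>, the profile lies above each of the functions \<open>x\<cdot>cos + y\<cdot>sin\<close> tangent to it.\<close>

lemma support_inequality: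
  assumes sol: "is_sol b h q" and b: "b < pi" and t: "0 \<le> t" "t \<le> b" and th: "0 \<le> \<theta>" "\<theta> \<le> b"
  shows "q t * sin t * sin (\<theta> - t) + h t * cos (\<theta> - t) \<le> h \<theta>"
proof -
  \<comment> \<open>\<open>V x\<close> is the value at \<open>\<theta>\<close> of the solution of
    \<open>y'' + y = 0\<close> that touches \<open>h\<close> at \<open>x\<close>; since
    \<open>h'' + h > 0\<close>, it can only grow as \<open>x\<close> moves towards
    \<open>\<theta>\<close>, where it equals \<open>h \<theta>\<close>.\<close>
  define V where "V x = q x * sin x * sin (\<theta> - x) + h x * cos (\<theta> - x)" for x
  define A where "A x = h x powr (p - 1) * radius h q x powr (1 - real n)" for x
  have dV: "(V has_real_derivative A x * sin (\<theta> - x)) (at x)" if x: "0 < x" "x < b" for x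
  proof -
    have s: "0 < sin x" using is_sol_pos(4)[OF sol b, of x] x by auto
    define D where "D = (A x - radius h q x) / sin x"
    have D: "D * sin x = A x - radius h q x" using s by (simp add: D_def)
    have "(V has_real_derivative (D * sin x + q x * cos x) * sin (\<theta> - x)
       + q x * sin x * (- cos (\<theta> - x)) + (q x * sin x * cos (\<theta> - x) + h x * sin (\<theta> - x))) (at x)"
      unfolding V_def[abs_def] A_def D_def
      by (rule derivative_eq_intros is_solD(5,6)[OF sol x] refl)+ (simp add: algebra_simps)
    then show ?thesis unfolding D by (simp add: algebra_simps)
  qed
  have A: "0 \<le> A x" for x by (simp add: A_def)
  have cV: "continuous_on {0..b} V" unfolding V_def by (intro continuous_intros is_solD[OF sol])
  have "V t \<le> V \<theta>"
  proof (cases "t \<le> \<theta>")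
    case True
    show ?thesis
    proof (rule DERIV_nonneg_imp_increasing_open[OF True])
      fix x assume x: "t < x" "x < \<theta>"
      have "0 \<le> A x * sin (\<theta> - x)" using x t th b by (intro mult_nonneg_nonneg A sin_ge_zero) auto
      then show "\<exists>y. (V has_real_derivative y) (at x) \<and> 0 \<le> y" using dV[of x] x t th by force
    qed (rule continuous_on_subset[OF cV], use t th in auto)
  next
    case False
    then have "\<theta> \<le> t" by simp
    then show ?thesis
    proof (rule DERIV_nonpos_imp_decreasing_open)
      fix x assume x: "\<theta> < x" "x < t"
      have "sin (\<theta> - x) \<le> 0" using sin_ge_zero[of "x - \<theta>"] x t th b sin_minus[of "x - \<theta>"] by auto
      then have "A x * sin (\<theta> - x) \<le> 0" by (intro mult_nonneg_nonpos A)
      then show "\<exists>y. (V has_real_derivative y) (at x) \<and> y \<le> 0" using dV[of x] x t th by force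
    qed (rule continuous_on_subset[OF cV], use t th in auto)
  qed
  then show ?thesis by (simp add: V_def)
qed

lemma support_inequality_crit:
  assumes "is_sol b h q" "b < pi" "0 \<le> t" "t \<le> b" "0 \<le> \<theta>" "\<theta> \<le> b" "q t = 0"
  shows "h t * cos (\<theta> - t) \<le> h \<theta>"
  using support_inequality[OF assms(1-6)] assms(7) by simp

text \<open>Since \<open>q sin = h'\<close>, the differentiated function is the height
  \<open>h cos - h' sin\<close> of the boundary point, and its derivative is
  \<open>- (h'' + h) sin\<close>.\<close>

lemma height_deriv:
  assumes sol: "is_sol b h q" and b: "b < pi" and x: "0 < x" "x < b"
  shows "((\<lambda>x. h x * cos x - q x * (sin x)\<^sup>2) has_real_derivative
    - (h x powr (p - 1) * radius h q x powr (1 - real n) * sin x)) (at x)"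
proof -
  define A where "A = h x powr (p - 1) * radius h q x powr (1 - real n)"
  define D where "D = (A - radius h q x) / sin x"
  have D: "D * sin x = A - radius h q x" using is_sol_pos(4)[OF sol b, of x] x by (simp add: D_def)
  have "((\<lambda>x. h x * cos x - q x * (sin x)\<^sup>2) has_real_derivative (q x * sin x * cos x - h x * sin x)
     - (D * sin x * sin x + q x * (2 * sin x * cos x))) (at x)"
    unfolding A_def D_def
    by (rule derivative_eq_intros is_solD(5,6)[OF sol x] refl)+ (simp add: algebra_simps power2_eq_square)
  then show ?thesis unfolding D by (simp add: A_def algebra_simps)
qed

lemma height_bound:
  assumes sol: "is_sol b h q" and b: "b < pi" and t: "0 \<le> t" "t \<le> b"
  shows "h t * cos t - q t * (sin t)\<^sup>2 \<le> h 0"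
proof -
  have "h t * cos t - q t * (sin t)\<^sup>2 \<le> h 0 * cos 0 - q 0 * (sin 0)\<^sup>2"
  proof (rule DERIV_nonpos_imp_decreasing_open[OF t(1)])
    fix x assume x: "0 < x" "x < t"
    then have "0 \<le> h x powr (p - 1) * radius h q x powr (1 - real n) * sin x"
      using is_sol_pos(3)[OF sol b, of x] t by (intro mult_nonneg_nonneg) auto
    then show "\<exists>y. ((\<lambda>x. h x * cos x - q x * (sin x)\<^sup>2) has_real_derivative y) (at x) \<and> y \<le> 0"
      using height_deriv[OF sol b x(1)] x(2) t(2) by force
  next
    show "continuous_on {0..t} (\<lambda>x. h x * cos x - q x * (sin x)\<^sup>2)"
      by (rule continuous_on_subset[of "{0..b}"], intro continuous_intros is_solD[OF sol]) (use t in auto)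
  qed
  then show ?thesis by simp
qed

text \<open>Under lower bounds on \<open>h\<close> and \<open>g\<close> the curvature radius
  \<open>h'' + h = h^(p - 1) g^(1 - n)\<close> is at most \<open>c^(p - n)\<close>, so the height
  cannot fall faster than that.\<close>

lemma height_lower:
  assumes sol: "is_sol b h q" and b: "b < pi" and t: "0 \<le> t" "t \<le> b" and c: "0 < c"
    and lo: "\<And>x. 0 < x \<Longrightarrow> x < t \<Longrightarrow> c \<le> h x" "\<And>x. 0 < x \<Longrightarrow> x < t \<Longrightarrow> c \<le> radius h q x"
  shows "h 0 - c powr (p - n) * t \<le> h t * cos t - q t * (sin t)\<^sup>2"
proof -
  define K where "K = c powr (p - n)"
  have "h 0 * cos 0 - q 0 * (sin 0)\<^sup>2 + K * 0 \<le> h t * cos t - q t * (sin t)\<^sup>2 + K * t"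
  proof (rule DERIV_nonneg_imp_increasing_open[OF t(1)])
    fix x assume x: "0 < x" "x < t"
    define A where "A = h x powr (p - 1) * radius h q x powr (1 - real n)"
    have "A \<le> c powr (p - 1) * c powr (1 - real n)"
      unfolding A_def using lo[OF x] c p n by (intro mult_mono powr_mono2') auto
    also have "\<dots> = K" by (simp add: K_def powr_add[symmetric])
    finally have "A * sin x \<le> K * 1"
      using is_sol_pos(3)[OF sol b, of x] x t by (intro mult_mono) (auto simp: K_def A_def)
    moreover have "((\<lambda>x. h x * cos x - q x * (sin x)\<^sup>2 + K * x) has_real_derivative - (A * sin x) + K) (at x)"
      unfolding A_def using x t by (intro DERIV_add height_deriv[OF sol b] DERIV_cmult_Id) auto
    ultimately show "\<exists>y. ((\<lambda>x. h x * cos x - q x * (sin x)\<^sup>2 + K * x) has_real_derivative y) (at x) \<and> 0 \<le> y"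
      by force
  next
    show "continuous_on {0..t} (\<lambda>x. h x * cos x - q x * (sin x)\<^sup>2 + K * x)"
      by (rule continuous_on_subset[of "{0..b}"], intro continuous_intros is_solD[OF sol]) (use t in auto)
  qed
  then show ?thesis by (simp add: K_def)
qed

text \<open>Recovers the support function from the distance to the axis and the height of the
  boundary point.\<close>

lemma profile_decomp:
  fixes h q :: "real \<Rightarrow> real"
  shows "h t = sin t * (sin t * radius h q t) + (h t * cos t - q t * (sin t)\<^sup>2) * cos t"
  using sin_cos_squared_add[of t] by algebra

text \<open>The comparison with \<open>c = 0\<close>: the distance from the axis grows up to the
  equator.\<close>

lemma north_radius_mono:
  assumes sol: "is_sol b h q" and b: "b < pi" and st: "0 \<le> s" "s \<le> t" "t \<le> b" "t \<le> pi / 2"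
  shows "sin s * radius h q s \<le> sin t * radius h q t"
proof -
  have "sin s ^ n * radius h q s ^ n - 0 * sin s ^ n \<le> sin t ^ n * radius h q t ^ n - 0 * sin t ^ n"
    by (rule radius_power_compare_le[OF sol b st(1-3)]) (use st in \<open>auto intro!: mult_nonneg_nonneg cos_ge_zero\<close>)
  then have "(sin s * radius h q s) ^ n \<le> (sin t * radius h q t) ^ n"
    by (simp add: power_mult_distrib)
  then show ?thesis
    by (rule power_le_imp_le_base[where n="n - 1", rotated 1, unfolded Suc_diff_1[OF n[unfolded One_nat_def Suc_le_eq]], rotated])
       (use is_sol_pos[OF sol b, of t] st in auto)
qed

text \<open>\<open>t\<close> may be the right end \<open>b\<close>, where no two-sided derivative of
  \<open>h\<close> is at hand, so the sign of \<open>q\<close> is read off from the monotonicity of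
  \<open>h\<close> just to the left of \<open>t\<close>.\<close>

lemma slope_at_left_min:
  assumes sol: "is_sol b h q" and b: "b < pi" and st: "0 \<le> s" "s < t" "t \<le> b"
    and min: "\<And>x. s \<le> x \<Longrightarrow> x \<le> t \<Longrightarrow> h t \<le> h x"
  shows "q t \<le> 0"
proof (rule ccontr)
  assume "\<not> q t \<le> 0"
  then have qt: "0 < q t" by simp
  have "(q \<longlongrightarrow> q t) (at t within {0..b})" using is_solD(2)[OF sol] st by (auto simp: continuous_on_def)
  from order_tendstoD(1)[OF this qt] obtain d where d: "0 < d"
    "\<And>x. x \<in> {0..b} \<Longrightarrow> x \<noteq> t \<Longrightarrow> dist x t < d \<Longrightarrow> 0 < q x"
    unfolding eventually_at by blast
  define u where "u = max s (t - d / 2)"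
  have u: "s \<le> u" "u < t" "t - u < d" using st d(1) by (auto simp: u_def)
  have "h u < h t"
  proof (rule DERIV_pos_imp_increasing_open[OF u(2)])
    fix x assume x: "u < x" "x < t"
    have "0 < q x * sin x"
      using d(2)[of x] x u st is_sol_pos(4)[OF sol b, of x] by (auto simp: dist_real_def)
    then show "\<exists>y. (h has_real_derivative y) (at x) \<and> 0 < y"
      using is_solD(5)[OF sol, of x] x u st by auto
  qed (rule continuous_on_subset[OF is_solD(1)[OF sol]], use u st in auto)
  then show False using min[of u] u by simp
qed

lemma slope_at_interior_extremum:
  assumes sol: "is_sol b h q" and b: "b < pi" and st: "0 \<le> s" "s < t" "t < u" "u \<le> b"
    and ext: "(\<forall>x\<in>{s..u}. h x \<le> h t) \<or> (\<forall>x\<in>{s..u}. h t \<le> h x)"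
  shows "q t = 0"
proof -
  have d: "(h has_real_derivative q t * sin t) (at t)" using is_solD(5)[OF sol, of t] st by auto
  define r where "r = min (t - s) (u - t)"
  have r: "0 < r" using st by (simp add: r_def)
  have mem: "y \<in> {s..u}" if "\<bar>t - y\<bar> < r" for y using that by (auto simp: r_def)
  have "q t * sin t = 0"
    using ext
  proof
    assume "\<forall>x\<in>{s..u}. h x \<le> h t"
    then show ?thesis using DERIV_local_max[OF d r] mem by blast
  next
    assume "\<forall>x\<in>{s..u}. h t \<le> h x"
    then show ?thesis using DERIV_local_min[OF d r] mem by blast
  qed
  then show ?thesis using is_sol_pos(4)[OF sol b, of t] st by auto
qed

section \<open>Small initial heights\<close>

lemma cos_gt_half: "0 \<le> x \<Longrightarrow> x \<le> pi / 3 \<Longrightarrow> 1 / 2 \<le> cos x"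
  using cos_monotone_0_pi_le[of x "pi/3"] cos_60 by simp

lemma gt_pi_third: "0 \<le> x \<Longrightarrow> cos x < 1 / 2 \<Longrightarrow> pi / 3 < x"
  using cos_gt_half[of x] by linarith

text \<open>If the distance from the axis were at most \<open>M\<close> at \<open>\<theta>\<close>,
  it would be so before, and \<open>h\<close> would be at most \<open>a (1 + M)\<close> for angles
  up to \<open>arcsin a\<close>. The source there is then at least of order
  \<open>a^(p - 1)\<close>, and \<open>(g sin)^n\<close> at that angle at least of order
  \<open>a^(p - 1 + n)\<close>. As the exponent is negative, this exceeds \<open>M^n\<close> for
  small \<open>a\<close>.\<close>

lemma large_radius_if_small_start:
  fixes M :: real
  assumes M: "0 < M"
  obtains a0 where "0 < a0"
    "\<And>b h q \<theta>. is_sol b h q \<Longrightarrow> b < pi \<Longrightarrow> h 0 < a0 \<Longrightarrow> 1 \<le> \<theta> \<Longrightarrow> \<theta> \<le> pi / 2 \<Longrightarrow> \<theta> \<le> b \<Longrightarrow>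
       M < sin \<theta> * radius h q \<theta>"
proof -
  define e where "e = p - 1 + n"
  have e: "e < 0" using p by (simp add: e_def)
  define K where "K = (M ^ n + 1) * (1 + M) powr (1 - p)"
  have K: "0 < K" using M by (simp add: K_def add_nonneg_pos)
  \<comment> \<open>\<open>sin 1\<close> keeps the angle \<open>t1\<close> below 1; below the other
    value, \<open>(1 + M)^(p - 1) a^e\<close> is at least \<open>M^n + 1\<close>.\<close>
  define a0 where "a0 = min (sin 1) (K powr (1 / e))"
  have s1: "0 < sin (1::real)" using pi_gt3 by (intro sin_gt_zero) auto
  have a0: "0 < a0" using s1 K by (simp add: a0_def)
  have "M < sin \<theta> * radius h q \<theta>"
    if sol: "is_sol b h q" and b: "b < pi" and a: "h 0 < a0" and t: "1 \<le> \<theta>" "\<theta> \<le> pi / 2" "\<theta> \<le> b" for b h q \<theta>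
  proof (rule ccontr)
    define a where "a = h 0"
    have apos: "0 < a" using is_sol_pos(1)[OF sol b, of 0] t by (simp add: a_def)
    assume "\<not> M < sin \<theta> * radius h q \<theta>"
    then have le: "sin \<theta> * radius h q \<theta> \<le> M" by simp
    define t1 where "t1 = arcsin a"
    have a1: "a < sin 1" "a < K powr (1 / e)" using a by (auto simp: a0_def a_def)
    have ale: "a \<le> 1" using a1(1) sin_le_one[of 1] by linarith
    have st1: "sin t1 = a" using apos ale by (simp add: t1_def)
    have t10: "0 < t1" using apos ale arcsin_less_arcsin[of 0 a] by (simp add: t1_def)
    have t11: "t1 \<le> 1"
    proof -
      have "arcsin a \<le> arcsin (sin 1)" using a1(1) apos s1 sin_le_one[of 1] by (intro arcsin_le_arcsin) auto
      also have "arcsin (sin 1) = (1::real)" using pi_gt3 by (intro arcsin_sin) auto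
      finally show ?thesis by (simp add: t1_def)
    qed
    define m where "m = a * (1 + M)"
    have m: "0 < m" using apos M by (simp add: m_def)
    have hm: "h x \<le> m" if x: "0 < x" "x < t1" for x
    proof -
      have "sin x * radius h q x \<le> M"
        using north_radius_mono[OF sol b, of x \<theta>] x t t11 le by auto
      moreover have "0 \<le> sin x" using x t11 t by (intro sin_ge_zero) auto
      moreover have "sin x \<le> a" unfolding st1[symmetric] using x t11 pi_gt3 by (intro sin_monotone_2pi_le) auto
      ultimately have "sin x * (sin x * radius h q x) \<le> sin x * M" and "sin x * M \<le> a * M"
        using M mult_left_mono[of "sin x * radius h q x" M "sin x"] mult_right_mono[of "sin x" a M]
        by linarith+
      then have "sin x * (sin x * radius h q x) \<le> a * M" by (rule order_trans)
      moreover have "(h x * cos x - q x * (sin x)\<^sup>2) * cos x \<le> a"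
      proof -
        have "0 \<le> cos x" "cos x \<le> 1" using x t11 pi_gt3 by (auto intro!: cos_ge_zero)
        moreover have "h x * cos x - q x * (sin x)\<^sup>2 \<le> a"
          unfolding a_def by (rule height_bound[OF sol b]) (use x t t11 in auto)
        ultimately have "(h x * cos x - q x * (sin x)\<^sup>2) * cos x \<le> a * cos x" "a * cos x \<le> a * 1"
          using apos by (auto intro: mult_right_mono mult_left_mono simp del: mult_1_right)
        then show ?thesis by simp
      qed
      ultimately show ?thesis using profile_decomp[of h x q] by (simp add: m_def algebra_simps)
    qed
    have "sin 0 ^ n * radius h q 0 ^ n - m powr (p - 1) * sin 0 ^ n
        \<le> sin t1 ^ n * radius h q t1 ^ n - m powr (p - 1) * sin t1 ^ n"
    proof (rule radius_power_compare_le[OF sol b])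
      fix x assume x: "0 < x" "x < t1"
      have "m powr (p - 1) \<le> h x powr (p - 1)"
        by (rule powr_source_mono) (use hm[OF x] is_sol_pos(1)[OF sol b, of x] x t t11 in auto)
      then show "0 \<le> cos x * (h x powr (p - 1) - m powr (p - 1))"
        using x t11 pi_gt3 by (intro mult_nonneg_nonneg cos_ge_zero) auto
    qed (use t t10 t11 in auto)
    moreover have "(0::real) ^ n = 0" using n by simp
    ultimately have "m powr (p - 1) * a ^ n \<le> (sin t1 * radius h q t1) ^ n"
      by (simp add: st1 power_mult_distrib)
    also have "\<dots> \<le> M ^ n"
      using north_radius_mono[OF sol b, of t1 \<theta>] le t t10 t11 is_sol_pos[OF sol b, of t1]
      by (intro power_mono) auto
    finally have up: "m powr (p - 1) * a ^ n \<le> M ^ n" .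
    have "m powr (p - 1) * a ^ n = (1 + M) powr (p - 1) * a powr e"
      using apos M by (simp add: m_def powr_mult e_def powr_add powr_realpow)
    moreover have "K \<le> a powr e"
    proof -
      have "(K powr (1 / e)) powr e \<le> a powr e" using a1(2) apos e by (intro powr_mono2') auto
      then show ?thesis using K e by (simp add: powr_powr)
    qed
    then have "(1 + M) powr (p - 1) * K \<le> (1 + M) powr (p - 1) * a powr e" by (rule mult_left_mono) simp
    moreover have "(1 + M) powr (p - 1) * K = M ^ n + 1"
    proof -
      have "(1 + M) powr (p - 1) * (1 + M) powr (1 - p) = 1"
        unfolding powr_add[symmetric] using M by simp
      then show ?thesis by (simp add: K_def mult.left_commute)
    qed
    ultimately show False using up by linarith
  qed
  then show ?thesis using that a0 by blast
qed

text \<open>The given heights are only compared with 1, so \<open>t1\<close> and \<open>t2\<close>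
  are first replaced by a maximum \<open>s1\<close> and a minimum \<open>s2\<close> with
  \<open>h s1 > 2\<close> and \<open>h s2 < 1 / 2\<close>. The tangent comparison at critical points
  then makes each of the gaps from \<open>0\<close> to \<open>s1\<close>, from \<open>s1\<close> to
  \<open>s2\<close> and from \<open>s2\<close> to \<open>t3\<close> longer than pi/3.\<close>

lemma no_triple_small_start:
  obtains a0 where "0 < a0"
    "\<And>b h q t1 t2 t3. is_sol b h q \<Longrightarrow> b < pi \<Longrightarrow> h 0 < a0 \<Longrightarrow> 0 \<le> t1 \<Longrightarrow> t1 < t2 \<Longrightarrow> t2 < t3 \<Longrightarrow> t3 \<le> b \<Longrightarrow>
       q t1 = 0 \<Longrightarrow> q t2 = 0 \<Longrightarrow> q t3 = 0 \<Longrightarrow> 1 \<le> h t1 \<Longrightarrow> h t2 \<le> 1 \<Longrightarrow> 1 \<le> h t3 \<Longrightarrow> False"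
proof -
  \<comment> \<open>At least 2, so that heights above \<open>M\<close> are clear of the level 1; the
    other value makes \<open>M^n\<close> at least the source \<open>h^(p - 1)\<close> at
    \<open>h = 1 / 2\<close>.\<close>
  define M where "M = max 2 (2 powr ((1 - p) / n))"
  have M2: "2 \<le> M" by (simp add: M_def)
  have Mn: "2 powr (1 - p) \<le> M ^ n"
  proof -
    have "2 powr (1 - p) = (2 powr ((1 - p) / n)) ^ n"
      using n by (simp add: powr_realpow[symmetric] powr_powr)
    also have "\<dots> \<le> M ^ n" by (intro power_mono) (auto simp: M_def)
    finally show ?thesis .
  qed
  obtain a1 where a1: "0 < a1"
    "\<And>b h q \<theta>. is_sol b h q \<Longrightarrow> b < pi \<Longrightarrow> h 0 < a1 \<Longrightarrow> 1 \<le> \<theta> \<Longrightarrow> \<theta> \<le> pi / 2 \<Longrightarrow> \<theta> \<le> b \<Longrightarrow>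
       M < sin \<theta> * radius h q \<theta>"
    using large_radius_if_small_start[of M] M2 by auto
  have pi3: "1 < pi / 3" using pi_gt3 by simp
  have False
    if sol: "is_sol b h q" and b: "b < pi" and a: "h 0 < min a1 (1 / 2)"
      and t: "0 \<le> t1" "t1 < t2" "t2 < t3" "t3 \<le> b"
      and q: "q t1 = 0" "q t2 = 0" "q t3 = 0" and h: "1 \<le> h t1" "h t2 \<le> 1" "1 \<le> h t3"
    for b h q t1 t2 t3
  proof -
    have big: "M < sin \<theta> * radius h q \<theta>" if "1 \<le> \<theta>" "\<theta> \<le> pi / 2" "\<theta> \<le> b" for \<theta>
      using a1(2)[OF sol b] a that by simp
    \<comment> \<open>At a critical point \<open>g = h\<close>, so a height of at most 1 contradicts
      the large radius between angle 1 and the equator.\<close>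
    have low: False if "1 \<le> x" "x \<le> pi / 2" "x \<le> b" "q x = 0" "h x \<le> 1" for x
    proof -
      have "sin x * h x \<le> 1 * 1"
        using that is_sol_pos[OF sol b, of x] by (intro mult_mono) auto
      then show False using big[OF that(1-3)] that(4) M2 by simp
    qed
    \<comment> \<open>The support inequality at \<open>x\<close>, evaluated at the pole: a critical
      height of at least 1 within pi/3 of the pole would force
      \<open>h 0 \<ge> 1 / 2\<close>.\<close>
    have start: "pi / 3 < x" if "0 \<le> x" "x \<le> b" "q x = 0" "1 \<le> h x" for x
    proof (rule gt_pi_third[OF that(1)], rule ccontr)
      assume "\<not> cos x < 1 / 2"
      then have "1 * (1 / 2) \<le> h x * cos x" using that by (intro mult_mono) auto
      also have "\<dots> \<le> h 0" using support_inequality_crit[OF sol b that(1,2), of 0] that t by simp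
      finally show False using a by simp
    qed
    have "pi / 3 < t1" using start q h t by simp
    have t2: "pi / 2 < t2"
      using low[of t2] t q h \<open>pi / 3 < t1\<close> pi3 by force
    have pb: "pi / 2 \<le> b" using t2 t by simp
    have Hp: "M < h (pi / 2)" using big[of "pi / 2"] pb pi_gt3 by simp
    have "\<exists>x\<in>{0..t2}. \<forall>y\<in>{0..t2}. h y \<le> h x"
      by (rule continuous_attains_sup) (use t in \<open>auto intro: continuous_on_subset[OF is_solD(1)[OF sol]]\<close>)
    then obtain s1 where s1: "s1 \<in> {0..t2}" "\<And>y. y \<in> {0..t2} \<Longrightarrow> h y \<le> h s1" by blast
    have H1: "M < h s1" using s1(2)[of "pi / 2"] Hp t2 pi_gt3 by simp
    have "s1 \<noteq> 0" using H1 a M2 by auto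
    moreover have "s1 \<noteq> t2" using H1 h M2 by auto
    ultimately have s1': "0 < s1" "s1 < t2" using s1(1) by auto
    have qs1: "q s1 = 0"
      by (rule slope_at_interior_extremum[OF sol b order_refl s1']) (use s1 t in auto)
    have s1p: "pi / 3 < s1" using start[of s1] qs1 s1' t H1 M2 by simp
    have "\<exists>x\<in>{s1..t3}. \<forall>y\<in>{s1..t3}. h x \<le> h y"
      by (rule continuous_attains_inf) (use t s1' in \<open>auto intro: continuous_on_subset[OF is_solD(1)[OF sol]]\<close>)
    then obtain s2 where s2: "s2 \<in> {s1..t3}" "\<And>y. y \<in> {s1..t3} \<Longrightarrow> h s2 \<le> h y" by blast
    have H2: "h s2 \<le> 1" using s2(2)[of t2] h s1' t by simp
    have "s2 \<noteq> s1" using H2 H1 M2 by auto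
    then have s2': "s1 < s2" using s2 by simp
    have qs2: "q s2 = 0"
    proof (cases "s2 = t3")
      case False
      then show ?thesis
        using slope_at_interior_extremum[OF sol b less_imp_le[OF s1'(1)] s2', of t3] s2 t by auto
    qed (use q in simp)
    have s2b: "s2 \<le> b" using s2 t by simp
    have s2p: "pi / 2 < s2"
      using low[of s2] s2b H2 qs2 s2' s1p pi3 by force
    define c where "c = h s2 powr (p - 1)"
    have hs2: "0 < h s2" using is_sol_pos(1)[OF sol b, of s2] s2b s2p pi_gt3 by simp
    have hc: "h s2 ^ n \<le> c"
    proof -
      have "h s2 ^ n \<le> 1" using H2 hs2 by (intro power_le_one) auto
      also have "1 = 1 powr (p - 1)" by simp
      also have "\<dots> \<le> c" unfolding c_def by (rule powr_source_mono[OF hs2 H2])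
      finally show ?thesis .
    qed
    \<comment> \<open>From \<open>s\<close> to \<open>s2\<close> the cosine is not positive, and
      \<open>g s = h s > M\<close> for either choice: \<open>q\<close> vanishes at
      \<open>s1\<close>, and \<open>cos\<close> at the equator.\<close>
    define s where "s = max s1 (pi / 2)"
    have s: "0 \<le> s" "s \<le> s2" "pi / 2 \<le> s" "s1 \<le> s" using s2' s2p s1' by (auto simp: s_def)
    have "sin s ^ n * radius h q s ^ n - c * sin s ^ n \<le> sin s2 ^ n * radius h q s2 ^ n - c * sin s2 ^ n"
    proof (rule radius_power_compare_le[OF sol b s(1,2) s2b])
      fix x assume x: "s < x" "x < s2"
      have "h x powr (p - 1) \<le> c" unfolding c_def
        by (rule powr_source_mono[OF hs2]) (use s2 s x in auto)
      moreover have "cos x \<le> 0" using cos_ge_zero[of "pi - x"] x s s2b b by auto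
      ultimately show "0 \<le> cos x * (h x powr (p - 1) - c)" by (intro mult_nonpos_nonpos) auto
    qed
    also have "\<dots> = (h s2 ^ n - c) * sin s2 ^ n" using qs2 by (simp add: algebra_simps)
    also have "\<dots> \<le> 0" using hc is_sol_pos(3)[OF sol b, of s2] s s2b by (intro mult_nonpos_nonneg) auto
    finally have "sin s ^ n * radius h q s ^ n \<le> sin s ^ n * c" by (simp add: mult.commute)
    moreover have "0 < sin s" using is_sol_pos(4)[OF sol b, of s] s s2b pi_gt_zero by linarith
    ultimately have gc: "radius h q s ^ n \<le> c" by simp
    have "M < radius h q s"
      using H1 Hp qs1 by (auto simp: s_def max_def)
    then have M3: "M ^ n < c"
      using gc power_strict_mono[of M "radius h q s" n] M2 n by simp
    \<comment> \<open>The source at \<open>s2\<close> exceeds \<open>M^n\<close>, and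
      \<open>h^(p - 1)\<close> decreases in \<open>h\<close>, so \<open>h s2\<close> lies below the
      height \<open>1 / 2\<close> used to choose \<open>M\<close>.\<close>
    have half: "h s2 < 1 / 2"
    proof (rule ccontr)
      assume "\<not> h s2 < 1 / 2"
      then have "c \<le> (1 / 2) powr (p - 1)" unfolding c_def by (intro powr_source_mono) auto
      also have "\<dots> = 2 powr (1 - p)" by (simp add: powr_divide powr_minus_divide[symmetric])
      finally show False using M3 Mn by simp
    qed
    have "pi / 3 < s2 - s1"
    proof (rule gt_pi_third)
      have "h s1 * cos (s2 - s1) \<le> h s2"
        by (rule support_inequality_crit[OF sol b]) (use s1' s2' s2b qs1 in auto)
      moreover have "2 * (1/2) \<le> h s1 * cos (s2 - s1)" if "1 / 2 \<le> cos (s2 - s1)"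
        using that H1 M2 by (intro mult_mono) auto
      ultimately show "cos (s2 - s1) < 1 / 2" using half by fastforce
    qed (use s2' in simp)
    moreover have "pi / 3 < t3 - s2"
    proof (rule gt_pi_third)
      have "h t3 * cos (s2 - t3) \<le> h s2"
        by (rule support_inequality_crit[OF sol b]) (use t s2b s2' s1' q in auto)
      moreover have "1 * (1/2) \<le> h t3 * cos (s2 - t3)" if "1 / 2 \<le> cos (s2 - t3)"
        using that h by (intro mult_mono) auto
      moreover have "cos (s2 - t3) = cos (t3 - s2)" using cos_minus[of "t3 - s2"] by simp
      ultimately show "cos (t3 - s2) < 1 / 2" using half by fastforce
    qed (use s2 in simp)
    ultimately show False using s1p t b by simp
  qed
  then show ?thesis using that[of "min a1 (1/2)"] a1(1) by auto
qed

section \<open>Bounds uniform for initial heights in \<open>{a0..1}\<close>\<close>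

lemma power_root_le:
  assumes "0 \<le> g" "g ^ n \<le> X" shows "g \<le> X powr (1 / n)"
proof (cases "g = 0")
  case False
  then have "(g ^ n) powr (1 / n) \<le> X powr (1 / n)" using assms by (intro powr_mono2) auto
  then show ?thesis using root_powr(1)[of g] False assms by simp
qed simp

lemma power_root_ge:
  assumes "0 < g" "0 < X" "X \<le> g ^ n" shows "X powr (1 / n) \<le> g"
proof -
  have "X powr (1 / n) \<le> (g ^ n) powr (1 / n)" using assms by (intro powr_mono2) auto
  then show ?thesis using root_powr(1)[of g] assms by simp
qed

text \<open>Integrating from the pole, where \<open>sin\<close> vanishes, turns a one-sided bound on
  \<open>h\<close> into the opposite bound on \<open>g\<close>, because the exponent
  \<open>p - 1\<close> of the source is negative.\<close>

lemma north_radius_upper: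
  assumes sol: "is_sol b h q" and b: "b < pi" and t: "0 < t" "t \<le> b" "t \<le> pi / 2" and m: "0 < m"
    and h: "\<And>x. 0 < x \<Longrightarrow> x < t \<Longrightarrow> m \<le> h x"
  shows "radius h q t \<le> m powr ((p - 1) / n)"
proof -
  have "sin t ^ n * radius h q t ^ n - m powr (p - 1) * sin t ^ n \<le> sin 0 ^ n * radius h q 0 ^ n - m powr (p - 1) * sin 0 ^ n"
  proof (rule radius_power_compare_ge[OF sol b])
    fix x assume x: "0 < x" "x < t"
    show "cos x * (h x powr (p - 1) - m powr (p - 1)) \<le> 0"
      using powr_source_mono[OF m h[OF x]] x t by (intro mult_nonneg_nonpos cos_ge_zero) auto
  qed (use t in auto)
  moreover have "(0::real) ^ n = 0" using n by simp
  ultimately have "sin t ^ n * radius h q t ^ n \<le> sin t ^ n * m powr (p - 1)" by (simp add: mult.commute)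
  then have "radius h q t ^ n \<le> m powr (p - 1)" using is_sol_pos(4)[OF sol b, of t] t by simp
  then have "radius h q t \<le> (m powr (p - 1)) powr (1 / n)"
    using is_sol_pos(2)[OF sol b, of t] t by (intro power_root_le) auto
  then show ?thesis by (simp add: powr_powr)
qed

lemma north_radius_lower:
  assumes sol: "is_sol b h q" and b: "b < pi" and t: "0 < t" "t \<le> b" "t \<le> pi / 2"
    and h: "\<And>x. 0 < x \<Longrightarrow> x < t \<Longrightarrow> h x \<le> m" and m: "0 < m"
  shows "m powr ((p - 1) / n) \<le> radius h q t"
proof -
  have "sin 0 ^ n * radius h q 0 ^ n - m powr (p - 1) * sin 0 ^ n \<le> sin t ^ n * radius h q t ^ n - m powr (p - 1) * sin t ^ n"
  proof (rule radius_power_compare_le[OF sol b])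
    fix x assume x: "0 < x" "x < t"
    have "m powr (p - 1) \<le> h x powr (p - 1)"
      by (rule powr_source_mono) (use h[OF x] is_sol_pos(1)[OF sol b, of x] x t in auto)
    then show "0 \<le> cos x * (h x powr (p - 1) - m powr (p - 1))"
      using x t by (intro mult_nonneg_nonneg cos_ge_zero) auto
  qed (use t in auto)
  moreover have "(0::real) ^ n = 0" using n by simp
  ultimately have "sin t ^ n * m powr (p - 1) \<le> sin t ^ n * radius h q t ^ n" by (simp add: mult.commute)
  then have "m powr (p - 1) \<le> radius h q t ^ n" using is_sol_pos(4)[OF sol b, of t] t by simp
  then have "(m powr (p - 1)) powr (1 / n) \<le> radius h q t"
    using is_sol_pos(2)[OF sol b, of t] t m by (intro power_root_ge) auto
  then show ?thesis by (simp add: powr_powr)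
qed

text \<open>Bounds on \<open>h\<close> and \<open>g\<close> are obtained alternately. Up to pi/3 the
  tangent comparison at the pole bounds \<open>h\<close> below, hence \<open>g\<close> above, hence
  \<open>h\<close> above, hence \<open>g\<close> below. The growing distance from the axis carries
  the lower bound for \<open>g\<close> to the equator; at a minimum of \<open>h\<close> over an
  initial interval, \<open>q \<le> 0\<close> gives \<open>h \<ge> g\<close>, which bounds
  \<open>h\<close> below up to the equator, and finally \<open>g\<close> above.\<close>

lemma north_bounds:
  fixes a0 :: real
  assumes a0: "0 < a0"
  obtains c C where "0 < c" "0 < C"
    "\<And>b h q \<theta>. is_sol b h q \<Longrightarrow> b < pi \<Longrightarrow> a0 \<le> h 0 \<Longrightarrow> h 0 \<le> 1 \<Longrightarrow> 0 < \<theta> \<Longrightarrow> \<theta> \<le> b \<Longrightarrow> \<theta> \<le> pi / 2 \<Longrightarrow>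
       c \<le> h \<theta> \<and> c \<le> radius h q \<theta> \<and> radius h q \<theta> \<le> C"
proof -
  define m where "m = a0 / 2"
  define C1 where "C1 = m powr ((p - 1) / n)"
  define c1 where "c1 = (1 + C1) powr ((p - 1) / n)"
  define c where "c = min a0 (c1 / 2)"
  define C where "C = c powr ((p - 1) / n)"
  have pos: "0 < m" "0 < C1" using a0 by (auto simp: m_def C1_def)
  have pos': "0 < c1" using pos by (auto simp: c1_def)
  have c: "0 < c" using pos' a0 by (auto simp: c_def)
  have C: "0 < C" using c by (simp add: C_def)
  have "c \<le> h \<theta> \<and> c \<le> radius h q \<theta> \<and> radius h q \<theta> \<le> C"
    if sol: "is_sol b h q" and b: "b < pi" and h0: "a0 \<le> h 0" "h 0 \<le> 1"
      and th: "0 < \<theta>" "\<theta> \<le> b" "\<theta> \<le> pi / 2" for b h q \<theta>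
  proof -
    define g where "g x = radius h q x" for x
    have hm: "m \<le> h x" if x: "0 \<le> x" "x \<le> b" "x \<le> pi / 3" for x
    proof -
      have "a0 * (1/2) \<le> h 0 * cos x" using cos_gt_half[of x] x h0 a0 by (intro mult_mono) auto
      also have "\<dots> \<le> h x" using support_inequality[OF sol b, of 0 x] x by simp
      finally show ?thesis by (simp add: m_def)
    qed
    have gC: "g x \<le> C1" if x: "0 < x" "x \<le> b" "x \<le> pi / 3" for x
      unfolding g_def C1_def by (rule north_radius_upper[OF sol b x(1,2) _ pos(1)]) (use x hm in auto)
    have hM: "h x \<le> 1 + C1" if x: "0 < x" "x \<le> b" "x \<le> pi / 3" for x
    proof -
      have s: "0 \<le> sin x" "sin x \<le> 1" using is_sol_pos(3)[OF sol b, of x] x by auto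
      have g0: "0 < g x" using is_sol_pos(2)[OF sol b, of x] x by (simp add: g_def)
      have "sin x * (sin x * g x) \<le> 1 * (1 * C1)"
        using s g0 gC[OF x] by (intro mult_mono mult_nonneg_nonneg) auto
      moreover have "(h x * cos x - q x * (sin x)\<^sup>2) * cos x \<le> 1"
      proof -
        have cx: "0 \<le> cos x" "cos x \<le> 1" using x by (auto intro!: cos_ge_zero)
        have "(h x * cos x - q x * (sin x)\<^sup>2) * cos x \<le> 1 * cos x"
          using height_bound[OF sol b, of x] x h0 cx by (intro mult_right_mono) auto
        also have "1 * cos x \<le> 1" by simp
        finally show ?thesis .
      qed
      ultimately show ?thesis using profile_decomp[of h x q] by (simp add: g_def)
    qed
    have gc1: "c1 \<le> g x" if x: "0 < x" "x \<le> b" "x \<le> pi / 3" for x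
      unfolding g_def c1_def by (rule north_radius_lower[OF sol b x(1,2)]) (use x hM pos in auto)
    have gc: "c1 / 2 \<le> g x" if x: "0 < x" "x \<le> b" "x \<le> pi / 2" for x
    proof (cases "x \<le> pi / 3")
      case False
      have "1 / 2 * c1 \<le> sin (pi / 3) * g (pi / 3)"
      proof (rule mult_mono)
        have "1 / 2 \<le> sqrt 3 / 2" by simp
        then show "1 / 2 \<le> sin (pi / 3)" by (simp add: sin_60)
      qed (use gc1[of "pi/3"] False x pos' in \<open>auto intro: sin_ge_zero\<close>)
      also have "\<dots> \<le> sin x * g x" unfolding g_def
        by (rule north_radius_mono[OF sol b]) (use False x in auto)
      also have "\<dots> \<le> 1 * g x" using is_sol_pos(2)[OF sol b, of x] x by (intro mult_right_mono) (auto simp: g_def)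
      finally show ?thesis by simp
    qed (use gc1[of x] x pos' in simp)
    have hc: "c \<le> h x" if x: "0 < x" "x \<le> b" "x \<le> pi / 2" for x
    proof -
      have "\<exists>y\<in>{0..x}. \<forall>z\<in>{0..x}. h y \<le> h z"
        by (rule continuous_attains_inf) (use x in \<open>auto intro: continuous_on_subset[OF is_solD(1)[OF sol]]\<close>)
      then obtain y where y: "y \<in> {0..x}" "\<And>z. z \<in> {0..x} \<Longrightarrow> h y \<le> h z" by blast
      have "c \<le> h y"
      proof (cases "y = 0")
        case False
        then have y0: "0 < y" "y \<le> b" "y \<le> pi / 2" using y x by auto
        have "q y \<le> 0" by (rule slope_at_left_min[OF sol b order_refl y0(1,2)]) (use y in auto)
        then have "q y * cos y \<le> 0" using y0 by (intro mult_nonpos_nonneg cos_ge_zero) auto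
        then show ?thesis using gc[OF y0] by (simp add: g_def c_def)
      qed (use h0 in \<open>simp add: c_def\<close>)
      then show ?thesis using y(2)[of x] x by simp
    qed
    have "g \<theta> \<le> C" unfolding g_def C_def
      by (rule north_radius_upper[OF sol b th c]) (use hc th in auto)
    then show ?thesis using hc[OF th] gc[OF th] by (simp add: g_def c_def)
  qed
  then show ?thesis using that c C by blast
qed

lemma cos_nonpos_south: "pi / 2 \<le> x \<Longrightarrow> x \<le> pi \<Longrightarrow> cos x \<le> 0"
  using cos_ge_zero[of "pi - x"] by simp

lemma south_radius_antimono:
  assumes sol: "is_sol b h q" and b: "b < pi" and st: "pi / 2 \<le> s" "s \<le> t" "t \<le> b"
  shows "sin t * radius h q t \<le> sin s * radius h q s"
proof -
  have "sin t ^ n * radius h q t ^ n - 0 * sin t ^ n \<le> sin s ^ n * radius h q s ^ n - 0 * sin s ^ n"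
  proof (rule radius_power_compare_ge[OF sol b])
    show "0 \<le> s" using st pi_gt_zero by linarith
  qed (use st b in \<open>auto intro!: mult_nonpos_nonneg cos_nonpos_south\<close>)
  then have "(sin t * radius h q t) ^ n \<le> (sin s * radius h q s) ^ n"
    by (simp add: power_mult_distrib)
  moreover have "0 \<le> sin s * radius h q s"
    using is_sol_pos[OF sol b, of s] st pi_gt_zero by (intro mult_nonneg_nonneg) auto
  ultimately show ?thesis using n by (cases n) (auto intro: power_le_imp_le_base)
qed

text \<open>\<open>(h / cos)' = g sin / cos^2\<close>, so \<open>h / |cos|\<close> does not increase
  beyond the equator.\<close>

lemma south_upper_bound:
  assumes sol: "is_sol b h q" and b: "b < pi" and st: "pi / 2 < s" "s \<le> t" "t \<le> b"
  shows "h t \<le> h s / \<bar>cos s\<bar>"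
proof -
  have neg: "cos x < 0" if "s \<le> x" "x \<le> t" for x
    using cos_gt_zero[of "pi - x"] that st b by simp
  have s0: "0 < s" using st pi_gt_zero by linarith
  have "h s / cos s \<le> h t / cos t"
  proof (rule DERIV_nonneg_imp_increasing_open[OF st(2)])
    fix x assume x: "s < x" "x < t"
    have c: "cos x \<noteq> 0" using neg[of x] x by simp
    have x': "0 < x" "x < b" using x st pi_gt_zero by linarith+
    have "((\<lambda>x. h x / cos x) has_real_derivative (q x * sin x * cos x - h x * - sin x) / (cos x * cos x)) (at x)"
      by (rule derivative_eq_intros is_solD(5)[OF sol x'] refl c)+ simp
    moreover have "q x * sin x * cos x - h x * - sin x = sin x * radius h q x" by (simp add: algebra_simps)
    moreover have "0 \<le> sin x * radius h q x" using is_sol_pos[OF sol b, of x] x' by simp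
    ultimately show "\<exists>y. ((\<lambda>x. h x / cos x) has_real_derivative y) (at x) \<and> 0 \<le> y"
      by (intro exI[of _ "sin x * radius h q x / (cos x * cos x)"] conjI) (simp_all only:, simp)
  next
    have "continuous_on {s..t} h" by (rule continuous_on_subset[OF is_solD(1)[OF sol]]) (use st s0 in auto)
    then show "continuous_on {s..t} (\<lambda>x. h x / cos x)"
      using neg by (intro continuous_intros) force+
  qed
  then have "h t \<le> h s / cos s * cos t"
    using neg[of t] st by (simp add: divide_le_eq le_divide_eq)
  also have "\<dots> = h s / \<bar>cos s\<bar> * \<bar>cos t\<bar>" using neg[of s] neg[of t] st by simp
  also have "\<dots> \<le> h s / \<bar>cos s\<bar> * 1"
    using is_sol_pos(1)[OF sol b, of s] st s0 by (intro mult_left_mono) (auto simp: less_imp_le)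
  finally show ?thesis by simp
qed

text \<open>The bound of \<open>south_upper_bound\<close> degenerates at the equator, so the
  northern bounds are first carried a little further, to some \<open>\<beta>\<close> past pi/2 that
  is independent of the solution. Beyond \<open>\<beta>\<close> only the upper bound on
  \<open>h\<close> survives.\<close>

lemma past_equator_bounds:
  fixes a0 :: real
  assumes a0: "0 < a0"
  obtains \<beta> c C where "pi / 2 < \<beta>" "\<beta> < pi" "0 < c" "0 < C"
    "\<And>b h q \<theta>. is_sol b h q \<Longrightarrow> b < pi \<Longrightarrow> a0 \<le> h 0 \<Longrightarrow> h 0 \<le> 1 \<Longrightarrow> 0 < \<theta> \<Longrightarrow> \<theta> \<le> b \<Longrightarrow> \<theta> \<le> \<beta> \<Longrightarrow> c \<le> h \<theta>"
    "\<And>b h q \<theta>. is_sol b h q \<Longrightarrow> b < pi \<Longrightarrow> a0 \<le> h 0 \<Longrightarrow> h 0 \<le> 1 \<Longrightarrow> 0 < \<theta> \<Longrightarrow> \<theta> \<le> b \<Longrightarrow> h \<theta> \<le> C"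
proof -
  obtain c C where c: "0 < c" and C: "0 < C" and nb:
    "\<And>b h q \<theta>. is_sol b h q \<Longrightarrow> b < pi \<Longrightarrow> a0 \<le> h 0 \<Longrightarrow> h 0 \<le> 1 \<Longrightarrow> 0 < \<theta> \<Longrightarrow> \<theta> \<le> b \<Longrightarrow> \<theta> \<le> pi / 2 \<Longrightarrow>
       c \<le> h \<theta> \<and> c \<le> radius h q \<theta> \<and> radius h q \<theta> \<le> C"
    using north_bounds[OF a0] by blast
  define k where "k = (c / 2) powr (p - 1)"
  have k: "0 < k" using c by (simp add: k_def)
  \<comment> \<open>Conditions on \<open>\<beta>\<close>: the tangent function at the equator, with
    value at least \<open>c\<close> and slope at least -1, stays above \<open>c / 2\<close>, and
    \<open>(g sin)^n\<close> loses at most half of \<open>c^n\<close>.\<close>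
  have t1: "((\<lambda>x. c * sin x + cos x) \<longlongrightarrow> c * sin (pi / 2) + cos (pi / 2)) (at_right (pi / 2))"
    by (intro tendsto_intros)
  have t2: "((\<lambda>x. k * (1 - sin x ^ n)) \<longlongrightarrow> k * (1 - sin (pi / 2) ^ n)) (at_right (pi / 2))"
    by (intro tendsto_intros)
  have "eventually (\<lambda>x. c / 2 < c * sin x + cos x) (at_right (pi / 2))"
    by (rule order_tendstoD(1)[OF t1]) (use c in simp)
  moreover have "eventually (\<lambda>x. k * (1 - sin x ^ n) < c ^ n / 2) (at_right (pi / 2))"
    by (rule order_tendstoD(2)[OF t2]) (use c in simp)
  moreover have "eventually (\<lambda>x. x \<in> {pi/2<..<pi}) (at_right (pi / 2))"
    by (rule eventually_at_right_real) simp
  ultimately have "eventually (\<lambda>x. c / 2 < c * sin x + cos x \<and> k * (1 - sin x ^ n) < c ^ n / 2 \<and> x < pi) (at_right (pi / 2))"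
    by eventually_elim auto
  then obtain \<beta>' where \<beta>': "pi / 2 < \<beta>'"
    "\<And>x. pi / 2 < x \<Longrightarrow> x < \<beta>' \<Longrightarrow> c / 2 < c * sin x + cos x \<and> k * (1 - sin x ^ n) < c ^ n / 2 \<and> x < pi"
    unfolding eventually_at_right_field by blast
  define \<beta> where "\<beta> = (pi / 2 + \<beta>') / 2"
  have \<beta>: "pi / 2 < \<beta>" "\<beta> < \<beta>'" using \<beta>'(1) by (auto simp: \<beta>_def)
  have \<beta>pi: "\<beta> < pi" using \<beta>'(2)[OF \<beta>] by simp
  have cb: "0 < \<bar>cos \<beta>\<bar>" using cos_gt_zero[of "pi - \<beta>"] \<beta> \<beta>pi by simp
  define K where "K = (c / 2) powr (p - n)"
  define C2 where "C2 = C + 1 + K * pi"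
  have K: "0 < K" using c by (simp add: K_def)
  have C2: "0 < C2" using C K by (auto simp: C2_def intro!: add_pos_pos)
  have main: "c / 2 \<le> h \<theta> \<and> c / 2 \<le> radius h q \<theta>"
    if sol: "is_sol b h q" and b: "b < pi" and h0: "a0 \<le> h 0" "h 0 \<le> 1"
      and th: "0 < \<theta>" "\<theta> \<le> b" "\<theta> \<le> \<beta>" for b h q \<theta>
  proof (cases "\<theta> \<le> pi / 2")
    case True
    then show ?thesis using nb[OF sol b h0 th(1,2)] c by auto
  next
    case False
    have pb: "pi / 2 \<le> b" using False th by simp
    have hp: "c \<le> h (pi / 2)" using nb[OF sol b h0, of "pi / 2"] pb by simp
    \<comment> \<open>At the equator the height is \<open>- q (pi / 2)\<close>, and heights never
      exceed the initial one.\<close>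
    have qp: "-1 \<le> q (pi / 2)" using height_bound[OF sol b, of "pi / 2"] pb h0 by simp
    have hx: "c / 2 \<le> h x" if x: "pi / 2 < x" "x \<le> \<theta>" for x
    proof -
      have x0: "0 < x" using x pi_gt_zero by linarith
      have cx: "cos x \<le> 0" using x th b by (intro cos_nonpos_south) auto
      have "q (pi / 2) * sin (pi / 2) * sin (x - pi / 2) + h (pi / 2) * cos (x - pi / 2) \<le> h x"
        by (rule support_inequality[OF sol b]) (use x x0 th pb in auto)
      moreover have "sin (x - pi / 2) = - cos x" "cos (x - pi / 2) = sin x"
        by (simp_all add: sin_diff cos_diff)
      ultimately have "q (pi / 2) * - cos x + h (pi / 2) * sin x \<le> h x" by simp
      moreover have "-1 * - cos x \<le> q (pi / 2) * - cos x" by (rule mult_right_mono[OF qp]) (use cx in simp)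
      moreover have "c * sin x \<le> h (pi / 2) * sin x"
        by (rule mult_right_mono[OF hp]) (use is_sol_pos(3)[OF sol b, of x] x x0 th in auto)
      moreover have "c / 2 < c * sin x + cos x" using \<beta>'(2)[of x] x th \<beta> by simp
      ultimately show ?thesis by simp
    qed
    have "sin (pi/2) ^ n * radius h q (pi/2) ^ n - k * sin (pi/2) ^ n
       \<le> sin \<theta> ^ n * radius h q \<theta> ^ n - k * sin \<theta> ^ n"
    proof (rule radius_power_compare_le[OF sol b])
      fix x assume x: "pi / 2 < x" "x < \<theta>"
      have "h x powr (p - 1) \<le> k" unfolding k_def by (rule powr_source_mono) (use c hx[of x] x in auto)
      then show "0 \<le> cos x * (h x powr (p - 1) - k)"
        using x th b by (intro mult_nonpos_nonpos cos_nonpos_south) auto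
    qed (use False th in auto)
    then have "h (pi/2) ^ n - k * (1 - sin \<theta> ^ n) \<le> (sin \<theta> * radius h q \<theta>) ^ n"
      unfolding power_mult_distrib by (simp add: right_diff_distrib)
    moreover have "c ^ n \<le> h (pi/2) ^ n" using hp c by (intro power_mono) auto
    moreover have "k * (1 - sin \<theta> ^ n) < c ^ n / 2" using \<beta>'(2)[of \<theta>] False th \<beta> by simp
    moreover have "(c / 2) ^ n \<le> c ^ n / 2"
    proof -
      have "(2::real) ^ 1 \<le> 2 ^ n" using n by (intro power_increasing) auto
      then have "c ^ n / 2 ^ n \<le> c ^ n / 2" using c by (intro divide_left_mono) auto
      then show ?thesis by (simp add: power_divide)
    qed
    ultimately have pw: "(c / 2) ^ n \<le> (sin \<theta> * radius h q \<theta>) ^ n" by linarith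
    have g0: "0 < radius h q \<theta>" "0 \<le> sin \<theta>" using is_sol_pos[OF sol b, of \<theta>] th by auto
    have "c / 2 \<le> sin \<theta> * radius h q \<theta>"
    proof (rule ccontr)
      assume "\<not> ?thesis"
      then have "(sin \<theta> * radius h q \<theta>) ^ n < (c / 2) ^ n"
        using g0 n by (intro power_strict_mono) auto
      then show False using pw by simp
    qed
    also have "\<dots> \<le> 1 * radius h q \<theta>" using g0 by (intro mult_right_mono) auto
    finally show ?thesis using hx[of \<theta>] False by simp
  qed
  have up1: "h \<theta> \<le> C2"
    if sol: "is_sol b h q" and b: "b < pi" and h0: "a0 \<le> h 0" "h 0 \<le> 1"
      and th: "0 < \<theta>" "\<theta> \<le> b" "\<theta> \<le> \<beta>" for b h q \<theta>
  proof -
    have s0: "0 \<le> sin \<theta>" using is_sol_pos(3)[OF sol b, of \<theta>] th by simp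
    have rho: "sin \<theta> * radius h q \<theta> \<le> C"
    proof (cases "\<theta> \<le> pi / 2")
      case True
      have "sin \<theta> * radius h q \<theta> \<le> 1 * C"
        using nb[OF sol b h0 th(1,2) True] s0 c C by (intro mult_mono) auto
      then show ?thesis by simp
    next
      case False
      have "sin \<theta> * radius h q \<theta> \<le> sin (pi/2) * radius h q (pi/2)"
        by (rule south_radius_antimono[OF sol b]) (use False th in auto)
      also have "\<dots> \<le> C" using nb[OF sol b h0, of "pi/2"] False th by simp
      finally show ?thesis .
    qed
    have "sin \<theta> * (sin \<theta> * radius h q \<theta>) \<le> 1 * C"
      using rho s0 C by (intro mult_mono) (auto intro!: mult_nonneg_nonneg is_sol_pos(2)[OF sol b, THEN less_imp_le] simp: th less_imp_le)
    moreover have "(h \<theta> * cos \<theta> - q \<theta> * (sin \<theta>)\<^sup>2) * cos \<theta> \<le> 1 + K * pi"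
    proof -
      \<comment> \<open>The height starts at \<open>h 0 \<le> 1\<close>, decreases, and has bounded
        speed up to \<open>\<beta>\<close>, so it is bounded on both sides; with the distance from
        the axis this bounds \<open>h\<close>.\<close>
      define Z where "Z = h \<theta> * cos \<theta> - q \<theta> * (sin \<theta>)\<^sup>2"
      have "Z \<le> 1" using height_bound[OF sol b, of \<theta>] th h0 by (simp add: Z_def)
      moreover have "h 0 - K * \<theta> \<le> Z" unfolding Z_def K_def
        by (rule height_lower[OF sol b]) (use c main[OF sol b h0] th in auto)
      moreover have "K * \<theta> \<le> K * pi" using K th b by (intro mult_left_mono) auto
      ultimately have "\<bar>Z\<bar> \<le> 1 + K * pi" using h0 a0 K pi_gt_zero
        by (smt (verit) mult_pos_pos)
      then have "\<bar>Z * cos \<theta>\<bar> \<le> (1 + K * pi) * 1" unfolding abs_mult by (intro mult_mono) auto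
      then show ?thesis by (simp add: Z_def)
    qed
    ultimately show ?thesis using profile_decomp[of h \<theta> q] by (simp add: C2_def)
  qed
  have up: "h \<theta> \<le> C2 / \<bar>cos \<beta>\<bar>"
    if sol: "is_sol b h q" and b: "b < pi" and h0: "a0 \<le> h 0" "h 0 \<le> 1"
      and th: "0 < \<theta>" "\<theta> \<le> b" for b h q \<theta>
  proof (cases "\<theta> \<le> \<beta>")
    case True
    have "C2 * \<bar>cos \<beta>\<bar> \<le> C2 * 1" using C2 by (intro mult_left_mono) auto
    then have "C2 \<le> C2 / \<bar>cos \<beta>\<bar>" using cb by (simp add: le_divide_eq)
    then show ?thesis using up1[OF sol b h0 th True] by simp
  next
    case False
    have "h \<theta> \<le> h \<beta> / \<bar>cos \<beta>\<bar>"
      by (rule south_upper_bound[OF sol b \<beta>(1)]) (use False th in auto)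
    also have "\<dots> \<le> C2 / \<bar>cos \<beta>\<bar>"
      using up1[OF sol b h0, of \<beta>] False th \<beta> pi_gt_zero by (intro divide_right_mono) auto
    finally show ?thesis .
  qed
  show ?thesis
  proof (rule that[OF \<beta>(1) \<beta>pi, of "c/2" "C2 / \<bar>cos \<beta>\<bar>"])
    show "0 < c / 2" "0 < C2 / \<bar>cos \<beta>\<bar>" using c C2 cb by (auto intro: divide_pos_pos)
    show "c / 2 \<le> h \<theta>"
      if "is_sol b h q" "b < pi" "a0 \<le> h 0" "h 0 \<le> 1" "0 < \<theta>" "\<theta> \<le> b" "\<theta> \<le> \<beta>" for b h q \<theta>
      using main[OF that] by simp
    show "h \<theta> \<le> C2 / \<bar>cos \<beta>\<bar>"
      if "is_sol b h q" "b < pi" "a0 \<le> h 0" "h 0 \<le> 1" "0 < \<theta>" "\<theta> \<le> b" for b h q \<theta>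
      by (rule up[OF that])
  qed
qed

text \<open>The end condition gives \<open>g t = h t\<close>, from which \<open>(g sin)^n\<close> is
  followed backwards; this makes the constants independent of the distance of \<open>t\<close> from
  pi. The lower bound on \<open>h\<close> is delicate only at a minimum \<open>x\<close> past
  \<open>\<beta>\<close>: if it were deep, \<open>t\<close> would be more than pi/3 away and
  \<open>sin t\<close> at most half of \<open>sin x\<close>, and the fall of
  \<open>(g sin)^n\<close> in between shows that \<open>g x = h x\<close> cannot be small.\<close>

lemma apriori_bounds:
  fixes a0 :: real
  assumes a0: "0 < a0"
  obtains c C where "0 < c" "0 < C"
    "\<And>t h q \<theta>. is_sol t h q \<Longrightarrow> t < pi \<Longrightarrow> a0 \<le> h 0 \<Longrightarrow> h 0 \<le> 1 \<Longrightarrow> q t = 0 \<Longrightarrow> 1 \<le> h t \<Longrightarrow>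
       0 < \<theta> \<Longrightarrow> \<theta> \<le> t \<Longrightarrow> c \<le> h \<theta> \<and> h \<theta> \<le> C \<and> c \<le> radius h q \<theta> \<and> radius h q \<theta> \<le> C"
proof -
  obtain c1 C1 where c1: "0 < c1" and C1: "0 < C1" and nb:
    "\<And>b h q \<theta>. is_sol b h q \<Longrightarrow> b < pi \<Longrightarrow> a0 \<le> h 0 \<Longrightarrow> h 0 \<le> 1 \<Longrightarrow> 0 < \<theta> \<Longrightarrow> \<theta> \<le> b \<Longrightarrow> \<theta> \<le> pi / 2 \<Longrightarrow>
       c1 \<le> h \<theta> \<and> c1 \<le> radius h q \<theta> \<and> radius h q \<theta> \<le> C1"
    using north_bounds[OF a0] by blast
  obtain \<beta> c2 C2 where \<beta>: "pi / 2 < \<beta>" "\<beta> < pi" and c2: "0 < c2" and C2: "0 < C2"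
    and lo: "\<And>b h q \<theta>. is_sol b h q \<Longrightarrow> b < pi \<Longrightarrow> a0 \<le> h 0 \<Longrightarrow> h 0 \<le> 1 \<Longrightarrow> 0 < \<theta> \<Longrightarrow> \<theta> \<le> b \<Longrightarrow> \<theta> \<le> \<beta> \<Longrightarrow> c2 \<le> h \<theta>"
    and up: "\<And>b h q \<theta>. is_sol b h q \<Longrightarrow> b < pi \<Longrightarrow> a0 \<le> h 0 \<Longrightarrow> h 0 \<le> 1 \<Longrightarrow> 0 < \<theta> \<Longrightarrow> \<theta> \<le> b \<Longrightarrow> h \<theta> \<le> C2"
    using past_equator_bounds[OF a0] by blast
  define k where "k = C2 powr (p - 1)"
  have k: "0 < k" using C2 by (simp add: k_def)
  \<comment> \<open>Lower bounds for the minimum of \<open>h\<close> by position: at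
    \<open>0\<close>, up to \<open>\<beta>\<close>, and beyond \<open>\<beta>\<close>;
    \<open>1 / 2\<close> covers the end \<open>t\<close> and is the depth from which the pi/3 gap
    follows.\<close>
  define c3 where "c3 = min (min (1 / 2) a0) (min c2 ((k / 2) powr (1 / n)))"
  have c3: "0 < c3" using a0 c2 k by (simp add: c3_def)
  \<comment> \<open>Capped by 1 so that \<open>k1 \<le> h t ^ n\<close>, the starting value for the
    backward comparison.\<close>
  define k1 where "k1 = min k 1"
  define K1 where "K1 = max (C2 ^ n) (c3 powr (p - 1))"
  have k1: "0 < k1" "k1 \<le> k" "k1 \<le> 1" using k by (auto simp: k1_def)
  define c where "c = min (min c1 c3) (k1 powr (1 / n))"
  define C where "C = max (max C1 C2) (K1 powr (1 / n))"
  have "c \<le> h \<theta> \<and> h \<theta> \<le> C \<and> c \<le> radius h q \<theta> \<and> radius h q \<theta> \<le> C"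
    if sol: "is_sol t h q" and b: "t < pi" and h0: "a0 \<le> h 0" "h 0 \<le> 1"
      and qt: "q t = 0" and ht: "1 \<le> h t" and th: "0 < \<theta>" "\<theta> \<le> t" for t h q \<theta>
  proof -
    have hk: "k \<le> h x powr (p - 1)" if "0 < x" "x \<le> t" for x
      unfolding k_def using powr_source_mono[OF is_sol_pos(1)[OF sol b] up[OF sol b h0 that]] that by simp
    have hlow': "c3 \<le> h \<theta>" if th: "0 < \<theta>" "\<theta> \<le> t" for \<theta>
    proof -
      have "\<exists>y\<in>{0..t}. \<forall>z\<in>{0..t}. h y \<le> h z"
        by (rule continuous_attains_inf) (use th is_solD(1)[OF sol] in auto)
      then obtain x where x: "x \<in> {0..t}" "\<And>z. z \<in> {0..t} \<Longrightarrow> h x \<le> h z" by blast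
      have "c3 \<le> h x"
      proof (cases "x = 0 \<or> x = t \<or> x \<le> \<beta>")
        case True
        then consider "x = 0" | "x = t" | "x \<noteq> 0" "x \<le> \<beta>" by blast
        then show ?thesis
        proof cases
          case 1 then show ?thesis using h0 by (simp add: c3_def)
        next
          case 2 then show ?thesis using ht by (simp add: c3_def)
        next
          case 3 then show ?thesis using lo[OF sol b h0, of x] x(1) by (simp add: c3_def)
        qed
      next
        case False
        then have x': "0 < x" "x < t" "pi / 2 < x" using x(1) \<beta> by auto
        have qx: "q x = 0"
          by (rule slope_at_interior_extremum[OF sol b order_refl x'(1,2)]) (use x in auto)
        show ?thesis
        proof (rule ccontr)
          assume "\<not> ?thesis"
          then have small: "h x < c3" by simp
          then have small1: "h x < 1 / 2" by (simp add: c3_def)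
          have xt: "pi / 3 < t - x"
          proof (rule gt_pi_third)
            have "h t * cos (x - t) \<le> h x"
              by (rule support_inequality_crit[OF sol b]) (use x' qt in auto)
            moreover have "1 * (1/2) \<le> h t * cos (x - t)" if "1 / 2 \<le> cos (x - t)"
              using that ht by (intro mult_mono) auto
            moreover have "cos (x - t) = cos (t - x)" using cos_minus[of "t - x"] by simp
            ultimately show "cos (t - x) < 1 / 2" using small1 by fastforce
          qed (use x' in simp)
          have sx: "0 < sin x" using is_sol_pos(4)[OF sol b, of x] x' by simp
          have st: "0 \<le> sin t" using is_sol_pos(3)[OF sol b, of t] x' by simp
          \<comment> \<open>Past the equator the sine decreases, and the cosine term in
            \<open>sin (x + pi / 3)\<close> is not positive.\<close>
          have "sin t \<le> sin (x + pi / 3)"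
          proof -
            have sc: "sin y = cos (y - pi / 2)" for y :: real by (simp add: cos_diff)
            show ?thesis unfolding sc
              using xt x' b by (intro cos_monotone_0_pi_le) auto
          qed
          also have "\<dots> = sin x / 2 + cos x * sin (pi / 3)" by (simp add: sin_add cos_60)
          also have "\<dots> \<le> sin x / 2"
            using cos_nonpos_south[of x] x' b sin_ge_zero[of "pi/3"] by (auto intro!: mult_nonpos_nonneg)
          finally have "sin t ^ n \<le> (sin x / 2) ^ n" using st by (rule power_mono)
          also have "(sin x / 2) ^ n \<le> sin x ^ n / 2"
          proof -
            have "(2::real) ^ 1 \<le> 2 ^ n" using n by (intro power_increasing) auto
            then have "sin x ^ n / 2 ^ n \<le> sin x ^ n / 2" using sx by (intro divide_left_mono) auto
            then show ?thesis by (simp add: power_divide)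
          qed
          finally have sn: "sin t ^ n \<le> sin x ^ n / 2" .
          have "sin t ^ n * radius h q t ^ n - k * sin t ^ n
             \<le> sin x ^ n * radius h q x ^ n - k * sin x ^ n"
          proof (rule radius_power_compare_ge[OF sol b])
            fix y assume y: "x < y" "y < t"
            show "cos y * (h y powr (p - 1) - k) \<le> 0"
              using hk[of y] y x' b by (intro mult_nonpos_nonneg cos_nonpos_south) auto
          qed (use x' in auto)
          moreover have "0 \<le> sin t ^ n * radius h q t ^ n"
            using st is_sol_pos(2)[OF sol b, of t] x' by simp
          ultimately have "k * (sin x ^ n - sin t ^ n) \<le> sin x ^ n * h x ^ n"
            using qx by (simp add: right_diff_distrib)
          moreover have "k * (sin x ^ n / 2) \<le> k * (sin x ^ n - sin t ^ n)"
            using sn k by (intro mult_left_mono) auto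
          ultimately have "sin x ^ n * (k / 2) \<le> sin x ^ n * h x ^ n" by (simp add: mult.commute)
          then have "k / 2 \<le> h x ^ n" using sx by simp
          then have "(k / 2) powr (1 / n) \<le> h x"
            using k is_sol_pos(1)[OF sol b, of x] x' by (intro power_root_ge) auto
          then show False using small by (simp add: c3_def)
        qed
      qed
      then show ?thesis using x(2)[of \<theta>] th by simp
    qed
    have hlow: "c3 \<le> h x" if "0 < x" "x \<le> t" for x using hlow' that by blast
    have south: "k1 powr (1 / n) \<le> radius h q \<theta>" "radius h q \<theta> \<le> K1 powr (1 / n)"
      if s: "pi / 2 < \<theta>"
    proof -
      have st: "0 \<le> sin t" "0 < sin \<theta>" using is_sol_pos[OF sol b, of t] is_sol_pos[OF sol b, of \<theta>] th by auto
      have g0: "0 < radius h q \<theta>" using is_sol_pos(2)[OF sol b, of \<theta>] th by simp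
      \<comment> \<open>At \<open>t\<close> the radius is \<open>h t\<close>; going back from
        \<open>t\<close> to \<open>\<theta>\<close> in the southern hemisphere, the source bound
        \<open>k1\<close> keeps \<open>g^n\<close> above \<open>k1\<close>.\<close>
      have "0 \<le> (h t ^ n - k1) * sin t ^ n" using k1 ht st by (intro mult_nonneg_nonneg) (auto intro: order_trans[OF _ one_le_power])
      also have "\<dots> = sin t ^ n * radius h q t ^ n - k1 * sin t ^ n" using qt by (simp add: algebra_simps)
      also have "\<dots> \<le> sin \<theta> ^ n * radius h q \<theta> ^ n - k1 * sin \<theta> ^ n"
      proof (rule radius_power_compare_ge[OF sol b])
        fix y assume y: "\<theta> < y" "y < t"
        show "cos y * (h y powr (p - 1) - k1) \<le> 0"
          using hk[of y] k1 y th s b by (intro mult_nonpos_nonneg cos_nonpos_south) auto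
      qed (use th in auto)
      finally have "sin \<theta> ^ n * k1 \<le> sin \<theta> ^ n * radius h q \<theta> ^ n" by (simp add: mult.commute)
      then have "k1 \<le> radius h q \<theta> ^ n" using st by simp
      then show "k1 powr (1 / n) \<le> radius h q \<theta>" using k1 g0 by (intro power_root_ge) auto
      have "h t ^ n \<le> K1"
      proof -
        have "h t ^ n \<le> C2 ^ n" using up[OF sol b h0, of t] th ht by (intro power_mono) auto
        then show ?thesis by (simp add: K1_def)
      qed
      then have K: "(h t ^ n - K1) * sin t ^ n \<le> 0" using st by (intro mult_nonpos_nonneg) auto
      have "sin \<theta> ^ n * radius h q \<theta> ^ n - K1 * sin \<theta> ^ n
         \<le> sin t ^ n * radius h q t ^ n - K1 * sin t ^ n"
      proof (rule radius_power_compare_le[OF sol b])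
        fix y assume y: "\<theta> < y" "y < t"
        have "h y powr (p - 1) \<le> c3 powr (p - 1)" by (rule powr_source_mono[OF c3]) (use hlow y th in auto)
        then show "0 \<le> cos y * (h y powr (p - 1) - K1)"
          using y th s b by (intro mult_nonpos_nonpos cos_nonpos_south) (auto simp: K1_def)
      qed (use th in auto)
      also have "\<dots> = (h t ^ n - K1) * sin t ^ n" using qt by (simp add: algebra_simps)
      finally have "sin \<theta> ^ n * radius h q \<theta> ^ n \<le> sin \<theta> ^ n * K1" using K by (simp add: mult.commute)
      then have "radius h q \<theta> ^ n \<le> K1" using st by simp
      then show "radius h q \<theta> \<le> K1 powr (1 / n)" using g0 by (intro power_root_le) auto
    qed
    show ?thesis
    proof (cases "\<theta> \<le> pi / 2")
      case True
      then show ?thesis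
        using nb[OF sol b h0 th True] hlow[OF th] up[OF sol b h0 th] by (auto simp: c_def C_def)
    next
      case False
      then show ?thesis
        using south hlow[OF th] up[OF sol b h0 th] by (auto simp: c_def C_def)
    qed
  qed
  moreover have "0 < c" "0 < C" using c1 c3 k1 C1 by (auto simp: c_def C_def)
  ultimately show ?thesis using that[of c C] by blast
qed
end

section \<open>Oscillation near the constant solution\<close>

text \<open>Gronwall's lemma run backwards from \<open>t\<close>. The constant may blow up as
  \<open>\<delta>\<close> tends to \<open>0\<close>, since the equations are singular at the pole;
  the value at \<open>0\<close> is reached only by continuity. Applied to sums of squares, which
  then vanish at \<open>0\<close>.\<close>

lemma energy_zero:
  fixes E :: "real \<Rightarrow> real"
  assumes t: "0 < t" and c: "continuous_on {0..t} E" and Et: "E t \<le> 0"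
    and d: "\<And>\<delta>. 0 < \<delta> \<Longrightarrow> \<delta> < t \<Longrightarrow> \<exists>C. \<forall>x. \<delta> < x \<and> x < t \<longrightarrow> (\<exists>y. (E has_real_derivative y) (at x) \<and> - C * E x \<le> y)"
  shows "E 0 \<le> 0"
proof -
  have le: "E \<delta> \<le> 0" if dl: "0 < \<delta>" "\<delta> < t" for \<delta>
  proof -
    obtain C where C: "\<And>x. \<delta> < x \<Longrightarrow> x < t \<Longrightarrow> \<exists>y. (E has_real_derivative y) (at x) \<and> - C * E x \<le> y"
      using d[OF dl] by blast
    have "E \<delta> * exp (C * \<delta>) \<le> E t * exp (C * t)"
    proof (rule DERIV_nonneg_imp_increasing_open[OF less_imp_le[OF dl(2)]])
      fix x assume x: "\<delta> < x" "x < t"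
      obtain y where y: "(E has_real_derivative y) (at x)" "- C * E x \<le> y" using C[OF x] by blast
      have "((\<lambda>x. E x * exp (C * x)) has_real_derivative (y + C * E x) * exp (C * x)) (at x)"
        by (rule derivative_eq_intros y(1) refl)+ (simp add: algebra_simps)
      moreover have "0 \<le> (y + C * E x) * exp (C * x)" using y(2) by simp
      ultimately show "\<exists>y. ((\<lambda>x. E x * exp (C * x)) has_real_derivative y) (at x) \<and> 0 \<le> y" by blast
    qed (intro continuous_intros continuous_on_subset[OF c], use dl in auto)
    also have "\<dots> \<le> 0" using Et by (simp add: mult_nonpos_nonneg)
    finally show ?thesis by (simp add: mult_le_0_iff)
  qed
  have "(E \<longlongrightarrow> E 0) (at_right 0)"
    using c t by (auto simp: continuous_on_def at_within_Icc_at_right dest!: bspec[of _ _ 0])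
  then show ?thesis
    by (rule tendsto_upperbound) (use eventually_at_right_real[OF t] in \<open>auto elim!: eventually_mono intro: le\<close>)
qed

context sphere_profile begin

definition eig :: real where "eig = real n + 1 - p"

lemma eig_gt: "3 * (real n + 2) < eig"
  using p by (simp add: eig_def)

lemma eig_pos: "0 < eig"
  using p by (simp add: eig_def)

lemma eig_contraction:
  assumes b: "0 < b" "b < pi"
  obtains \<kappa> where "\<And>a. weight_contraction (\<lambda>u \<theta>. a + integral {0..\<theta>} (\<lambda>t. sin t * sin_avg n (\<lambda>t. - eig * u t) t)) \<kappa> b"
proof -
  have "\<exists>\<kappa>. \<forall>a. weight_contraction (\<lambda>u \<theta>. a + integral {0..\<theta>} (\<lambda>t. sin t * sin_avg n (\<lambda>t. - eig * u t) t)) \<kappa> b"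
  proof (rule sin_avg_volterra_contraction[OF n b less_imp_le[OF eig_pos], of "\<lambda>u t. - eig * u t"])
    fix u v :: "real \<Rightarrow> real" and M \<kappa> t :: real
    assume uv: "\<And>t. t \<in> {0..b} \<Longrightarrow> \<bar>u t - v t\<bar> \<le> M * exp (\<kappa> * t)" "t \<in> {0..b}"
    have "\<bar>- eig * u t - - eig * v t\<bar> = eig * \<bar>u t - v t\<bar>"
      using eig_pos by (simp add: abs_mult[symmetric] right_diff_distrib[symmetric] abs_minus_commute flip: abs_mult)
        (simp add: abs_mult right_diff_distrib[symmetric] abs_minus_commute)
    also have "\<dots> \<le> eig * (M * exp (\<kappa> * t))" using uv eig_pos by (intro mult_left_mono) auto
    finally show "\<bar>- eig * u t - - eig * v t\<bar> \<le> eig * M * exp (\<kappa> * t)" by (simp add: mult.assoc)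
  qed (auto intro!: continuous_intros)
  then show ?thesis using that by blast
qed

text \<open>\<open>\<phi>\<close> is the zonal function with Laplacian \<open>- eig \<phi>\<close>
  and value 1 at the north pole, and \<open>r = \<phi>' / sin\<close>. In general it is singular at
  the south pole, hence the half-open interval.\<close>

lemma linear_profile_exists:
  obtains \<phi> r where "continuous_on {0..<pi} \<phi>" "continuous_on {0..<pi} r"
    "\<And>\<theta>. \<theta> \<in> {0..<pi} \<Longrightarrow> \<phi> \<theta> = 1 + integral {0..\<theta>} (\<lambda>t. sin t * r t)"
    "r = sin_avg n (\<lambda>t. - eig * \<phi> t)"
proof -
  have c: "continuous_on {0..<pi} (\<lambda>\<theta>. 1 + integral {0..\<theta>} (\<lambda>t. sin t * sin_avg n (\<lambda>t. - eig * u t) t))"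
    if "continuous_on {0..<pi} u" for u
    by (rule sin_avg_volterra_cont[OF n]) (intro continuous_intros that)
  have k: "\<exists>\<kappa>. weight_contraction (\<lambda>u \<theta>. 1 + integral {0..\<theta>} (\<lambda>t. sin t * sin_avg n (\<lambda>t. - eig * u t) t)) \<kappa> b"
    if "0 < b" "b < pi" for b
    by (rule eig_contraction[OF that]) blast
  obtain u where u: "continuous_on {0..<pi} u"
    "\<And>t. t \<in> {0..<pi} \<Longrightarrow> 1 + integral {0..t} (\<lambda>s. sin s * sin_avg n (\<lambda>t. - eig * u t) s) = u t"
    by (rule weight_contraction_fixpoint[of pi "\<lambda>u \<theta>. 1 + integral {0..\<theta>} (\<lambda>t. sin t * sin_avg n (\<lambda>t. - eig * u t) t)", OF c k])
       (assumption+, rule that, auto)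
  show ?thesis
  proof (rule that[OF u(1) _ _ refl])
    show "continuous_on {0..<pi} (sin_avg n (\<lambda>t. - eig * u t))"
      by (intro sin_avg_cont_Ico[OF n] continuous_intros u(1))
  qed (use u(2) in auto)
qed

text \<open>Sturm comparison with the zonal harmonic \<open>cos^3 - 3 cos / (n + 3)\<close> of degree 3, whose eigenvalue
  is \<open>3 (n + 2)\<close>: since \<open>eig\<close> is larger, the derivative of the linearised profile oscillates faster
  and changes sign three times before the south pole.\<close>

lemma linear_profile_oscillates:
  assumes c\<phi>: "continuous_on {0..<pi} \<phi>" and cr: "continuous_on {0..<pi} r"
    and fix\<phi>: "\<And>\<theta>. \<theta> \<in> {0..<pi} \<Longrightarrow> \<phi> \<theta> = 1 + integral {0..\<theta>} (\<lambda>t. sin t * r t)"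
    and r: "r = sin_avg n (\<lambda>t. - eig * \<phi> t)"
  obtains x0 x1 x2 x3 where "0 < x0" "x0 < x1" "x1 < x2" "x2 < x3" "x3 < pi"
    "r x0 < 0" "0 < r x1" "r x2 < 0" "0 < r x3"
proof -
  have sub: "continuous_on {0..b} \<phi>" "continuous_on {0..b} r" if "b < pi" for b
    by (rule continuous_on_subset[OF c\<phi>], use that in force) (rule continuous_on_subset[OF cr], use that in force)
  have d\<phi>: "(\<phi> has_real_derivative sin x * r x) (at x)" if x: "0 < x" "x < pi" for x
  proof -
    define b where "b = (x + pi) / 2"
    have b: "0 < b" "x < b" "b < pi" using x by (auto simp: b_def)
    have "((\<lambda>y. 1 + integral {0..y} (\<lambda>t. sin t * r t)) has_real_derivative 0 + sin x * r x) (at x within {0..b})"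
      by (intro DERIV_add DERIV_const integral_has_real_derivative continuous_intros sub b) (use x b in auto)
    then have "((\<lambda>y. 1 + integral {0..y} (\<lambda>t. sin t * r t)) has_real_derivative sin x * r x) (at x)"
      using b x by (simp add: at_within_Icc_at)
    then show ?thesis
      by (rule has_field_derivative_transform_within_open[where S="{0<..<pi}"]) (use x fix\<phi> in auto)
  qed
  define Y where "Y x = sin x ^ n * r x" for x
  have dY: "(Y has_real_derivative - eig * sin x ^ (n - 1) * \<phi> x) (at x)" if x: "0 < x" "x < pi" for x
  proof -
    define b where "b = (x + pi) / 2"
    have b: "0 < b" "x < b" "b < pi" using x by (auto simp: b_def)
    have "((\<lambda>y. sin y ^ n * sin_avg n (\<lambda>t. - eig * \<phi> t) y) has_real_derivative sin x ^ (n - 1) * (- eig * \<phi> x)) (at x)"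
      by (rule sin_avg_deriv[OF n _ x(1) b(2) less_imp_le[OF b(3)]]) (intro continuous_intros sub b)
    then show ?thesis unfolding Y_def[abs_def] r by (simp add: mult_ac)
  qed
  \<comment> \<open>\<open>P\<close> is the zonal harmonic, \<open>S = P' / sin\<close> and
    \<open>X = S sin^n\<close>; they correspond to \<open>\<phi>\<close>, \<open>r\<close> and
    \<open>Y\<close>.\<close>
  define P where "P x = cos x ^ 3 - 3 / (real n + 3) * cos x" for x :: real
  define S where "S x = 3 * (1 / (real n + 3) - (cos x)\<^sup>2)" for x :: real
  define X where "X x = sin x ^ n * S x" for x
  have dP: "(P has_real_derivative sin x * S x) (at x)" for x
    unfolding P_def[abs_def] S_def
    by (rule derivative_eq_intros refl)+ (simp_all add: algebra_simps power2_eq_square)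
  have dX: "(X has_real_derivative - (3 * (real n + 2)) * sin x ^ (n - 1) * P x) (at x)" for x
  proof -
    have dS: "(S has_real_derivative 6 * cos x * sin x) (at x)"
      unfolding S_def[abs_def] by (rule derivative_eq_intros refl)+ (simp add: algebra_simps)
    have s2: "sin x * sin x = 1 - cos x * cos x" using sin_squared_eq[of x] by (simp add: power2_eq_square)
    have "n * cos x * S x + sin x * (6 * cos x * sin x) = cos x * (n * S x + 6 * (sin x * sin x))"
      by (simp add: algebra_simps)
    also have "\<dots> = - (3 * (real n + 2)) * P x"
      unfolding s2 by (simp add: S_def P_def power2_eq_square power3_eq_cube field_simps)
    finally show ?thesis using sin_pow_mult_deriv[OF n dS] by (simp only: X_def[abs_def] mult_ac)
  qed
  \<comment> \<open>A Wronskian of the two problems, weighted so that the terms with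
    \<open>\<phi> P\<close> cancel in the derivative; what remains has the sign of
    \<open>r S\<close>.\<close>
  define w where "w x = eig * \<phi> x * X x - 3 * (real n + 2) * Y x * P x" for x
  have dw: "(w has_real_derivative (eig - 3 * (real n + 2)) * (sin x ^ n * sin x) * (r x * S x)) (at x)" if x: "0 < x" "x < pi" for x
  proof -
    have "(w has_real_derivative eig * (sin x * r x) * X x + eig * \<phi> x * (- (3 * (real n + 2)) * sin x ^ (n - 1) * P x)
        - 3 * (real n + 2) * ((- eig * sin x ^ (n - 1) * \<phi> x) * P x + Y x * (sin x * S x))) (at x)"
      unfolding w_def[abs_def]
      by (rule derivative_eq_intros d\<phi>[OF x] dY[OF x] dX dP refl)+ (simp add: algebra_simps)
    moreover have "eig * (sin x * r x) * X x + eig * \<phi> x * (- (3 * (real n + 2)) * sin x ^ (n - 1) * P x)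
        - 3 * (real n + 2) * ((- eig * sin x ^ (n - 1) * \<phi> x) * P x + Y x * (sin x * S x))
        = (eig - 3 * (real n + 2)) * (sin x ^ n * sin x) * (r x * S x)"
      by (simp add: X_def Y_def algebra_simps)
    ultimately show ?thesis by simp
  qed
  have cw: "continuous_on {0..b} w" if "b < pi" for b
    unfolding w_def X_def Y_def S_def P_def by (intro continuous_intros sub that) (use n in auto)
  have sp: "0 < sin x" if "0 < x" "x < pi" for x using that by (intro sin_gt_zero)
  have w_mono: "w s \<le> w t" if st: "0 \<le> s" "s \<le> t" "t < pi" and pos: "\<And>x. s < x \<Longrightarrow> x < t \<Longrightarrow> 0 \<le> r x * S x" for s t
  proof (rule DERIV_nonneg_imp_increasing_open[OF st(2)])
    fix x assume x: "s < x" "x < t"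
    have "0 \<le> (eig - 3 * (real n + 2)) * (sin x ^ n * sin x) * (r x * S x)"
      by (rule mult_nonneg_nonneg[OF _ pos[OF x]]) (use eig_gt sp[of x] x st in auto)
    then show "\<exists>y. (w has_real_derivative y) (at x) \<and> 0 \<le> y" using dw[of x] x st by force
  qed (rule continuous_on_subset[OF cw[OF st(3)]], use st in auto)
  \<comment> \<open>Uniqueness for the second order equation: a common zero of \<open>\<phi>\<close>
    and \<open>r\<close> would make \<open>\<phi>\<close> vanish at the pole, where it is 1.\<close>
  have nz: "\<not> (\<phi> t = 0 \<and> r t = 0)" if t: "0 < t" "t < pi" for t
  proof
    assume z: "\<phi> t = 0 \<and> r t = 0"
    define E where "E x = (sin x * r x)\<^sup>2 + eig * (\<phi> x)\<^sup>2" for x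
    have "E 0 \<le> 0"
    proof (rule energy_zero[OF t(1)])
      show "continuous_on {0..t} E" unfolding E_def by (intro continuous_intros sub t)
      show "E t \<le> 0" using z by (simp add: E_def)
      fix \<delta> assume dl: "0 < \<delta>" "\<delta> < t"
      have "\<exists>m\<in>{\<delta>..t}. \<forall>y\<in>{\<delta>..t}. sin m \<le> sin y"
        by (rule continuous_attains_inf) (use dl in \<open>auto intro!: continuous_intros\<close>)
      then obtain m where m: "m \<in> {\<delta>..t}" "\<And>y. y \<in> {\<delta>..t} \<Longrightarrow> sin m \<le> sin y" by blast
      have sm: "0 < sin m" using sp m(1) dl t by auto
      show "\<exists>C. \<forall>x. \<delta> < x \<and> x < t \<longrightarrow> (\<exists>y. (E has_real_derivative y) (at x) \<and> - C * E x \<le> y)"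
      proof (rule exI[of _ "2 * real n / sin m"], intro allI impI)
        fix x assume x: "\<delta> < x \<and> x < t"
        have x': "0 < x" "x < pi" using x dl t by auto
        have sx: "0 < sin x" "sin m \<le> sin x" using sp[OF x'] m(2)[of x] x by auto
        have "((\<lambda>x. sin x ^ n * r x) has_real_derivative sin x ^ (n - 1) * (- eig * \<phi> x)) (at x)"
          using dY[OF x'] unfolding Y_def[abs_def] by (simp add: mult_ac)
        from sin_pow_div_deriv[OF n x' this]
        have dr: "(r has_real_derivative (- eig * \<phi> x - n * cos x * r x) / sin x) (at x)" .
        define D where "D = (- eig * \<phi> x - n * cos x * r x) / sin x"
        have D: "sin x * D = - eig * \<phi> x - n * cos x * r x" using sx by (simp add: D_def)
        have "(E has_real_derivative 2 * (sin x * r x) * (cos x * r x + sin x * D) + eig * (2 * \<phi> x * (sin x * r x))) (at x)"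
          unfolding E_def[abs_def] D_def
          by (rule derivative_eq_intros dr d\<phi>[OF x'] refl)+ (simp add: algebra_simps)
        then have dE: "(E has_real_derivative - (2 * (real n - 1) * cos x * sin x * (r x)\<^sup>2)) (at x)"
          unfolding D by (simp add: algebra_simps power2_eq_square)
        have "2 * (real n - 1) * cos x * sin x * (r x)\<^sup>2 \<le> 2 * real n / sin m * (sin x * r x)\<^sup>2"
        proof -
          have "(real n - 1) * cos x \<le> (real n - 1) * 1" using n by (intro mult_left_mono) auto
          then have "(real n - 1) * cos x * (sin m * (sin x * (r x)\<^sup>2)) \<le> real n * (sin m * (sin x * (r x)\<^sup>2))"
            using sx sm by (intro mult_right_mono) auto
          also have "\<dots> \<le> real n * (sin x * (sin x * (r x)\<^sup>2))"
            using sx sm by (intro mult_left_mono mult_right_mono) auto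
          finally have "(real n - 1) * cos x * (sin m * (sin x * (r x)\<^sup>2)) \<le> real n * (sin x * (sin x * (r x)\<^sup>2))" .
          then show ?thesis using sm by (simp add: field_simps power2_eq_square)
        qed
        also have "\<dots> \<le> 2 * real n / sin m * E x"
          using sm eig_pos by (intro mult_left_mono) (auto simp: E_def)
        finally have "- (2 * real n / sin m) * E x \<le> - (2 * (real n - 1) * cos x * sin x * (r x)\<^sup>2)" by simp
        then show "\<exists>y. (E has_real_derivative y) (at x) \<and> - (2 * real n / sin m) * E x \<le> y" using dE by blast
      qed
    qed
    then show False using fix\<phi>[of 0] eig_pos by (simp add: E_def)
  qed
  \<comment> \<open>The equality case of the comparison: if \<open>w\<close> vanishes on an
    interval, so do \<open>r\<close> and then \<open>\<phi>\<close> at its midpoint.\<close>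
  have w_const: False if st: "0 \<le> s" "s < t" "t < pi" and eq: "w s = 0" "w t = 0"
    and pos: "\<And>x. s < x \<Longrightarrow> x < t \<Longrightarrow> 0 \<le> r x * S x" and S: "\<And>x. s < x \<Longrightarrow> x < t \<Longrightarrow> S x \<noteq> 0" for s t
  proof -
    have w0: "w x = 0" if x: "s \<le> x" "x \<le> t" for x
    proof -
      have "w s \<le> w x" by (rule w_mono) (use x st pos in auto)
      moreover have "w x \<le> w t" by (rule w_mono) (use x st pos in auto)
      ultimately show ?thesis using eq by simp
    qed
    define m where "m = (s + t) / 2"
    have m: "s < m" "m < t" "0 < m" "m < pi" using st by (auto simp: m_def)
    have "(eig - 3 * (real n + 2)) * (sin m ^ n * sin m) * (r m * S m) = 0"
    proof (rule DERIV_local_const[OF dw[OF m(3,4)]])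
      show "0 < (t - s) / 2" using st by simp
      show "\<forall>y. \<bar>m - y\<bar> < (t - s) / 2 \<longrightarrow> w m = w y"
      proof (intro allI impI)
        fix y assume "\<bar>m - y\<bar> < (t - s) / 2"
        then have "s \<le> y" "y \<le> t" unfolding m_def by (simp_all add: abs_less_iff field_simps)
        then show "w m = w y" using w0 m by simp
      qed
    qed
    then have rm: "r m = 0" using eig_gt sp[OF m(3,4)] S[OF m(1,2)] by simp
    have "eig * \<phi> m * X m = 0" using w0[of m] m rm by (simp add: w_def Y_def)
    then have "\<phi> m = 0" using eig_pos sp[OF m(3,4)] S[OF m(1,2)] by (simp add: X_def)
    then show False using nz[OF m(3,4)] rm by simp
  qed
  \<comment> \<open>\<open>\<alpha>\<close> and \<open>pi - \<alpha>\<close>, where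
    \<open>cos^2 = 1 / (n + 3)\<close>, are the zeros of \<open>S\<close>; they cut
    \<open>(0, pi)\<close> into three intervals, whose comparisons yield the signs of
    \<open>r\<close> at \<open>x1\<close>, \<open>x2\<close> and \<open>x3\<close>.\<close>
  define c where "c = 1 / sqrt (real n + 3)"
  have c2: "c\<^sup>2 = 1 / (real n + 3)" by (simp add: c_def power_divide)
  have c01: "0 < c" "c < 1" by (auto simp: c_def)
  define \<alpha> where "\<alpha> = arccos c"
  have ca: "cos \<alpha> = c" using c01 by (simp add: \<alpha>_def)
  have \<alpha>: "0 < \<alpha>" "\<alpha> < pi / 2"
    using arccos_less_arccos[of c 1] arccos_less_arccos[of 0 c] c01 by (auto simp: \<alpha>_def)
  have S_eq: "S x = 3 * ((c - cos x) * (c + cos x))" for x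
    unfolding S_def c2[symmetric] by (simp add: algebra_simps power2_eq_square)
  have S1: "S x < 0" if "0 \<le> x" "x < \<alpha>" for x
  proof -
    have "c < cos x" unfolding ca[symmetric] using that \<alpha> by (intro cos_monotone_0_pi) auto
    then show ?thesis using c01 unfolding S_eq by (auto intro!: mult_neg_pos)
  qed
  have S2: "0 < S x" if "\<alpha> < x" "x < pi - \<alpha>" for x
  proof -
    have "cos x < c" unfolding ca[symmetric] using that \<alpha> by (intro cos_monotone_0_pi) auto
    moreover have "cos (pi - \<alpha>) < cos x" using that \<alpha> by (intro cos_monotone_0_pi) auto
    ultimately show ?thesis using ca unfolding S_eq by auto
  qed
  have S3: "S x < 0" if "pi - \<alpha> < x" "x < pi" for x
  proof -
    have "cos x < cos (pi - \<alpha>)" using that \<alpha> by (intro cos_monotone_0_pi) auto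
    then show ?thesis using ca c01 unfolding S_eq by (auto intro!: mult_pos_neg)
  qed
  have S0: "S \<alpha> = 0" "S (pi - \<alpha>) = 0" by (auto simp: S_eq ca)
  have Pa: "P \<alpha> < 0" "0 < P (pi - \<alpha>)"
  proof -
    have "P \<alpha> = c * (c\<^sup>2 - 3 / (real n + 3))" by (simp add: P_def ca power3_eq_cube power2_eq_square algebra_simps)
    also have "\<dots> < 0" using c01 unfolding c2 by (intro mult_pos_neg) (auto simp: field_simps)
    finally show a: "P \<alpha> < 0" .
    have "P (pi - \<alpha>) = - P \<alpha>" by (simp add: P_def)
    then show "0 < P (pi - \<alpha>)" using a by simp
  qed
  have wa: "w \<alpha> = 3 * (real n + 2) * (sin \<alpha> ^ n * (r \<alpha> * - P \<alpha>))"
    "w (pi - \<alpha>) = - (3 * (real n + 2) * (sin \<alpha> ^ n * (r (pi - \<alpha>) * P (pi - \<alpha>))))"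
    by (simp_all add: w_def X_def Y_def S0)
  have sa: "0 < sin \<alpha>" using sp[of \<alpha>] \<alpha> by simp
  have wa_sign: "r \<alpha> \<le> 0 \<Longrightarrow> w \<alpha> \<le> 0" "0 \<le> r \<alpha> \<Longrightarrow> 0 \<le> w \<alpha>"
    using Pa sa unfolding wa(1) by (auto simp: mult_le_0_iff zero_le_mult_iff)
  have wb_sign: "r (pi - \<alpha>) \<le> 0 \<Longrightarrow> 0 \<le> w (pi - \<alpha>)" "0 \<le> r (pi - \<alpha>) \<Longrightarrow> w (pi - \<alpha>) \<le> 0"
    using Pa sa unfolding wa(2) by (auto simp: mult_le_0_iff zero_le_mult_iff)
  have w00: "w 0 = 0" using n by (simp add: w_def X_def Y_def)
  have "r 0 = - eig / n" using fix\<phi>[of 0] by (simp add: r sin_avg_def)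
  then have r0: "r 0 < 0" using eig_pos n by (simp add: divide_neg_pos)
  have "(r \<longlongrightarrow> r 0) (at_right 0)"
    using sub(2)[of 1] pi_gt3 by (auto simp: continuous_on_def at_within_Icc_at_right dest!: bspec[of _ _ 0])
  from order_tendstoD(2)[OF this r0] obtain \<delta>0 where d0: "0 < \<delta>0" "\<And>x. 0 < x \<Longrightarrow> x < \<delta>0 \<Longrightarrow> r x < 0"
    unfolding eventually_at_right_field by blast
  \<comment> \<open>If \<open>r\<close> stayed nonpositive up to \<open>\<alpha>\<close>,
    \<open>w\<close> would increase from \<open>0\<close>, but the sign of \<open>r\<close> at
    \<open>\<alpha>\<close> makes \<open>w \<alpha> \<le> 0\<close>; so \<open>w\<close> would be
    \<open>0\<close> throughout, the excluded equality case.\<close>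
  have "\<exists>x1. 0 < x1 \<and> x1 \<le> \<alpha> \<and> 0 < r x1"
  proof (rule ccontr)
    assume "\<not> ?thesis"
    then have le: "r x \<le> 0" if "0 < x" "x \<le> \<alpha>" for x using that by force
    have pos: "0 \<le> r x * S x" if "0 < x" "x < \<alpha>" for x
      using le[of x] S1[of x] that by (auto intro: mult_nonpos_nonpos)
    have "w 0 \<le> w \<alpha>" by (rule w_mono) (use \<alpha> pos in auto)
    then have "w \<alpha> = 0" using wa_sign(1) le[of \<alpha>] \<alpha> w00 by simp
    then show False by (intro w_const[of 0 \<alpha>] pos less_imp_neq[OF S1]) (use \<alpha> w00 in auto)
  qed
  then obtain x1 where x1: "0 < x1" "x1 \<le> \<alpha>" "0 < r x1" by blast
  define x0 where "x0 = min (\<delta>0 / 2) (x1 / 2)"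
  have x0: "0 < x0" "x0 < x1" "r x0 < 0" using d0 x1 by (auto simp: x0_def)
  have "\<exists>x2. x1 < x2 \<and> x2 \<le> pi - \<alpha> \<and> r x2 < 0"
  proof (rule ccontr)
    assume "\<not> ?thesis"
    then have ge: "0 \<le> r x" if "x1 \<le> x" "x \<le> pi - \<alpha>" for x using that x1(3) by (cases "x = x1") force+
    have pos: "0 \<le> r x * S x" if "\<alpha> < x" "x < pi - \<alpha>" for x
      using ge[of x] S2[of x] that x1 by (auto intro: mult_nonneg_nonneg)
    have "w \<alpha> \<le> w (pi - \<alpha>)" by (rule w_mono) (use \<alpha> pos in auto)
    then have "w \<alpha> = 0" "w (pi - \<alpha>) = 0"
      using wa_sign(2) wb_sign(2) ge[of \<alpha>] ge[of "pi - \<alpha>"] \<alpha> x1 by auto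
    then show False by (intro w_const[of \<alpha> "pi - \<alpha>"] pos less_imp_neq[OF S2, symmetric]) (use \<alpha> in auto)
  qed
  then obtain x2 where x2: "x1 < x2" "x2 \<le> pi - \<alpha>" "r x2 < 0" by blast
  \<comment> \<open>On the last interval there is no endpoint value of \<open>w\<close> to use,
    since \<open>\<phi>\<close> and \<open>r\<close> may be unbounded at the pole. Instead the
    quotient \<open>Y / X\<close> is compared with a multiple of the cotangent, whose divergence at
    pi gives the contradiction.\<close>
  have "\<exists>x3. x2 < x3 \<and> x3 < pi \<and> 0 < r x3"
  proof (rule ccontr)
    assume "\<not> ?thesis"
    then have le: "r x \<le> 0" if "x2 \<le> x" "x < pi" for x using that x2(3) by (cases "x = x2") force+
    have pos: "0 \<le> r x * S x" if "pi - \<alpha> < x" "x < pi" for x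
      using le[of x] S3[of x] that x2 by (auto intro: mult_nonpos_nonpos)
    have wb: "0 \<le> w (pi - \<alpha>)" using wb_sign(1) le x2 \<alpha> by simp
    define y where "y = pi - \<alpha> / 2"
    have y: "pi - \<alpha> < y" "y < pi" "0 < y" using \<alpha> by (auto simp: y_def)
    have wy: "w (pi - \<alpha>) \<le> w y" by (rule w_mono) (use y \<alpha> pos in auto)
    have "w y \<noteq> 0"
    proof
      assume "w y = 0"
      moreover from this have "w (pi - \<alpha>) = 0" using wb wy by simp
      ultimately show False
        by (intro w_const[of "pi - \<alpha>" y] pos less_imp_neq[OF S3]) (use y \<alpha> in auto)
    qed
    then have wypos: "0 < w y" using wb wy by simp
    \<comment> \<open>9 bounds \<open>S^2\<close>, so that
      \<open>(Y / X)' = - sin^(n - 1) w / X^2\<close> is at most \<open>- k / sin^2\<close>, the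
      derivative of \<open>k cos / sin\<close>.\<close>
    define k where "k = w y / 9"
    have k: "0 < k" using wypos by (simp add: k_def)
    define G where "G x = Y x / X x - k * (cos x / sin x)" for x
    have G: "G t \<le> G y" if t: "y \<le> t" "t < pi" for t
    proof (rule DERIV_nonpos_imp_decreasing_open[OF t(1)])
      fix x assume x: "y < x" "x < t"
      have x': "0 < x" "x < pi" "pi - \<alpha> < x" using x y t by auto
      have s: "0 < sin x" using sp x' by simp
      have S: "S x < 0" using S3 x' by simp
      have X0: "X x \<noteq> 0" using s S by (simp add: X_def)
      obtain m where m: "n = Suc m" using n by (cases n) auto
      have dcot: "((\<lambda>x. cos x / sin x) has_real_derivative (- sin x * sin x - cos x * cos x) / (sin x * sin x)) (at x)"
        by (intro DERIV_divide DERIV_cos DERIV_sin) (use s in simp)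
      have 1: "(- eig * sin x ^ (n - 1) * \<phi> x) * X x - Y x * (- (3 * (real n + 2)) * sin x ^ (n - 1) * P x)
         = - (sin x ^ (n - 1) * w x)" by (simp add: w_def algebra_simps)
      have 2: "- sin x * sin x - cos x * cos x = - 1"
        using sin_cos_squared_add[of x] by (simp add: power2_eq_square)
      have dG: "(G has_real_derivative k / (sin x * sin x) - sin x ^ (n - 1) * w x / (X x * X x)) (at x)"
        using DERIV_diff[OF DERIV_divide[OF dY[OF x'(1,2)] dX X0] DERIV_cmult[OF dcot, of k]]
        unfolding G_def[abs_def] 1 2 by simp
      have "k / (sin x * sin x) \<le> sin x ^ (n - 1) * w x / (X x * X x)"
      proof -
        have wx: "w y \<le> w x" by (rule w_mono) (use x y t pos in auto)
        have "\<bar>S x\<bar> \<le> 3"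
        proof -
          have "0 \<le> (cos x)\<^sup>2" "(cos x)\<^sup>2 \<le> 1" by (auto simp: abs_square_le_1)
          moreover have "0 \<le> 1 / (real n + 3)" "1 / (real n + 3) \<le> 1" by auto
          ultimately have "\<bar>1 / (real n + 3) - (cos x)\<^sup>2\<bar> \<le> 1" by linarith
          then show ?thesis unfolding S_def abs_mult by simp
        qed
        then have S9: "S x * S x \<le> 9" using mult_mono[of "\<bar>S x\<bar>" 3 "\<bar>S x\<bar>" 3] by simp
        have SS: "0 < S x * S x" using S by (simp add: mult_neg_neg)
        have sm: "sin x ^ m \<le> 1" "0 < sin x ^ m" using s by (auto intro!: power_le_one)
        have eq: "sin x ^ (n - 1) * w x / (X x * X x) = w x / (sin x ^ m * (S x * S x)) / (sin x * sin x)"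
          using s by (simp add: X_def m field_simps)
        have "k * (sin x ^ m * (S x * S x)) \<le> k * (1 * 9)"
          using k sm S9 SS by (intro mult_left_mono mult_mono) auto
        also have "\<dots> \<le> w x" using wx by (simp add: k_def)
        finally have "k \<le> w x / (sin x ^ m * (S x * S x))" using sm SS by (subst le_divide_eq) auto
        then show ?thesis unfolding eq using s by (intro divide_right_mono) auto
      qed
      then show "\<exists>z. (G has_real_derivative z) (at x) \<and> z \<le> 0" using dG by force
    next
      have "continuous_on {y..t} Y" "continuous_on {y..t} X"
        unfolding Y_def X_def S_def
        by (intro continuous_intros continuous_on_subset[OF sub(2)[OF t(2)]]; use y n in auto)+
      moreover have "sin x \<noteq> 0 \<and> X x \<noteq> 0" if "x \<in> {y..t}" for x
        using sp[of x] S3[of x] that y t by (auto simp: X_def)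
      ultimately show "continuous_on {y..t} G"
        unfolding G_def by (intro continuous_intros) auto
    qed
    \<comment> \<open>Small enough that \<open>k cos t / sin t\<close> exceeds \<open>|G y|\<close>,
      by \<open>sin t \<le> t\<close> and \<open>cos t \<ge> 1 / 2\<close>; the value
      \<open>\<alpha> / 2\<close> places \<open>pi - t\<close> at or beyond
      \<open>y\<close>.\<close>
    define t where "t = min (min (pi / 3) (\<alpha> / 2)) (k / (2 * (\<bar>G y\<bar> + 1)))"
    have "t \<le> pi / 3" "t \<le> \<alpha> / 2" "t \<le> k / (2 * (\<bar>G y\<bar> + 1))"
      unfolding t_def by (meson min.cobounded1 min.cobounded2 order_trans)+
    moreover have "0 < t" using \<alpha> k by (simp add: t_def)
    ultimately have t: "0 < t" "t \<le> pi / 3" "t \<le> \<alpha> / 2" "t \<le> k / (2 * (\<bar>G y\<bar> + 1))" by auto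
    have st: "0 < sin t" "sin t \<le> t" using sp[of t] t sin_x_le_x[of t] by auto
    have "Y (pi - t) / X (pi - t) + k * (cos t / sin t) \<le> G y"
      using G[of "pi - t"] t by (simp add: y_def G_def)
    moreover have "0 \<le> Y (pi - t) / X (pi - t)"
      using le[of "pi - t"] S3[of "pi - t"] t \<alpha> x2 st
      by (auto simp: Y_def X_def intro!: divide_nonpos_neg)
    moreover have "\<bar>G y\<bar> + 1 \<le> k * (cos t / sin t)"
    proof -
      define g where "g = \<bar>G y\<bar> + 1"
      have g: "0 < g" by (simp add: g_def)
      have "g * sin t \<le> g * t" using st g by (intro mult_left_mono) auto
      also have "g * t \<le> k * (1 / 2)" using t(4) g unfolding g_def[symmetric] by (simp add: field_simps)
      finally have "(\<bar>G y\<bar> + 1) * sin t \<le> k * (1 / 2)" by (simp add: g_def)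
      also have "\<dots> \<le> k * cos t" using cos_gt_half[of t] t k by (intro mult_left_mono) auto
      finally show ?thesis using st by (simp add: le_divide_eq)
    qed
    ultimately show False by linarith
  qed
  then obtain x3 where "x2 < x3" "x3 < pi" "0 < r x3" by blast
  then show ?thesis using that x0 x1 x2 by blast
qed

section \<open>Perturbation from the constant solution\<close>

lemma is_sol_one: "is_sol b (\<lambda>_. 1) (\<lambda>_. 0)"
  unfolding is_sol_def by simp

lemma prof_one:
  assumes t: "0 \<le> \<theta>" "\<theta> < pi"
  shows "prof (1/2) 1 \<theta> = 1" "slope (1/2) 1 \<theta> = 0" "mean_source (1/2) (prof (1/2) 1) \<theta> = 1"
proof -
  define b where "b = (\<theta> + pi) / 2"
  have b: "0 < b" "b < pi" "\<theta> \<in> {0..b}" using t pi_gt_zero by (auto simp: b_def)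
  note P = is_sol_prof[OF is_sol_one[of b] b(1,2), of "1/2" \<theta>]
  show "prof (1/2) 1 \<theta> = 1" using P(1) b by simp
  show "slope (1/2) 1 \<theta> = 0" using P(2) b by simp
  show "mean_source (1/2) (prof (1/2) 1) \<theta> = 1" using P(3) b by simp
qed

text \<open>At \<open>x = y = 1\<close> the two contributions of \<open>y\<close> to the derivative
  cancel, \<open>(n - 1) / n + (1 - n) / n = 0\<close>, so only \<open>x\<close> survives, with
  coefficient \<open>p - 1 - n = - eig\<close>.\<close>

lemma reaction_linearization:
  assumes "0 < \<eta>"
  obtains d where "0 < d"
    "\<And>x y. \<bar>x - 1\<bar> < d \<Longrightarrow> \<bar>y - 1\<bar> < d \<Longrightarrow> \<bar>reaction (1/2) x y + eig * (x - 1)\<bar> \<le> \<eta> * (\<bar>x - 1\<bar> + \<bar>y - 1\<bar>)"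
proof -
  define F where "F z = (real n - 1) * snd z powr (1 / n) + fst z powr (p - 1) * snd z powr ((1 - real n) / n) - real n * fst z"
    for z :: "real \<times> real"
  have n0: "real n \<noteq> 0" using n by simp
  have "(F has_derivative (\<lambda>d. (real n - 1) * (1 / n * snd d) + ((p - 1) * fst d + (1 - real n) / n * snd d) - real n * fst d)) (at (1, 1))"
    unfolding F_def[abs_def]
    by (rule derivative_eq_intros refl | simp)+ (simp add: algebra_simps)
  moreover have "(\<lambda>d. (real n - 1) * (1 / n * snd d) + ((p - 1) * fst d + (1 - real n) / n * snd d) - real n * fst d)
      = (\<lambda>d. - eig * fst d)"
    using n0 by (auto simp: eig_def field_simps)
  ultimately have "(F has_derivative (\<lambda>d. - eig * fst d)) (at (1, 1))" by simp
  then obtain d1 where d1: "0 < d1"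
    "\<And>z. norm (z - (1, 1)) < d1 \<Longrightarrow> norm (F z - F (1, 1) - (- eig * fst (z - (1, 1)))) \<le> \<eta> * norm (z - (1, 1))"
    using assms unfolding has_derivative_at_alt by meson
  have F1: "F (1, 1) = 0" by (simp add: F_def)
  show ?thesis
  proof (rule that[of "min (d1 / 2) (1 / 2)"])
    show "0 < min (d1 / 2) (1 / 2)" using d1 by simp
    fix x y :: real assume x: "\<bar>x - 1\<bar> < min (d1 / 2) (1 / 2)" and y: "\<bar>y - 1\<bar> < min (d1 / 2) (1 / 2)"
    have nb: "norm ((x, y) - (1, 1)) \<le> \<bar>x - 1\<bar> + \<bar>y - 1\<bar>"
      using norm_Pair_le[of "x - 1" "y - 1"] by simp
    then have "norm ((x, y) - (1, 1)) < d1" using x y by linarith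
    from d1(2)[OF this] have "\<bar>F (x, y) + eig * (x - 1)\<bar> \<le> \<eta> * norm ((x, y) - (1, 1))" using F1 by simp
    also have "\<dots> \<le> \<eta> * (\<bar>x - 1\<bar> + \<bar>y - 1\<bar>)" using nb assms by (intro mult_left_mono) auto
    also have "F (x, y) = reaction (1/2) x y"
    proof -
      have "max x (1 / 2) = x" "max y (1 / 2) = y" using x y by (auto simp: max_def abs_less_iff)
      then show ?thesis by (simp add: F_def reaction_def)
    qed
    finally show "\<bar>reaction (1/2) x y + eig * (x - 1)\<bar> \<le> \<eta> * (\<bar>x - 1\<bar> + \<bar>y - 1\<bar>)" .
  qed
qed

text \<open>Differentiability of the slope in the height at \<open>a = 1\<close>, uniformly up to
  \<open>b\<close>. The remainder \<open>v = h - 1 - (a - 1) \<phi>\<close> solves the linear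
  Volterra equation with the linearisation error \<open>E\<close> as forcing, which is small
  compared with \<open>|a - 1|\<close>.\<close>

lemma slope_linearization:
  assumes c\<phi>: "continuous_on {0..<pi} \<phi>" and cr: "continuous_on {0..<pi} r"
    and fix\<phi>: "\<And>\<theta>. \<theta> \<in> {0..<pi} \<Longrightarrow> \<phi> \<theta> = 1 + integral {0..\<theta>} (\<lambda>t. sin t * r t)"
    and r: "r = sin_avg n (\<lambda>t. - eig * \<phi> t)"
    and b: "0 < b" "b < pi" and \<eta>: "0 < \<eta>"
  obtains d where "0 < d"
    "\<And>a \<theta>. \<bar>a - 1\<bar> < d \<Longrightarrow> \<theta> \<in> {0..b} \<Longrightarrow> \<bar>slope (1/2) a \<theta> - (a - 1) * r \<theta>\<bar> \<le> \<eta> * \<bar>a - 1\<bar>"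
proof -
  have half: "(0::real) < 1 / 2" by simp
  have sub: "continuous_on {0..b'} \<phi>" "continuous_on {0..b'} r" if "b' \<le> b" for b'
    by (rule continuous_on_subset[OF c\<phi>], use that b in force) (rule continuous_on_subset[OF cr], use that b in force)
  obtain C where C: "0 < C"
    "\<And>a a' t. t \<in> {0..b} \<Longrightarrow> \<bar>prof (1/2) a t - prof (1/2) a' t\<bar> \<le> C * \<bar>a - a'\<bar>"
    "\<And>a a' t. t \<in> {0..b} \<Longrightarrow> \<bar>slope (1/2) a t - slope (1/2) a' t\<bar> \<le> C * \<bar>a - a'\<bar>"
    "\<And>a a' t. t \<in> {0..b} \<Longrightarrow> \<bar>mean_source (1/2) (prof (1/2) a) t - mean_source (1/2) (prof (1/2) a') t\<bar> \<le> C * \<bar>a - a'\<bar>"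
    using prof_lipschitz[OF half b] by blast
  obtain K where K: "0 < K"
    "\<And>f M \<theta>. \<theta> \<in> {0..b} \<Longrightarrow> continuous_on {0..\<theta>} f \<Longrightarrow> (\<And>t. t \<in> {0..\<theta>} \<Longrightarrow> \<bar>f t\<bar> \<le> M)
      \<Longrightarrow> \<bar>sin_avg n f \<theta>\<bar> \<le> K * M"
    using sin_avg_bound[OF n, of b] b by auto
  obtain \<kappa> where \<kappa>: "\<And>a. weight_contraction (\<lambda>u \<theta>. a + integral {0..\<theta>} (\<lambda>t. sin t * sin_avg n (\<lambda>t. - eig * u t) t)) \<kappa> b"
    using eig_contraction[OF b] by blast
  have \<kappa>0: "0 \<le> \<kappa>" using \<kappa>[of 0] by (simp add: weight_contraction_def)
  \<comment> \<open>Collects all constants of the estimate, so that the final bound reads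
    \<open>e W |a - 1|\<close>.\<close>
  define W where "W = 2 * C * (K + eig * K * (2 * (pi * K) * exp (\<kappa> * b)))"
  have W: "0 < W" using C K eig_pos by (auto simp: W_def intro!: mult_pos_pos add_pos_pos)
  define e where "e = \<eta> / W"
  have e: "0 < e" using \<eta> W by (simp add: e_def)
  obtain d where d: "0 < d"
    "\<And>x y. \<bar>x - 1\<bar> < d \<Longrightarrow> \<bar>y - 1\<bar> < d \<Longrightarrow> \<bar>reaction (1/2) x y + eig * (x - 1)\<bar> \<le> e * (\<bar>x - 1\<bar> + \<bar>y - 1\<bar>)"
    using reaction_linearization[OF e] by blast
  show ?thesis
  proof (rule that[of "d / C"])
    show "0 < d / C" using d C by simp
    fix a \<theta> assume a: "\<bar>a - 1\<bar> < d / C" and th: "\<theta> \<in> {0..b}"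
    define h where "h = prof (1/2) a"
    define E where "E t = source (1/2) h t + eig * (h t - 1)" for t
    define B where "B = e * (2 * C * \<bar>a - 1\<bar>)"
    define v where "v t = h t - 1 - (a - 1) * \<phi> t" for t
    have Ca: "C * \<bar>a - 1\<bar> < d" using a C by (simp add: less_divide_eq mult.commute)
    have ch: "continuous_on {0..b} h" unfolding h_def by (rule prof_cont[OF half b(2)])
    have cs: "continuous_on {0..b} (source (1/2) h)" by (rule source_cont[OF half b ch])
    have cE: "continuous_on {0..b} E" unfolding E_def by (intro continuous_intros cs ch)
    have cv: "continuous_on {0..b} v" unfolding v_def by (intro continuous_intros ch sub) simp
    have sb: "continuous_on {0..t} f" if "continuous_on {0..b} f" "t \<in> {0..b}" for f :: "real \<Rightarrow> real" and t
      by (rule continuous_on_subset[OF that(1)]) (use that in auto)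
    have EB: "\<bar>E t\<bar> \<le> B" if t: "t \<in> {0..b}" for t
    proof -
      have 1: "\<bar>h t - 1\<bar> \<le> C * \<bar>a - 1\<bar>" using C(2)[OF t, of a 1] prof_one(1)[of t] t b by (simp add: h_def)
      have 2: "\<bar>mean_source (1/2) h t - 1\<bar> \<le> C * \<bar>a - 1\<bar>" using C(4)[OF t, of a 1] prof_one(3)[of t] t b by (simp add: h_def)
      have "\<bar>E t\<bar> \<le> e * (\<bar>h t - 1\<bar> + \<bar>mean_source (1/2) h t - 1\<bar>)"
        unfolding E_def source_def by (rule d(2)) (use 1 2 Ca in auto)
      also have "\<dots> \<le> B" unfolding B_def using 1 2 e by (intro mult_left_mono) auto
      finally show ?thesis .
    qed
    have B0: "0 \<le> B" using EB[of 0] b by force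
    have split: "sin_avg n (source (1/2) h) t - (a - 1) * r t = sin_avg n E t + sin_avg n (\<lambda>s. - eig * v s) t"
      if t: "t \<in> {0..b}" for t
    proof -
      have "sin_avg n (\<lambda>s. source (1/2) h s - (a - 1) * (- eig * \<phi> s)) t
          = sin_avg n (source (1/2) h) t - sin_avg n (\<lambda>s. (a - 1) * (- eig * \<phi> s)) t"
        by (rule sin_avg_diff) (use t in \<open>auto intro!: continuous_intros sb[OF cs] sub\<close>)
      also have "sin_avg n (\<lambda>s. (a - 1) * (- eig * \<phi> s)) t = (a - 1) * r t"
        unfolding r by (rule sin_avg_cmult)
      finally have 1: "sin_avg n (\<lambda>s. source (1/2) h s - (a - 1) * (- eig * \<phi> s)) t = sin_avg n (source (1/2) h) t - (a - 1) * r t" .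
      have "sin_avg n (\<lambda>s. E s - eig * v s) t = sin_avg n E t - sin_avg n (\<lambda>s. eig * v s) t"
        by (rule sin_avg_diff) (use t in \<open>auto intro!: continuous_intros sb[OF cE] sb[OF cv]\<close>)
      moreover have "sin_avg n (\<lambda>s. - eig * v s) t = - sin_avg n (\<lambda>s. eig * v s) t"
        using sin_avg_cmult[of n "-1" "\<lambda>s. eig * v s" t] by simp
      moreover have "(\<lambda>s. E s - eig * v s) = (\<lambda>s. source (1/2) h s - (a - 1) * (- eig * \<phi> s))"
        by (auto simp: E_def v_def algebra_simps)
      ultimately show ?thesis using 1 by simp
    qed
    have avE: "\<bar>sin_avg n E t\<bar> \<le> K * B" if t: "t \<in> {0..b}" for t
      by (rule K(2)[OF t sb[OF cE t]]) (use EB t in auto)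
    have cav: "continuous_on {0..b} (sin_avg n f)" if "continuous_on {0..b} f" for f
      by (rule sin_avg_cont[OF n that b])
    have v: "v t = 0 + integral {0..t} (\<lambda>s. sin s * sin_avg n (\<lambda>t. - eig * v t) s) + integral {0..t} (\<lambda>s. sin s * sin_avg n E s)"
      if t: "t \<in> {0..b}" for t
    proof -
      have "h t = a + integral {0..t} (\<lambda>s. sin s * sin_avg n (source (1/2) h) s)"
        using prof_fix(2)[OF half, of t a] t b by (simp add: profile_op_def h_def)
      moreover have "\<phi> t = 1 + integral {0..t} (\<lambda>s. sin s * r s)" using fix\<phi> t b by simp
      ultimately have "v t = integral {0..t} (\<lambda>s. sin s * sin_avg n (source (1/2) h) s) - (a - 1) * integral {0..t} (\<lambda>s. sin s * r s)"
        by (simp add: v_def algebra_simps)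
      also have "(a - 1) * integral {0..t} (\<lambda>s. sin s * r s) = integral {0..t} (\<lambda>s. (a - 1) * (sin s * r s))" by simp
      also have "integral {0..t} (\<lambda>s. sin s * sin_avg n (source (1/2) h) s) - integral {0..t} (\<lambda>s. (a - 1) * (sin s * r s))
         = integral {0..t} (\<lambda>s. sin s * sin_avg n (source (1/2) h) s - (a - 1) * (sin s * r s))"
        by (rule Henstock_Kurzweil_Integration.integral_diff[symmetric])
           (use t in \<open>auto intro!: integrable_continuous_real continuous_intros sb[OF cav[OF cs]] sub\<close>)
      also have "\<dots> = integral {0..t} (\<lambda>s. sin s * sin_avg n (\<lambda>t. - eig * v t) s + sin s * sin_avg n E s)"
      proof (rule integral_cong)
        fix s assume "s \<in> {0..t}"
        then have "sin_avg n (source (1/2) h) s - (a - 1) * r s = sin_avg n E s + sin_avg n (\<lambda>s. - eig * v s) s"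
          using split t by auto
        then have "sin s * (sin_avg n (source (1/2) h) s - (a - 1) * r s) = sin s * (sin_avg n E s + sin_avg n (\<lambda>s. - eig * v s) s)"
          by (simp only:)
        then show "sin s * sin_avg n (source (1/2) h) s - (a - 1) * (sin s * r s)
          = sin s * sin_avg n (\<lambda>t. - eig * v t) s + sin s * sin_avg n E s" by (simp add: algebra_simps)
      qed
      also have "\<dots> = integral {0..t} (\<lambda>s. sin s * sin_avg n (\<lambda>t. - eig * v t) s) + integral {0..t} (\<lambda>s. sin s * sin_avg n E s)"
        by (rule Henstock_Kurzweil_Integration.integral_add)
           (use t in \<open>auto intro!: integrable_continuous_real continuous_intros sb[OF cav] cE cv\<close>)
      finally show ?thesis by simp
    qed
    have vb: "\<bar>v t\<bar> \<le> 2 * (pi * (K * B)) * exp (\<kappa> * b)" if t: "t \<in> {0..b}" for t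
    proof -
      have "\<bar>v t - 0\<bar> \<le> 2 * (pi * (K * B)) * exp (\<kappa> * t)"
      proof (rule weight_contraction_diff[OF \<kappa>[of 0] less_imp_le[OF b(1)] cv continuous_on_const _ t])
        fix s assume s: "s \<in> {0..b}"
        have z: "sin_avg n (\<lambda>t. - eig * 0) = (\<lambda>_. 0)" by (auto simp: sin_avg_def)
        have "norm (integral {0..s} (\<lambda>s. sin s * sin_avg n E s)) \<le> K * B * (s - 0)"
        proof (rule integral_bound)
          fix x assume x: "x \<in> {0..s}"
          have "\<bar>sin x\<bar> * \<bar>sin_avg n E x\<bar> \<le> 1 * (K * B)" using avE[of x] x s by (intro mult_mono) auto
          then show "norm (sin x * sin_avg n E x) \<le> K * B" by (simp add: abs_mult)
        qed (use s in \<open>auto intro!: continuous_intros sb[OF cav[OF cE]]\<close>)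
        also have "\<dots> \<le> K * B * pi" using K B0 s b by (intro mult_left_mono) auto
        finally have i: "\<bar>integral {0..s} (\<lambda>s. sin s * sin_avg n E s)\<bar> \<le> pi * (K * B)" by (simp add: mult_ac)
        show "\<bar>v s - 0\<bar> \<le> \<bar>0 + integral {0..s} (\<lambda>t. sin t * sin_avg n (\<lambda>t. - eig * v t) t)
           - (0 + integral {0..s} (\<lambda>t. sin t * sin_avg n (\<lambda>t. - eig * 0) t))\<bar> + pi * (K * B)"
          using v[OF s] i unfolding z by simp
      qed
      also have "\<dots> \<le> 2 * (pi * (K * B)) * exp (\<kappa> * b)"
        using t \<kappa>0 K B0 by (intro mult_left_mono) (auto intro: mult_left_mono)
      finally show ?thesis by simp
    qed
    have "\<bar>sin_avg n (\<lambda>s. - eig * v s) \<theta>\<bar> \<le> K * (eig * (2 * (pi * (K * B)) * exp (\<kappa> * b)))"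
    proof (rule K(2)[OF th])
      show "continuous_on {0..\<theta>} (\<lambda>s. - eig * v s)" by (intro continuous_intros sb[OF cv th])
      fix t assume "t \<in> {0..\<theta>}"
      then have "\<bar>v t\<bar> \<le> 2 * (pi * (K * B)) * exp (\<kappa> * b)" using vb th by auto
      then have "eig * \<bar>v t\<bar> \<le> eig * (2 * (pi * (K * B)) * exp (\<kappa> * b))" using eig_pos by (intro mult_left_mono) auto
      then show "\<bar>- eig * v t\<bar> \<le> eig * (2 * (pi * (K * B)) * exp (\<kappa> * b))" using eig_pos by (simp add: abs_mult)
    qed
    then have "\<bar>slope (1/2) a \<theta> - (a - 1) * r \<theta>\<bar> \<le> K * B + K * (eig * (2 * (pi * (K * B)) * exp (\<kappa> * b)))"
      using split[OF th] avE[OF th] unfolding slope_def h_def[symmetric] by linarith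
    also have "\<dots> = e * W * \<bar>a - 1\<bar>" by (simp add: B_def W_def algebra_simps)
    also have "\<dots> = \<eta> * \<bar>a - 1\<bar>" using W by (simp add: e_def)
    finally show "\<bar>slope (1/2) a \<theta> - (a - 1) * r \<theta>\<bar> \<le> \<eta> * \<bar>a - 1\<bar>" .
  qed
qed

text \<open>Strict signs at four sample points make this visibly an open condition. Quantifying over
  solutions instead of fixing \<open>prof e a\<close> keeps it free of the truncation level.\<close>

definition oscillates :: "real \<Rightarrow> bool" where
  "oscillates a \<longleftrightarrow> (\<exists>b h q x0 x1 x2 x3. b < pi \<and> is_sol b h q \<and> h 0 = a \<and>
     0 < x0 \<and> x0 < x1 \<and> x1 < x2 \<and> x2 < x3 \<and> x3 \<le> b \<and> 0 < q x0 \<and> q x1 < 0 \<and> 0 < q x2 \<and> q x3 < 0)"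

lemma oscillates_near_one:
  obtains d where "0 < d" "d < 1" "\<And>a. 1 - d < a \<Longrightarrow> a < 1 \<Longrightarrow> oscillates a"
proof -
  obtain \<phi> r where \<phi>: "continuous_on {0..<pi} \<phi>" "continuous_on {0..<pi} r"
    "\<And>\<theta>. \<theta> \<in> {0..<pi} \<Longrightarrow> \<phi> \<theta> = 1 + integral {0..\<theta>} (\<lambda>t. sin t * r t)"
    "r = sin_avg n (\<lambda>t. - eig * \<phi> t)"
    using linear_profile_exists by blast
  obtain x0 x1 x2 x3 where x: "0 < x0" "x0 < x1" "x1 < x2" "x2 < x3" "x3 < pi"
    "r x0 < 0" "0 < r x1" "r x2 < 0" "0 < r x3"
    using linear_profile_oscillates[OF \<phi>] by blast
  have b: "0 < x3" using x by simp
  \<comment> \<open>Half the smallest sample value of \<open>|r|\<close>, so that an error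
    \<open>\<eta> |a - 1|\<close> in the slope cannot change a sign.\<close>
  define \<eta> where "\<eta> = min (min (- r x0) (r x1)) (min (- r x2) (r x3)) / 2"
  have \<eta>: "0 < \<eta>" "\<eta> < - r x0" "\<eta> < r x1" "\<eta> < - r x2" "\<eta> < r x3"
    using x unfolding \<eta>_def by linarith+
  obtain d1 where d1: "0 < d1"
    "\<And>a \<theta>. \<bar>a - 1\<bar> < d1 \<Longrightarrow> \<theta> \<in> {0..x3} \<Longrightarrow> \<bar>slope (1/2) a \<theta> - (a - 1) * r \<theta>\<bar> \<le> \<eta> * \<bar>a - 1\<bar>"
    using slope_linearization[OF \<phi> b x(5) \<eta>(1)] by blast
  have half: "(0::real) < 1 / 2" by simp
  obtain C where C: "0 < C"
    "\<And>a a' t. t \<in> {0..x3} \<Longrightarrow> \<bar>prof (1/2) a t - prof (1/2) a' t\<bar> \<le> C * \<bar>a - a'\<bar>"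
    "\<And>a a' t. t \<in> {0..x3} \<Longrightarrow> \<bar>slope (1/2) a t - slope (1/2) a' t\<bar> \<le> C * \<bar>a - a'\<bar>"
    "\<And>a a' t. t \<in> {0..x3} \<Longrightarrow> \<bar>mean_source (1/2) (prof (1/2) a) t - mean_source (1/2) (prof (1/2) a') t\<bar> \<le> C * \<bar>a - a'\<bar>"
    using prof_lipschitz[OF half b x(5)] by blast
  \<comment> \<open>The bound with \<open>C\<close> keeps the profile and \<open>g^n\<close> at or
    above \<open>1 / 2\<close>, so that the truncation is inactive.\<close>
  define d where "d = min (min d1 (1 / (2 * C))) (1 / 2)"
  show ?thesis
  proof (rule that[of d])
    show "0 < d" using d1 C by (simp add: d_def)
    show "d < 1" by (simp add: d_def)
    fix a assume a: "1 - d < a" "a < 1"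
    have ad: "\<bar>a - 1\<bar> < d1" "\<bar>a - 1\<bar> < 1 / (2 * C)" using a by (auto simp: d_def)
    have Ca: "C * \<bar>a - 1\<bar> \<le> 1 / 2" using ad(2) C by (simp add: less_divide_eq mult.commute mult.left_commute)
    have sol: "is_sol x3 (prof (1/2) a) (slope (1/2) a)"
    proof (rule prof_is_sol(1)[OF half b x(5)])
      fix t assume t: "t \<in> {0..x3}"
      show "1 / 2 \<le> prof (1/2) a t" using C(2)[OF t, of a 1] prof_one(1)[of t] t x(5) Ca by auto
      show "1 / 2 \<le> mean_source (1/2) (prof (1/2) a) t" using C(4)[OF t, of a 1] prof_one(3)[of t] t x(5) Ca by auto
    qed
    have s: "\<bar>slope (1/2) a t - (a - 1) * r t\<bar> \<le> \<eta> * (1 - a)" if "t \<in> {0..x3}" for t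
      using d1(2)[OF ad(1) that] a by (simp add: abs_if)
    \<comment> \<open>\<open>a - 1\<close> is negative, so the slope has the sign opposite to
      \<open>r\<close>.\<close>
    have neg: "0 < slope (1/2) a t" if t: "t \<in> {0..x3}" "\<eta> < - r t" for t
    proof -
      have "\<eta> * (1 - a) < - r t * (1 - a)" using t a by (intro mult_strict_right_mono) auto
      then show ?thesis using s[OF t(1)] by (simp add: abs_le_iff algebra_simps)
    qed
    have pos: "slope (1/2) a t < 0" if t: "t \<in> {0..x3}" "\<eta> < r t" for t
    proof -
      have "\<eta> * (1 - a) < r t * (1 - a)" using t a by (intro mult_strict_right_mono) auto
      then show ?thesis using s[OF t(1)] by (simp add: abs_le_iff algebra_simps)
    qed
    show "oscillates a"
      unfolding oscillates_def
      by (rule exI[of _ x3], rule exI[of _ "prof (1/2) a"], rule exI[of _ "slope (1/2) a"],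
          rule exI[of _ x0], rule exI[of _ x1], rule exI[of _ x2], rule exI[of _ x3])
         (use sol x \<eta> neg[of x0] neg[of x2] pos[of x1] pos[of x3] prof_0[OF half] in auto)
  qed
qed

end

section \<open>The critical initial value\<close>

text \<open>The last zero has the required derivative: after it \<open>q\<close> is negative, which
  an increasing \<open>q\<close> at that zero would contradict.\<close>

lemma down_crossing:
  fixes q :: "real \<Rightarrow> real"
  assumes xy: "x < y" and c: "continuous_on {x..y} q" and s: "0 < q x" "q y < 0"
    and d: "\<And>t. x < t \<Longrightarrow> t < y \<Longrightarrow> (q has_real_derivative q' t) (at t)"
  obtains t where "x < t" "t < y" "q t = 0" "q' t \<le> 0"
proof -
  define A where "A = {t \<in> {x..y}. q t = 0}"
  have "\<exists>t\<ge>x. t \<le> y \<and> q t = 0"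
    by (rule IVT2'[of q y 0 x]) (use xy c s in auto)
  then have ne: "A \<noteq> {}" by (auto simp: A_def)
  have "closed A"
    using continuous_closed_preimage_constant[OF c, of 0] by (simp add: A_def)
  moreover have "bounded A" by (rule bounded_subset[of "{x..y}"]) (auto simp: A_def)
  ultimately have "compact A" by (simp add: compact_eq_bounded_closed)
  then obtain t where t: "t \<in> A" "\<And>u. u \<in> A \<Longrightarrow> u \<le> t"
    using compact_attains_sup[OF _ ne] by blast
  have qt: "q t = 0" "x < t" "t < y"
  proof -
    show "q t = 0" using t(1) by (simp add: A_def)
    then have "t \<noteq> x" "t \<noteq> y" using s by auto
    then show "x < t" "t < y" using t(1) by (auto simp: A_def)
  qed
  have neg: "q u < 0" if u: "t < u" "u \<le> y" for u
  proof (rule ccontr)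
    assume "\<not> q u < 0"
    then have "0 \<le> q u" by simp
    have "\<exists>v\<ge>u. v \<le> y \<and> q v = 0"
      by (rule IVT2'[of q y 0 u]) (use u qt \<open>0 \<le> q u\<close> s in \<open>auto intro: continuous_on_subset[OF c]\<close>)
    then obtain v where v: "u \<le> v" "v \<le> y" "q v = 0" by blast
    then have "v \<in> A" using u qt by (auto simp: A_def)
    then show False using t(2)[of v] v u by simp
  qed
  have "q' t \<le> 0"
  proof (rule ccontr)
    assume "\<not> q' t \<le> 0"
    then obtain e where e: "0 < e" "\<And>h. 0 < h \<Longrightarrow> h < e \<Longrightarrow> q t < q (t + h)"
      using DERIV_pos_inc_right[OF d[OF qt(2,3)]] by auto
    define h where "h = min (e / 2) (y - t)"
    have "0 < h" "h < e" "h \<le> y - t" using e qt by (auto simp: h_def)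
    then show False using e(2)[of h] neg[of "t + h"] qt by simp
  qed
  then show ?thesis using that qt by blast
qed

context sphere_profile begin

text \<open>With \<open>q = 0\<close> the radius is \<open>h\<close>, so
  \<open>q' sin = h^(p - n) - h\<close>, whose only sign change is at \<open>h = 1\<close>.\<close>

lemma crit_slope_deriv:
  assumes sol: "is_sol b h q" and b: "b < pi" and t: "0 < t" "t < b" and q: "q t = 0"
  obtains D where "(q has_real_derivative D) (at t)" "1 < h t \<Longrightarrow> D < 0" "h t < 1 \<Longrightarrow> 0 < D"
proof -
  have h0: "0 < h t" and s: "0 < sin t" using is_sol_pos[OF sol b, of t] t by auto
  define D where "D = (h t powr (p - real n) - h t) / sin t"
  have "(q has_real_derivative D) (at t)"
    using is_solD(6)[OF sol t] q by (simp add: D_def powr_add[symmetric])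
  moreover have "D < 0" if "1 < h t"
  proof -
    have "h t powr (p - real n) \<le> h t powr 0" using that p by (intro powr_mono) auto
    then have "h t powr (p - real n) < h t" using that h0 by simp
    then show ?thesis using s by (simp add: D_def divide_neg_pos)
  qed
  moreover have "0 < D" if "h t < 1"
  proof -
    have "h t powr 0 \<le> h t powr (p - real n)" using that h0 p by (intro powr_mono') auto
    then have "h t < h t powr (p - real n)" using that h0 by simp
    then show ?thesis using s by (simp add: D_def)
  qed
  ultimately show ?thesis using that by blast
qed

text \<open>Uniqueness for the system, which is regular away from the poles: a solution that touches the constant
  one to first order coincides with it.\<close>

lemma crit_unique:
  assumes sol: "is_sol b h q" and b: "b < pi" and t: "0 < t" "t \<le> b" and q: "q t = 0" and h: "h t = 1"
  shows "h 0 = 1"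
proof -
  define E where "E x = (h x - 1)\<^sup>2 + (q x)\<^sup>2" for x
  define g where "g x = radius h q x" for x
  have ch: "continuous_on {0..t} h" and cq: "continuous_on {0..t} q"
    using is_solD(1,2)[OF is_sol_mono[OF sol t(2)]] by auto
  have "\<exists>x\<in>{0..t}. \<forall>y\<in>{0..t}. min (h x) (g x) \<le> min (h y) (g y)"
    unfolding g_def by (rule continuous_attains_inf) (use t in \<open>auto intro!: continuous_intros ch cq\<close>)
  then obtain x where x: "x \<in> {0..t}" "\<And>y. y \<in> {0..t} \<Longrightarrow> min (h x) (g x) \<le> min (h y) (g y)" by blast
  define m where "m = min (min (h x) (g x)) 1"
  have m: "0 < m" "m \<le> 1" using is_sol_pos(1,2)[OF sol b, of x] x t by (auto simp: m_def g_def)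
  have lo: "m \<le> h y" "m \<le> g y" if "y \<in> {0..t}" for y using x(2)[OF that] by (auto simp: m_def)
  have "E 0 \<le> 0"
  proof (rule energy_zero[OF t(1)])
    show "continuous_on {0..t} E" unfolding E_def by (intro continuous_intros ch cq)
    show "E t \<le> 0" using q h by (simp add: E_def)
    fix \<delta> assume dl: "0 < \<delta>" "\<delta> < t"
    have "\<exists>x\<in>{\<delta>..t}. \<forall>y\<in>{\<delta>..t}. sin x \<le> sin y"
      by (rule continuous_attains_inf) (use dl in \<open>auto intro!: continuous_intros\<close>)
    then obtain u where u: "u \<in> {\<delta>..t}" "\<And>y. y \<in> {\<delta>..t} \<Longrightarrow> sin u \<le> sin y" by blast
    have su: "0 < sin u" using u(1) dl t b by (intro sin_gt_zero) auto
    define L1 where "L1 = \<bar>p - 1\<bar> * m powr (p - 1 - 1)"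
    define L2 where "L2 = \<bar>1 - real n\<bar> * m powr (1 - real n - 1)"
    define M where "M = m powr (1 - real n)"
    define L where "L = L1 * M + L2 + 1"
    have L: "0 \<le> L1" "0 \<le> L2" "0 < M" "0 < L" using m by (auto simp: L1_def L2_def M_def L_def intro: add_nonneg_pos)
    show "\<exists>C. \<forall>x. \<delta> < x \<and> x < t \<longrightarrow> (\<exists>y. (E has_real_derivative y) (at x) \<and> - C * E x \<le> y)"
    \<comment> \<open>1 comes from the term with \<open>h'\<close>, \<open>4 L / sin u\<close> from
      the one with \<open>q'\<close>; \<open>L\<close> is a Lipschitz constant for the numerator of
      \<open>q'\<close>, and \<open>sin u\<close> is the smallest sine on
      \<open>{\<delta>..t}\<close>.\<close>
    proof (rule exI[of _ "1 + 4 * L / sin u"], intro allI impI)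
      fix x assume x: "\<delta> < x \<and> x < t"
      have x': "0 < x" "x < b" "x \<in> {0..t}" "x \<in> {\<delta>..t}" using x dl t by auto
      have sx: "0 < sin x" "sin u \<le> sin x" using su u(2)[OF x'(4)] by auto
      define F where "F = h x powr (p - 1) * g x powr (1 - real n) - g x"
      have dE: "(E has_real_derivative 2 * (h x - 1) * (q x * sin x) + 2 * q x * (F / sin x)) (at x)"
        unfolding E_def[abs_def] F_def g_def
        by (rule derivative_eq_intros is_solD(5,6)[OF sol x'(1,2)] refl)+ (simp add: algebra_simps divide_inverse)
      define X where "X = \<bar>h x - 1\<bar>"
      define Z where "Z = \<bar>q x\<bar>"
      have XZ: "0 \<le> X" "0 \<le> Z" by (auto simp: X_def Z_def)
      have "\<bar>q x * cos x\<bar> \<le> Z * 1" unfolding Z_def abs_mult by (intro mult_left_mono) auto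
      then have gx: "\<bar>g x - 1\<bar> \<le> X + Z" unfolding g_def X_def by linarith
      have F: "\<bar>F\<bar> \<le> L * (X + Z)"
      proof -
        have 1: "\<bar>h x powr (p - 1) - 1 powr (p - 1)\<bar> \<le> L1 * \<bar>h x - 1\<bar>"
          unfolding L1_def by (rule powr_lipschitz) (use m lo[OF x'(3)] p in auto)
        have 2: "\<bar>g x powr (1 - real n) - 1 powr (1 - real n)\<bar> \<le> L2 * \<bar>g x - 1\<bar>"
          unfolding L2_def by (rule powr_lipschitz) (use m lo[OF x'(3)] n in auto)
        have 3: "g x powr (1 - real n) \<le> M"
          unfolding M_def by (rule powr_mono2') (use m lo[OF x'(3)] n in auto)
        have "F = (h x powr (p - 1) - 1) * g x powr (1 - real n) + (g x powr (1 - real n) - 1) - (g x - 1)"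
          by (simp add: F_def algebra_simps)
        then have "\<bar>F\<bar> \<le> \<bar>(h x powr (p - 1) - 1) * g x powr (1 - real n)\<bar> + \<bar>g x powr (1 - real n) - 1\<bar> + \<bar>g x - 1\<bar>"
          by linarith
        also have "\<dots> \<le> (L1 * X) * M + L2 * (X + Z) + (X + Z)"
        proof (intro add_mono gx)
          show "\<bar>(h x powr (p - 1) - 1) * g x powr (1 - real n)\<bar> \<le> (L1 * X) * M"
            unfolding abs_mult using 1 3 XZ L by (intro mult_mono) (auto simp: X_def)
          have "L2 * \<bar>g x - 1\<bar> \<le> L2 * (X + Z)" using gx L by (intro mult_left_mono) auto
          then show "\<bar>g x powr (1 - real n) - 1\<bar> \<le> L2 * (X + Z)" using 2 by simp
        qed
        also have "\<dots> \<le> L * (X + Z)"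
        proof -
          have "0 \<le> L1 * M * Z" using L XZ by simp
          then show ?thesis by (simp add: L_def algebra_simps)
        qed
        finally show ?thesis .
      qed
      have "\<bar>2 * (h x - 1) * (q x * sin x)\<bar> \<le> 2 * X * (Z * 1)"
        unfolding X_def Z_def abs_mult by (intro mult_mono) auto
      moreover have "\<bar>2 * q x * (F / sin x)\<bar> \<le> 2 * Z * (L * (X + Z) / sin u)"
        unfolding Z_def[symmetric] abs_mult abs_divide
        using F sx su XZ L by (intro mult_mono frac_le) (auto simp: Z_def)
      moreover have "2 * X * (Z * 1) \<le> X\<^sup>2 + Z\<^sup>2"
        using zero_le_power2[of "X - Z"] by (simp add: power2_diff)
      moreover have "2 * Z * (L * (X + Z) / sin u) \<le> 4 * L / sin u * (X\<^sup>2 + Z\<^sup>2)"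
      proof -
        have "2 * Z * (X + Z) \<le> 4 * (X\<^sup>2 + Z\<^sup>2)"
        proof -
          have e: "2 * Z * (X + Z) = 2 * (X * Z) + 2 * Z\<^sup>2" by (simp add: algebra_simps power2_eq_square)
          have "2 * (X * Z) \<le> X\<^sup>2 + Z\<^sup>2" using zero_le_power2[of "X - Z"] by (simp add: power2_diff)
          moreover have "0 \<le> X\<^sup>2" "0 \<le> Z\<^sup>2" by simp_all
          ultimately have "2 * (X * Z) + 2 * Z\<^sup>2 \<le> 4 * X\<^sup>2 + 4 * Z\<^sup>2" by linarith
          then show ?thesis unfolding e by simp
        qed
        then have "L / sin u * (2 * Z * (X + Z)) \<le> L / sin u * (4 * (X\<^sup>2 + Z\<^sup>2))"
          using L su by (intro mult_left_mono) auto
        then show ?thesis by (simp add: mult_ac)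
      qed
      moreover have "E x = X\<^sup>2 + Z\<^sup>2" by (simp add: E_def X_def Z_def)
      moreover have "- ((1 + k) * e) \<le> A + B"
        if "\<bar>A\<bar> \<le> A'" "\<bar>B\<bar> \<le> B'" "A' \<le> w" "B' \<le> k * w" "e = w" for A B A' B' w k e :: real
        using that by (simp add: distrib_right)
      ultimately have "- ((1 + 4 * L / sin u) * E x) \<le> 2 * (h x - 1) * (q x * sin x) + 2 * q x * (F / sin x)"
        by presburger
      then show "\<exists>y. (E has_real_derivative y) (at x) \<and> - (1 + 4 * L / sin u) * E x \<le> y"
        unfolding mult_minus_left using dE by blast
    qed
  qed
  then have "h 0 - 1 = 0" unfolding E_def sum_power2_le_zero_iff by blast
  then show ?thesis by simp
qed

text \<open>Each pair of neighbouring samples gives a zero of \<open>q\<close> with a known weak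
  sign of \<open>q'\<close>, and this sign tells on which side of 1 the height is. Strict
  inequalities come only later, from \<open>crit_unique\<close>.\<close>

lemma oscillates_triple:
  assumes "oscillates a"
  obtains b h q t1 t2 t3 where "b < pi" "is_sol b h q" "h 0 = a" "0 < t1" "t1 < t2" "t2 < t3" "t3 < b"
    "q t1 = 0" "q t2 = 0" "q t3 = 0" "1 \<le> h t1" "h t2 \<le> 1" "1 \<le> h t3"
proof -
  obtain b h q x0 x1 x2 x3 where b: "b < pi" and sol: "is_sol b h q" and a: "h 0 = a"
    and x: "0 < x0" "x0 < x1" "x1 < x2" "x2 < x3" "x3 \<le> b" "0 < q x0" "q x1 < 0" "0 < q x2" "q x3 < 0"
    using assms unfolding oscillates_def by blast
  define D where "D t = slope_rhs h q t" for t
  have dq: "(q has_real_derivative D t) (at t)" if "0 < t" "t < b" for t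
    using is_solD(6)[OF sol that] by (simp add: D_def)
  have cq: "continuous_on {s..t} q" if "0 \<le> s" "t \<le> b" for s t
    by (rule continuous_on_subset[OF is_solD(2)[OF sol]]) (use that in auto)
  have ge1: "1 \<le> h t" if t: "0 < t" "t < b" "q t = 0" "D t \<le> 0" for t
  proof (rule ccontr)
    assume "\<not> 1 \<le> h t"
    then show False using crit_slope_deriv[OF sol b t(1-3)] DERIV_unique[OF dq[OF t(1,2)]] t(4)
      by (metis not_le)
  qed
  have le1: "h t \<le> 1" if t: "0 < t" "t < b" "q t = 0" "0 \<le> D t" for t
  proof (rule ccontr)
    assume "\<not> h t \<le> 1"
    then show False using crit_slope_deriv[OF sol b t(1-3)] DERIV_unique[OF dq[OF t(1,2)]] t(4)
      by (metis not_le)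
  qed
  obtain t1 where t1: "x0 < t1" "t1 < x1" "q t1 = 0" "D t1 \<le> 0"
    by (rule down_crossing[of x0 x1 q D]) (use x dq cq in auto)
  obtain t3 where t3: "x2 < t3" "t3 < x3" "q t3 = 0" "D t3 \<le> 0"
    by (rule down_crossing[of x2 x3 q D]) (use x dq cq in auto)
  obtain t2 where t2: "x1 < t2" "t2 < x2" "- q t2 = 0" "- D t2 \<le> 0"
    by (rule down_crossing[of x1 x2 "\<lambda>t. - q t" "\<lambda>t. - D t"])
       (use x dq cq in \<open>auto intro!: continuous_intros DERIV_minus\<close>)
  show ?thesis
    by (rule that[OF b sol a, of t1 t2 t3]) (use x t1 t2 t3 ge1 le1 in auto)
qed

lemma is_sol_lower:
  assumes sol: "is_sol b h q" and b: "0 \<le> b"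
  obtains e where "0 < e" "\<And>\<theta>. \<theta> \<in> {0..b} \<Longrightarrow> e \<le> h \<theta>" "\<And>\<theta>. \<theta> \<in> {0..b} \<Longrightarrow> e \<le> radius h q \<theta> ^ n"
proof -
  have "\<exists>x\<in>{0..b}. \<forall>y\<in>{0..b}. min (h x) (radius h q x ^ n) \<le> min (h y) (radius h q y ^ n)"
    by (rule continuous_attains_inf) (use b in \<open>auto intro!: continuous_intros is_solD(1,2)[OF sol]\<close>)
  then obtain x where x: "x \<in> {0..b}" "\<And>y. y \<in> {0..b} \<Longrightarrow> min (h x) (radius h q x ^ n) \<le> min (h y) (radius h q y ^ n)" by blast
  show ?thesis
  proof (rule that[of "min (h x) (radius h q x ^ n)"])
    show "0 < min (h x) (radius h q x ^ n)" using is_solD(3,4)[OF sol, of x] x(1) by auto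
  qed (use x(2) in auto)
qed

text \<open>The solution stays above some \<open>e\<close>; the truncation level
  \<open>e / 2\<close> leaves room for nearby profiles to remain untruncated, and the strict signs
  at the sample points persist.\<close>

lemma oscillates_open:
  assumes "oscillates a"
  obtains d where "0 < d" "\<And>a'. \<bar>a' - a\<bar> < d \<Longrightarrow> oscillates a'"
proof -
  obtain b h q x0 x1 x2 x3 where b: "b < pi" and sol: "is_sol b h q" and a: "h 0 = a"
    and x: "0 < x0" "x0 < x1" "x1 < x2" "x2 < x3" "x3 \<le> b" "0 < q x0" "q x1 < 0" "0 < q x2" "q x3 < 0"
    using assms unfolding oscillates_def by blast
  have b0: "0 < b" using x by simp
  obtain e where e: "0 < e" "\<And>\<theta>. \<theta> \<in> {0..b} \<Longrightarrow> e \<le> h \<theta>" "\<And>\<theta>. \<theta> \<in> {0..b} \<Longrightarrow> e \<le> radius h q \<theta> ^ n"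
    using is_sol_lower[OF sol less_imp_le[OF b0]] by blast
  have e2: "0 < e / 2" using e by simp
  have e2': "e / 2 \<le> h \<theta>" "e / 2 \<le> radius h q \<theta> ^ n" if "\<theta> \<in> {0..b}" for \<theta> using e that by (smt (verit) field_sum_of_halves)+
  have P: "h \<theta> = prof (e/2) a \<theta>" "q \<theta> = slope (e/2) a \<theta>"
    "radius h q \<theta> ^ n = mean_source (e/2) (prof (e/2) a) \<theta>" if "\<theta> \<in> {0..b}" for \<theta>
    unfolding a[symmetric] by (rule is_sol_prof[OF sol b0 b e2 _ _ that]; use e2' in simp)+
  obtain C where C: "0 < C"
    "\<And>a a' t. t \<in> {0..b} \<Longrightarrow> \<bar>prof (e/2) a t - prof (e/2) a' t\<bar> \<le> C * \<bar>a - a'\<bar>"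
    "\<And>a a' t. t \<in> {0..b} \<Longrightarrow> \<bar>slope (e/2) a t - slope (e/2) a' t\<bar> \<le> C * \<bar>a - a'\<bar>"
    "\<And>a a' t. t \<in> {0..b} \<Longrightarrow> \<bar>mean_source (e/2) (prof (e/2) a) t - mean_source (e/2) (prof (e/2) a') t\<bar> \<le> C * \<bar>a - a'\<bar>"
    using prof_lipschitz[OF e2 b0 b] by blast
  define \<eta> where "\<eta> = min (e / 2) (min (min (q x0) (- q x1)) (min (q x2) (- q x3)))"
  have \<eta>: "0 < \<eta>" "\<eta> \<le> e / 2" "\<eta> \<le> q x0" "\<eta> \<le> - q x1" "\<eta> \<le> q x2" "\<eta> \<le> - q x3"
    using e x unfolding \<eta>_def by linarith+
  show ?thesis
  proof (rule that[of "\<eta> / C"])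
    show "0 < \<eta> / C" using \<eta> C by simp
    fix a' assume "\<bar>a' - a\<bar> < \<eta> / C"
    then have Ca: "C * \<bar>a - a'\<bar> < \<eta>" using C by (simp add: less_divide_eq mult.commute abs_minus_commute)
    have sol': "is_sol b (prof (e/2) a') (slope (e/2) a')"
    proof (rule prof_is_sol(1)[OF e2 b0 b])
      fix t assume t: "t \<in> {0..b}"
      show "e / 2 \<le> prof (e/2) a' t" using C(2)[OF t, of a a'] P(1)[OF t] e(2)[OF t] Ca \<eta>(2) by linarith
      show "e / 2 \<le> mean_source (e/2) (prof (e/2) a') t" using C(4)[OF t, of a a'] P(3)[OF t] e(3)[OF t] Ca \<eta>(2) by linarith
    qed
    have s: "\<bar>q t - slope (e/2) a' t\<bar> < \<eta>" if t: "t \<in> {0..b}" for t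
      using C(3)[OF t, of a a'] P(2)[OF t] Ca by linarith
    have sx: "\<bar>q x0 - slope (e/2) a' x0\<bar> < \<eta>" "\<bar>q x1 - slope (e/2) a' x1\<bar> < \<eta>"
      "\<bar>q x2 - slope (e/2) a' x2\<bar> < \<eta>" "\<bar>q x3 - slope (e/2) a' x3\<bar> < \<eta>"
      using s x by auto
    have "0 < slope (e/2) a' x0" "slope (e/2) a' x1 < 0" "0 < slope (e/2) a' x2" "slope (e/2) a' x3 < 0"
      using sx \<eta> by linarith+
    then show "oscillates a'"
      unfolding oscillates_def
      using b sol' x(1-5) prof_0[OF e2, of a'] by blast
  qed
qed

lemma not_oscillates_small:
  obtains a0 where "0 < a0" "\<And>a. a < a0 \<Longrightarrow> \<not> oscillates a"
proof -
  obtain a0 where a0: "0 < a0"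
    "\<And>b h q t1 t2 t3. is_sol b h q \<Longrightarrow> b < pi \<Longrightarrow> h 0 < a0 \<Longrightarrow> 0 \<le> t1 \<Longrightarrow> t1 < t2 \<Longrightarrow> t2 < t3 \<Longrightarrow> t3 \<le> b \<Longrightarrow>
       q t1 = 0 \<Longrightarrow> q t2 = 0 \<Longrightarrow> q t3 = 0 \<Longrightarrow> 1 \<le> h t1 \<Longrightarrow> h t2 \<le> 1 \<Longrightarrow> 1 \<le> h t3 \<Longrightarrow> False"
    using no_triple_small_start by blast
  have "\<not> oscillates a" if a: "a < a0" for a
  proof
    assume "oscillates a"
    then obtain b h q t1 t2 t3 where t: "b < pi" "is_sol b h q" "h 0 = a" "0 < t1" "t1 < t2" "t2 < t3" "t3 < b"
      "q t1 = 0" "q t2 = 0" "q t3 = 0" "1 \<le> h t1" "h t2 \<le> 1" "1 \<le> h t3"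
      using oscillates_triple by blast
    show False by (rule a0(2)[OF t(2,1), of t1 t2 t3]) (use t a in auto)
  qed
  then show ?thesis using that a0(1) by blast
qed

lemma critical_start_exists:
  obtains s where "0 < s" "s < 1" "\<not> oscillates s" "\<And>a. s < a \<Longrightarrow> a < 1 \<Longrightarrow> oscillates a"
proof -
  obtain a0 where a0: "0 < a0" "\<And>a. a < a0 \<Longrightarrow> \<not> oscillates a" using not_oscillates_small by blast
  obtain d where d: "0 < d" "d < 1" "\<And>a. 1 - d < a \<Longrightarrow> a < 1 \<Longrightarrow> oscillates a" using oscillates_near_one by blast
  define N where "N = {a. 0 < a \<and> a < 1 \<and> \<not> oscillates a}"
  define z where "z = min a0 1 / 2"
  have z: "0 < z" "z < 1" "z < a0" using a0 by (auto simp: z_def min_def)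
  have zN: "z \<in> N" using z a0(2)[of z] by (simp add: N_def)
  have ub: "a \<le> 1 - d" if "a \<in> N" for a using that d(3)[of a] by (force simp: N_def)
  have bdd: "bdd_above N" using ub by (auto simp: bdd_above_def)
  define s where "s = Sup N"
  have s: "z \<le> s" "s \<le> 1 - d"
    unfolding s_def using zN bdd ub by (auto intro: cSup_upper cSup_least)
  have s1: "0 < s" "s < 1" using s z d by auto
  have osc: "oscillates a" if a: "s < a" "a < 1" for a
  proof (rule ccontr)
    assume "\<not> oscillates a"
    then have "a \<in> N" using a s1 by (simp add: N_def)
    then have "a \<le> s" unfolding s_def by (rule cSup_upper[OF _ bdd])
    then show False using a by simp
  qed
  have "\<not> oscillates s"
  proof
    assume "oscillates s"
    then obtain e where e: "0 < e" "\<And>a'. \<bar>a' - s\<bar> < e \<Longrightarrow> oscillates a'" using oscillates_open by blast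
    have "\<exists>x\<in>N. s - e < x" using e zN unfolding s_def by (intro less_cSupD) auto
    then obtain x where x: "x \<in> N" "s - e < x" by blast
    have "x \<le> s" unfolding s_def by (rule cSup_upper[OF x(1) bdd])
    then have "oscillates x" using e(2)[of x] x by simp
    then show False using x by (simp add: N_def)
  qed
  then show ?thesis using that s1 osc by blast
qed

text \<open>\<open>apriori_bounds\<close> lets one truncation level serve all approximating
  solutions, so along a subsequence critical angles and profiles converge together. If the limit
  \<open>t3\<close> were below pi, the limit profile would have three nondegenerate critical points
  and \<open>q\<close> would be negative just past \<open>t3\<close>, which makes \<open>s\<close>
  oscillate; so \<open>t3 = pi\<close>, and the bounds hold on all of
  \<open>{0..<pi}\<close>.\<close>

lemma global_profile_exists:
  obtains h q c C where "0 < c" "h 0 < 1" "\<And>b. b < pi \<Longrightarrow> is_sol b h q"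
    "\<And>\<theta>. 0 \<le> \<theta> \<Longrightarrow> \<theta> < pi \<Longrightarrow> c \<le> h \<theta> \<and> h \<theta> \<le> C \<and> c \<le> radius h q \<theta> \<and> radius h q \<theta> \<le> C"
proof -
  obtain s where s: "0 < s" "s < 1" "\<not> oscillates s" "\<And>a. s < a \<Longrightarrow> a < 1 \<Longrightarrow> oscillates a"
    using critical_start_exists by blast
  \<comment> \<open>The shift 2 keeps the heights below 1 from \<open>k = 0\<close> on.\<close>
  define as where "as k = s + (1 - s) / (real k + 2)" for k
  have as: "s < as k" "as k < 1" for k
  proof -
    show "s < as k" using s by (simp add: as_def)
    have "(1 - s) / (real k + 2) < (1 - s) / 1" using s by (intro divide_strict_left_mono) auto
    then show "as k < 1" by (simp add: as_def)
  qed
  have as_lim: "as \<longlonglongrightarrow> s"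
  proof -
    have "(\<lambda>k. (1 - s) * inverse (real (k + 2))) \<longlonglongrightarrow> (1 - s) * 0"
      by (intro tendsto_intros LIMSEQ_ignore_initial_segment[OF lim_inverse_n])
    then have "(\<lambda>k. s + (1 - s) * inverse (real (k + 2))) \<longlonglongrightarrow> s + 0" by (intro tendsto_intros) simp
    then show ?thesis by (simp add: as_def[abs_def] divide_inverse add.commute)
  qed
  have "\<exists>h q t. snd (snd t) < pi \<and> is_sol (snd (snd t)) h q \<and> h 0 = as k \<and> 0 < fst t \<and> fst t < fst (snd t) \<and> fst (snd t) < snd (snd t) \<and>
     q (fst t) = 0 \<and> q (fst (snd t)) = 0 \<and> q (snd (snd t)) = 0 \<and> 1 \<le> h (fst t) \<and> h (fst (snd t)) \<le> 1 \<and> 1 \<le> h (snd (snd t))" for k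
  proof -
    obtain b h q t1 t2 t3 where t: "b < pi" "is_sol b h q" "h 0 = as k" "0 < t1" "t1 < t2" "t2 < t3" "t3 < b"
      "q t1 = 0" "q t2 = 0" "q t3 = 0" "1 \<le> h t1" "h t2 \<le> 1" "1 \<le> h t3"
      using oscillates_triple[OF s(4)[OF as]] by blast
    show ?thesis
      by (rule exI[of _ h], rule exI[of _ q], rule exI[of _ "(t1, t2, t3)"]) (use t is_sol_mono[OF t(2), of t3] in auto)
  qed
  then obtain H Q T where HQ: "\<And>k. snd (snd (T k)) < pi \<and> is_sol (snd (snd (T k))) (H k) (Q k) \<and> H k 0 = as k \<and> 0 < fst (T k) \<and>
     fst (T k) < fst (snd (T k)) \<and> fst (snd (T k)) < snd (snd (T k)) \<and> Q k (fst (T k)) = 0 \<and> Q k (fst (snd (T k))) = 0 \<and>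
     Q k (snd (snd (T k))) = 0 \<and> 1 \<le> H k (fst (T k)) \<and> H k (fst (snd (T k))) \<le> 1 \<and> 1 \<le> H k (snd (snd (T k)))"
    by metis
  obtain c C where c: "0 < c" "0 < C" and cC:
    "\<And>t h q \<theta>. is_sol t h q \<Longrightarrow> t < pi \<Longrightarrow> s \<le> h 0 \<Longrightarrow> h 0 \<le> 1 \<Longrightarrow> q t = 0 \<Longrightarrow> 1 \<le> h t \<Longrightarrow>
       0 < \<theta> \<Longrightarrow> \<theta> \<le> t \<Longrightarrow> c \<le> h \<theta> \<and> h \<theta> \<le> C \<and> c \<le> radius h q \<theta> \<and> radius h q \<theta> \<le> C"
    using apriori_bounds[OF s(1)] by blast
  have bounds: "c \<le> H k \<theta> \<and> H k \<theta> \<le> C \<and> c \<le> H k \<theta> + Q k \<theta> * cos \<theta> \<and> H k \<theta> + Q k \<theta> * cos \<theta> \<le> C"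
    if th: "0 \<le> \<theta>" "\<theta> \<le> snd (snd (T k))" for k \<theta>
  proof -
    define t where "t = snd (snd (T k))"
    have t: "0 < t" "t < pi" "is_sol t (H k) (Q k)" using HQ[of k] by (auto simp: t_def)
    have pos: "c \<le> H k x \<and> H k x \<le> C \<and> c \<le> H k x + Q k x * cos x \<and> H k x + Q k x * cos x \<le> C" if "0 < x" "x \<le> t" for x
      by (rule cC[OF t(3,2)]) (use HQ[of k] as[of k] that in \<open>auto simp: t_def\<close>)
    show ?thesis
    proof (cases "\<theta> = 0")
      case True
      have cl: "0 \<in> closure {0<..<t}" using t by simp
      have cont: "continuous_on (closure {0<..<t}) (H k)" "continuous_on (closure {0<..<t}) (\<lambda>x. H k x + Q k x * cos x)"
        using t by (auto intro!: continuous_intros is_solD(1,2)[OF t(3)])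
      have "H k 0 \<le> C" by (rule continuous_le_on_closure[OF cont(1) cl]) (use pos in auto)
      moreover have "c \<le> H k 0" by (rule continuous_ge_on_closure[OF cont(1) cl]) (use pos in auto)
      moreover have "H k 0 + Q k 0 * cos 0 \<le> C" by (rule continuous_le_on_closure[OF cont(2) cl]) (use pos in auto)
      moreover have "c \<le> H k 0 + Q k 0 * cos 0" by (rule continuous_ge_on_closure[OF cont(2) cl]) (use pos in auto)
      ultimately show ?thesis using True by simp
    qed (use pos th in \<open>auto simp: t_def\<close>)
  qed
  \<comment> \<open>Strictly below both \<open>c\<close> and \<open>c^n\<close>: if
    \<open>t3 < pi\<close>, the limit profile then stays untruncated a little beyond
    \<open>t3\<close>.\<close>
  define e where "e = min c (c ^ n) / 2"
  have e: "0 < e" "e < c" "e < c ^ n" using c by (auto simp: e_def min_def)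
  have P: "H k \<theta> = prof e (as k) \<theta>" "Q k \<theta> = slope e (as k) \<theta>"
    "(H k \<theta> + Q k \<theta> * cos \<theta>) ^ n = mean_source e (prof e (as k)) \<theta>"
    if th: "0 \<le> \<theta>" "\<theta> \<le> snd (snd (T k))" for k \<theta>
  proof -
    define t where "t = snd (snd (T k))"
    have t: "0 < t" "t < pi" "is_sol t (H k) (Q k)" "H k 0 = as k" using HQ[of k] by (auto simp: t_def)
    have le: "e \<le> H k x" "e \<le> (H k x + Q k x * cos x) ^ n" if "x \<in> {0..t}" for x
    proof -
      have b: "c \<le> H k x" "c \<le> H k x + Q k x * cos x" using bounds[of x k] that by (auto simp: t_def)
      show "e \<le> H k x" using b e by simp
      have "c ^ n \<le> (H k x + Q k x * cos x) ^ n" using b c by (intro power_mono) auto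
      then show "e \<le> (H k x + Q k x * cos x) ^ n" using e by simp
    qed
    have th': "\<theta> \<in> {0..t}" using th by (simp add: t_def)
    show "H k \<theta> = prof e (as k) \<theta>" "Q k \<theta> = slope e (as k) \<theta>"
      "(H k \<theta> + Q k \<theta> * cos \<theta>) ^ n = mean_source e (prof e (as k)) \<theta>"
      unfolding t(4)[symmetric] by (rule is_sol_prof[OF t(3,1,2) e(1) _ _ th']; use le in simp)+
  qed
  have bT: "bounded (range T)"
  proof -
    have "range T \<subseteq> {0..pi} \<times> ({0..pi} \<times> {0..pi})"
    proof
      fix x assume "x \<in> range T"
      then obtain k where "x = T k" by blast
      then show "x \<in> {0..pi} \<times> ({0..pi} \<times> {0..pi})" using HQ[of k] by (auto simp: mem_Times_iff)
    qed
    then show ?thesis by (rule bounded_subset[rotated]) (intro bounded_Times bounded_closed_interval)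
  qed
  obtain l r where r: "strict_mono r" and l: "(T \<circ> r) \<longlonglongrightarrow> l"
    using bounded_imp_convergent_subsequence[OF bT] by blast
  define t1 t2 t3 where "t1 = fst l" and "t2 = fst (snd l)" and "t3 = snd (snd l)"
  define u1 u2 u3 where "u1 = (\<lambda>k. fst (T (r k)))" and "u2 = (\<lambda>k. fst (snd (T (r k))))" and "u3 = (\<lambda>k. snd (snd (T (r k))))"
  define a where "a = as \<circ> r"
  have lim: "u1 \<longlonglongrightarrow> t1" "u2 \<longlonglongrightarrow> t2" "u3 \<longlonglongrightarrow> t3"
    using l unfolding t1_def t2_def t3_def u1_def u2_def u3_def comp_def by (intro tendsto_intros; simp)+
  have a_lim: "a \<longlonglongrightarrow> s" unfolding a_def by (rule LIMSEQ_subseq_LIMSEQ[OF as_lim r])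
  have u: "0 < u1 k" "u1 k < u2 k" "u2 k < u3 k" "u3 k < pi"
    "slope e (a k) (u1 k) = 0" "slope e (a k) (u2 k) = 0" "slope e (a k) (u3 k) = 0"
    "1 \<le> prof e (a k) (u1 k)" "prof e (a k) (u2 k) \<le> 1" "1 \<le> prof e (a k) (u3 k)" for k
  proof -
    have o: "0 < u1 k" "u1 k < u2 k" "u2 k < u3 k" "u3 k < pi"
      using HQ[of "r k"] by (auto simp: u1_def u2_def u3_def)
    then show "0 < u1 k" "u1 k < u2 k" "u2 k < u3 k" "u3 k < pi" by auto
    have P': "H (r k) \<theta> = prof e (a k) \<theta>" "Q (r k) \<theta> = slope e (a k) \<theta>" if "0 \<le> \<theta>" "\<theta> \<le> u3 k" for \<theta>
      using P[of \<theta> "r k"] that by (auto simp: a_def u3_def)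
    show "slope e (a k) (u1 k) = 0" "slope e (a k) (u2 k) = 0" "slope e (a k) (u3 k) = 0"
      "1 \<le> prof e (a k) (u1 k)" "prof e (a k) (u2 k) \<le> 1" "1 \<le> prof e (a k) (u3 k)"
      using P'[of "u1 k"] P'[of "u2 k"] P'[of "u3 k"] o HQ[of "r k"] by (auto simp: u1_def u2_def u3_def)
  qed
  have B: "c \<le> prof e (a k) \<theta>" "prof e (a k) \<theta> \<le> C" "c \<le> prof e (a k) \<theta> + slope e (a k) \<theta> * cos \<theta>"
    "prof e (a k) \<theta> + slope e (a k) \<theta> * cos \<theta> \<le> C" "c ^ n \<le> mean_source e (prof e (a k)) \<theta>"
    if "0 \<le> \<theta>" "\<theta> \<le> u3 k" for k \<theta>
  proof -
    have th: "0 \<le> \<theta>" "\<theta> \<le> snd (snd (T (r k)))" using that by (auto simp: u3_def)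
    note b = bounds[OF th] and P' = P[OF th]
    show "c \<le> prof e (a k) \<theta>" "prof e (a k) \<theta> \<le> C" "c \<le> prof e (a k) \<theta> + slope e (a k) \<theta> * cos \<theta>"
      "prof e (a k) \<theta> + slope e (a k) \<theta> * cos \<theta> \<le> C"
      using b unfolding a_def comp_def P'(1,2)[symmetric] by auto
    show "c ^ n \<le> mean_source e (prof e (a k)) \<theta>"
      unfolding a_def comp_def P'(3)[symmetric] using b c by (intro power_mono) auto
  qed
  have order: "0 \<le> t1" "t1 \<le> t2" "t2 \<le> t3" "t3 \<le> pi"
  proof -
    show "0 \<le> t1" by (rule LIMSEQ_le_const[OF lim(1)]) (use u(1) less_imp_le in blast)
    show "t1 \<le> t2" by (rule LIMSEQ_le[OF lim(1,2)]) (use u(2) less_imp_le in blast)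
    show "t2 \<le> t3" by (rule LIMSEQ_le[OF lim(2,3)]) (use u(3) less_imp_le in blast)
    show "t3 \<le> pi" by (rule LIMSEQ_le_const2[OF lim(3)]) (use u(4) less_imp_le in blast)
  qed
  have LB: "c \<le> prof e s \<theta>" "prof e s \<theta> \<le> C" "c \<le> prof e s \<theta> + slope e s \<theta> * cos \<theta>"
    "prof e s \<theta> + slope e s \<theta> * cos \<theta> \<le> C" "c ^ n \<le> mean_source e (prof e s) \<theta>"
    if th: "0 \<le> \<theta>" "\<theta> \<le> t3" "\<theta> < pi" for \<theta>
  proof -
    \<comment> \<open>The bounds for the \<open>k\<close>-th profile reach only to
      \<open>u3 k\<close>, so the angle is cut off there; \<open>w k\<close> still tends to
      \<open>\<theta>\<close>.\<close>
    define w where "w k = min \<theta> (u3 k)" for k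
    have w: "0 \<le> w k" "w k \<le> u3 k" for k using th u(1,2,3)[of k] by (auto simp: w_def)
    have "w \<longlonglongrightarrow> min \<theta> t3" unfolding w_def by (intro tendsto_intros lim)
    then have wl: "w \<longlonglongrightarrow> \<theta>" using th by (simp add: min_def)
    note L = prof_limit[OF e(1) th(1,3) w(1) wl a_lim]
    have L4: "(\<lambda>k. prof e (a k) (w k) + slope e (a k) (w k) * cos (w k)) \<longlonglongrightarrow> prof e s \<theta> + slope e s \<theta> * cos \<theta>"
      by (intro tendsto_intros L wl)
    show "c \<le> prof e s \<theta>" by (rule LIMSEQ_le_const[OF L(1)]) (use B(1)[OF w] in auto)
    show "prof e s \<theta> \<le> C" by (rule LIMSEQ_le_const2[OF L(1)]) (use B(2)[OF w] in auto)
    show "c \<le> prof e s \<theta> + slope e s \<theta> * cos \<theta>" by (rule LIMSEQ_le_const[OF L4]) (use B(3)[OF w] in auto)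
    show "prof e s \<theta> + slope e s \<theta> * cos \<theta> \<le> C" by (rule LIMSEQ_le_const2[OF L4]) (use B(4)[OF w] in auto)
    show "c ^ n \<le> mean_source e (prof e s) \<theta>" by (rule LIMSEQ_le_const[OF L(3)]) (use B(5)[OF w] in auto)
  qed
  have "t3 = pi"
  proof (rule ccontr)
    assume "t3 \<noteq> pi"
    then have t3: "t3 < pi" using order by simp
    have tp: "t1 < pi" "t2 < pi" "0 \<le> t2" "0 \<le> t3" using order t3 by auto
    have uk: "0 \<le> u1 k" "0 \<le> u2 k" "0 \<le> u3 k" for k using u(1,2,3)[of k] by auto
    note L1 = prof_limit[OF e(1) order(1) tp(1) uk(1) lim(1) a_lim]
    note L2 = prof_limit[OF e(1) tp(3) tp(2) uk(2) lim(2) a_lim]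
    note L3 = prof_limit[OF e(1) tp(4) t3 uk(3) lim(3) a_lim]
    have sl: "slope e s t1 = 0" "slope e s t2 = 0" "slope e s t3 = 0"
      using L1(2) L2(2) L3(2) u(5,6,7) by (simp_all add: LIMSEQ_const_iff)
    have pr: "1 \<le> prof e s t1" "prof e s t2 \<le> 1" "1 \<le> prof e s t3"
      using LIMSEQ_le_const[OF L1(1), of 1] LIMSEQ_le_const2[OF L2(1), of 1] LIMSEQ_le_const[OF L3(1), of 1] u(8,9,10) by auto
    have "t1 \<noteq> 0" using pr(1) prof_0[OF e(1), of s] s by auto
    then have t10: "0 < t1" using order by simp
    obtain b where b: "t3 < b" "b < pi" "is_sol b (prof e s) (slope e s)"
    proof -
      define b0 where "b0 = (t3 + pi) / 2"
      have b0: "t3 < b0" "b0 < pi" "0 < b0" using t3 tp by (auto simp: b0_def)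
      have c1: "continuous_on {0..b0} (prof e s)" by (rule prof_cont[OF e(1) b0(2)])
      have c2: "continuous_on {0..b0} (mean_source e (prof e s))" by (rule mean_source_cont[OF e(1) b0(3,2) c1])
      have at: "at t3 within {0..b0} = at t3" using order t10 b0 by (intro at_within_Icc_at) auto
      have "(prof e s \<longlongrightarrow> prof e s t3) (at t3)" "(mean_source e (prof e s) \<longlongrightarrow> mean_source e (prof e s) t3) (at t3)"
        using c1 c2 order t10 b0 by (auto simp: continuous_on_def at[symmetric])
      moreover have "e < prof e s t3" "e < mean_source e (prof e s) t3"
        using LB(1,5)[of t3] tp t3 e by auto
      ultimately have "eventually (\<lambda>x. e < prof e s x \<and> e < mean_source e (prof e s) x) (at t3)"
        by (intro eventually_conj order_tendstoD(1))
      then obtain d where d: "0 < d" "\<And>x. x \<noteq> t3 \<Longrightarrow> dist x t3 < d \<Longrightarrow> e < prof e s x \<and> e < mean_source e (prof e s) x"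
        unfolding eventually_at by auto
      define b where "b = min b0 (t3 + d / 2)"
      have b: "t3 < b" "b < pi" "0 < b" using b0 d tp by (auto simp: b_def)
      have ok: "e \<le> prof e s x \<and> e \<le> mean_source e (prof e s) x" if x: "x \<in> {0..b}" for x
      proof (cases "x \<le> t3")
        case True
        then show ?thesis using LB(1,5)[of x] x t3 e by auto
      next
        case False
        then have "dist x t3 < d" using x d by (auto simp: b_def dist_real_def)
        then show ?thesis using d(2)[of x] False by auto
      qed
      have "is_sol b (prof e s) (slope e s)" by (rule prof_is_sol(1)[OF e(1) b(3,2)]) (use ok in auto)
      then show ?thesis using that b by blast
    qed
    define h q where "h = prof e s" and "q = slope e s"
    have h0: "h 0 = s" using prof_0[OF e(1)] by (simp add: h_def)
    note sol = b(3)[folded h_def q_def]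
    note sl' = sl[folded q_def] and pr' = pr[folded h_def]
    \<comment> \<open>A critical point at height 1 would force \<open>h 0 = 1\<close>, against
      \<open>h 0 = s < 1\<close>; hence the limits of the critical points are distinct and
      nondegenerate.\<close>
    have ne1: "h t \<noteq> 1" if "0 < t" "t \<le> b" "q t = 0" for t
      using crit_unique[OF sol b(2) that] h0 s by auto
    have tb: "t1 \<le> b" "t2 \<le> b" "t3 \<le> b" "0 < t2" "0 < t3" using order b t10 by auto
    have str: "1 < h t1" "h t2 < 1" "1 < h t3"
      using ne1[OF t10 tb(1) sl'(1)] ne1[OF tb(4,2) sl'(2)] ne1[OF tb(5,3) sl'(3)] pr' by auto
    have t12: "t1 < t2" and t23: "t2 < t3" using str order by (auto simp: less_le)
    have tb': "t1 < b" "t2 < b" using t12 t23 b by auto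
    obtain D1 where D1: "(q has_real_derivative D1) (at t1)" "D1 < 0"
      using crit_slope_deriv[OF sol b(2) t10 tb'(1) sl'(1)] str(1) by blast
    obtain D2 where D2: "(q has_real_derivative D2) (at t2)" "0 < D2"
      using crit_slope_deriv[OF sol b(2) tb(4) tb'(2) sl'(2)] str(2) by blast
    obtain D3 where D3: "(q has_real_derivative D3) (at t3)" "D3 < 0"
      using crit_slope_deriv[OF sol b(2) tb(5) b(1) sl'(3)] str(3) by blast
    obtain d0 where d0: "0 < d0" "\<And>x. 0 < x \<Longrightarrow> x < d0 \<Longrightarrow> q t1 < q (t1 - x)" using DERIV_neg_dec_left[OF D1] by auto
    obtain d1 where d1: "0 < d1" "\<And>x. 0 < x \<Longrightarrow> x < d1 \<Longrightarrow> q (t1 + x) < q t1" using DERIV_neg_dec_right[OF D1] by auto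
    obtain d2 where d2: "0 < d2" "\<And>x. 0 < x \<Longrightarrow> x < d2 \<Longrightarrow> q t2 < q (t2 + x)" using DERIV_pos_inc_right[OF D2] by auto
    obtain d3 where d3: "0 < d3" "\<And>x. 0 < x \<Longrightarrow> x < d3 \<Longrightarrow> q (t3 + x) < q t3" using DERIV_neg_dec_right[OF D3] by auto
    \<comment> \<open>Offsets of sample points near the three critical points; the last sample lies
      beyond \<open>t3\<close>, which is why the solution had to be continued past it.\<close>
    define y0 y1 y2 y3 where "y0 = min d0 t1 / 2" and "y1 = min d1 (t2 - t1) / 2"
      and "y2 = min d2 (t3 - t2) / 2" and "y3 = min d3 (b - t3) / 2"
    have y: "0 < y0" "y0 < d0" "y0 < t1" "0 < y1" "y1 < d1" "y1 < t2 - t1" "0 < y2" "y2 < d2" "y2 < t3 - t2"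
      "0 < y3" "y3 < d3" "y3 < b - t3"
      using d0(1) d1(1) d2(1) d3(1) t10 t12 t23 b(1) by (auto simp: y0_def y1_def y2_def y3_def min_def)
    have "oscillates s"
      unfolding oscillates_def
    proof (rule exI[of _ b], rule exI[of _ h], rule exI[of _ q], rule exI[of _ "t1 - y0"], rule exI[of _ "t1 + y1"],
        rule exI[of _ "t2 + y2"], rule exI[of _ "t3 + y3"], intro conjI)
      show "0 < q (t1 - y0)" "q (t1 + y1) < 0" "0 < q (t2 + y2)" "q (t3 + y3) < 0"
        using d0(2)[of y0] d1(2)[of y1] d2(2)[of y2] d3(2)[of y3] y sl' by auto
    qed (use b sol h0 y t12 t23 in auto)
    then show False using s by simp
  qed
  note LB' = LB[unfolded this]
  show ?thesis
  proof (rule that[of c "prof e s" "slope e s" C, OF c(1)])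
    show "prof e s 0 < 1" using prof_0[OF e(1)] s by simp
    show "is_sol b (prof e s) (slope e s)" if b: "b < pi" for b
    proof -
      define b' where "b' = (max b 0 + pi) / 2"
      have b': "0 < b'" "b' < pi" "b \<le> b'" using b pi_gt_zero by (auto simp: b'_def max_def)
      have "is_sol b' (prof e s) (slope e s)"
        by (rule prof_is_sol(1)[OF e(1) b'(1,2)]) (use LB'(1,5) b' e in \<open>force intro: less_imp_le order_trans[of e c] order_trans[of e "c ^ n"]\<close>)+
      then show ?thesis using b'(3) by (rule is_sol_mono)
    qed
  qed (use LB' in auto)
qed

end

section \<open>Regularity at the poles\<close>

text \<open>One-variable counterpart of \<open>Ck_on\<close>. Smoothness of the profile is proved
  here, where products, powers and compositions are easy, and carried to the sphere in one go by
  \<open>Ck_on_inner\<close>.\<close>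

fun Ck_real :: "nat \<Rightarrow> real set \<Rightarrow> (real \<Rightarrow> real) \<Rightarrow> bool" where
  "Ck_real 0 I f = continuous_on I f"
| "Ck_real (Suc k) I f = (\<exists>f'. (\<forall>x\<in>I. (f has_real_derivative f' x) (at x)) \<and> Ck_real k I f')"

lemma Ck_real_SucI:
  assumes "\<And>x. x \<in> I \<Longrightarrow> (f has_real_derivative f' x) (at x)" "Ck_real k I f'"
  shows "Ck_real (Suc k) I f"
  unfolding Ck_real.simps by (rule exI[of _ f']) (use assms in simp)

lemma Ck_real_SucD:
  "Ck_real (Suc k) I f \<Longrightarrow> \<exists>f'. (\<forall>x\<in>I. (f has_real_derivative f' x) (at x)) \<and> Ck_real k I f'"
  by simp

lemma Ck_real_cong:
  assumes "open I" "\<And>x. x \<in> I \<Longrightarrow> f x = g x" "Ck_real k I f"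
  shows "Ck_real k I g"
proof (cases k)
  case 0
  then show ?thesis using assms continuous_on_eq[of I f g] by simp
next
  case (Suc m)
  then obtain f' where f': "\<And>x. x \<in> I \<Longrightarrow> (f has_real_derivative f' x) (at x)" "Ck_real m I f'"
    using Ck_real_SucD[OF assms(3)[unfolded Suc]] by blast
  have "(g has_real_derivative f' x) (at x)" if "x \<in> I" for x
    by (rule has_field_derivative_transform_within_open[OF f'(1)[OF that] assms(1) that assms(2)])
  then show ?thesis unfolding Suc by (rule Ck_real_SucI) (use f' in auto)
qed

lemma Ck_real_subset: "Ck_real k I f \<Longrightarrow> J \<subseteq> I \<Longrightarrow> Ck_real k J f"
proof (induction k arbitrary: f)
  case (Suc k)
  obtain f' where f': "\<And>x. x \<in> I \<Longrightarrow> (f has_real_derivative f' x) (at x)" "Ck_real k I f'"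
    using Ck_real_SucD[OF Suc.prems(1)] by blast
  have "(f has_real_derivative f' x) (at x)" if "x \<in> J" for x using f'(1) Suc.prems(2) that by blast
  then show ?case using Suc.IH[OF f'(2) Suc.prems(2)] by (rule Ck_real_SucI)
next
  case 0
  then show ?case using continuous_on_subset[of I f J] by simp
qed

lemma Ck_real_continuous: "Ck_real k I f \<Longrightarrow> continuous_on I f"
proof (cases k)
  case (Suc m)
  assume "Ck_real k I f"
  then obtain f' where "\<forall>x\<in>I. (f has_real_derivative f' x) (at x)"
    using Ck_real_SucD[of m I f] unfolding Suc by blast
  then show ?thesis by (intro continuous_at_imp_continuous_on ballI DERIV_isCont) blast
qed simp

lemma Ck_real_Suc_imp: "Ck_real (Suc k) I f \<Longrightarrow> Ck_real k I f"
proof (induction k arbitrary: f)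
  case 0 then show ?case using Ck_real_continuous by (simp del: Ck_real.simps(2))
next
  case (Suc k)
  obtain f' where f': "\<And>x. x \<in> I \<Longrightarrow> (f has_real_derivative f' x) (at x)" "Ck_real (Suc k) I f'"
    using Ck_real_SucD[OF Suc.prems] by blast
  show ?case by (rule Ck_real_SucI[OF f'(1) Suc.IH[OF f'(2)]])
qed

lemma Ck_real_const: "Ck_real k I (\<lambda>_. c)"
  by (induction k arbitrary: c) (auto simp del: Ck_real.simps(2) intro!: Ck_real_SucI[where f'="\<lambda>_. 0"])

lemma Ck_real_ident: "Ck_real k I (\<lambda>x. x)"
  by (cases k) (auto simp del: Ck_real.simps(2) intro!: Ck_real_SucI[where f'="\<lambda>_. 1"] Ck_real_const)

lemma Ck_real_add: "Ck_real k I f \<Longrightarrow> Ck_real k I g \<Longrightarrow> Ck_real k I (\<lambda>x. f x + g x)"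
proof (induction k arbitrary: f g)
  case (Suc k)
  obtain f' where f: "\<And>x. x \<in> I \<Longrightarrow> (f has_real_derivative f' x) (at x)" "Ck_real k I f'"
    using Ck_real_SucD[OF Suc.prems(1)] by blast
  obtain g' where g: "\<And>x. x \<in> I \<Longrightarrow> (g has_real_derivative g' x) (at x)" "Ck_real k I g'"
    using Ck_real_SucD[OF Suc.prems(2)] by blast
  show ?case by (rule Ck_real_SucI[OF _ Suc.IH[OF f(2) g(2)]]) (rule DERIV_add[OF f(1) g(1)])
qed (simp add: continuous_on_add)

lemma Ck_real_mult: "Ck_real k I f \<Longrightarrow> Ck_real k I g \<Longrightarrow> Ck_real k I (\<lambda>x. f x * g x)"
proof (induction k arbitrary: f g)
  case (Suc k)
  obtain f' where f: "\<And>x. x \<in> I \<Longrightarrow> (f has_real_derivative f' x) (at x)" "Ck_real k I f'"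
    using Ck_real_SucD[OF Suc.prems(1)] by blast
  obtain g' where g: "\<And>x. x \<in> I \<Longrightarrow> (g has_real_derivative g' x) (at x)" "Ck_real k I g'"
    using Ck_real_SucD[OF Suc.prems(2)] by blast
  have "Ck_real k I (\<lambda>x. f' x * g x + g' x * f x)"
    by (rule Ck_real_add[OF Suc.IH[OF f(2) Ck_real_Suc_imp[OF Suc.prems(2)]] Suc.IH[OF g(2) Ck_real_Suc_imp[OF Suc.prems(1)]]])
  then show ?case by (rule Ck_real_SucI[rotated]) (rule DERIV_mult[OF f(1) g(1)])
qed (simp add: continuous_on_mult)

lemma Ck_real_diff: "Ck_real k I f \<Longrightarrow> Ck_real k I g \<Longrightarrow> Ck_real k I (\<lambda>x. f x - g x)"
  using Ck_real_add[of k I f "\<lambda>x. (-1) * g x"] Ck_real_mult[OF Ck_real_const[of k I "-1"], of g] by simp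

lemma Ck_real_compose:
  "Ck_real k J g \<Longrightarrow> Ck_real k I f \<Longrightarrow> f ` I \<subseteq> J \<Longrightarrow> Ck_real k I (\<lambda>x. g (f x))"
proof (induction k arbitrary: g f)
  case (Suc k)
  obtain f' where f: "\<And>x. x \<in> I \<Longrightarrow> (f has_real_derivative f' x) (at x)" "Ck_real k I f'"
    using Ck_real_SucD[OF Suc.prems(2)] by blast
  obtain g' where g: "\<And>x. x \<in> J \<Longrightarrow> (g has_real_derivative g' x) (at x)" "Ck_real k J g'"
    using Ck_real_SucD[OF Suc.prems(1)] by blast
  have "Ck_real k I (\<lambda>x. g' (f x) * f' x)"
    by (rule Ck_real_mult[OF Suc.IH[OF g(2) Ck_real_Suc_imp[OF Suc.prems(2)] Suc.prems(3)] f(2)])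
  moreover have "((\<lambda>x. g (f x)) has_real_derivative g' (f x) * f' x) (at x)" if "x \<in> I" for x
    using DERIV_chain2[OF g(1) f(1)[OF that]] Suc.prems(3) that by blast
  ultimately show ?case by (rule Ck_real_SucI[rotated])
next
  case 0
  then show ?case using continuous_on_compose2[of J g I f] by simp
qed

lemma Ck_real_powr_base: "Ck_real k {0<..} (\<lambda>x. x powr r)"
proof (induction k arbitrary: r)
  case (Suc k)
  have "Ck_real k {0<..} (\<lambda>x. r * x powr (r - 1))"
    by (rule Ck_real_mult[OF Ck_real_const Suc.IH])
  moreover have "((\<lambda>x. x powr r) has_real_derivative r * x powr (r - 1)) (at x)" if "x \<in> {0<..}" for x
    using has_real_derivative_powr[of x r] that by simp
  ultimately show ?case by (rule Ck_real_SucI[rotated])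
qed (auto intro!: continuous_intros)

lemma Ck_real_powr: "Ck_real k I f \<Longrightarrow> (\<And>x. x \<in> I \<Longrightarrow> 0 < f x) \<Longrightarrow> Ck_real k I (\<lambda>x. f x powr r)"
  by (rule Ck_real_compose[OF Ck_real_powr_base]) auto

lemma Ck_real_divide:
  assumes "open I" "Ck_real k I f" "Ck_real k I g" "\<And>x. x \<in> I \<Longrightarrow> 0 < g x"
  shows "Ck_real k I (\<lambda>x. f x / g x)"
proof -
  have "Ck_real k I (\<lambda>x. f x * g x powr (-1))" by (intro Ck_real_mult Ck_real_powr assms)
  then show ?thesis
    by (rule Ck_real_cong[OF assms(1), rotated]) (use assms(4) in \<open>force simp: powr_minus_divide\<close>)
qed

text \<open>The derivative witnesses on the two sets need not agree as functions, so both are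
  replaced by \<open>deriv f\<close>.\<close>

lemma Ck_real_Un:
  "open I \<Longrightarrow> open J \<Longrightarrow> Ck_real k I f \<Longrightarrow> Ck_real k J f \<Longrightarrow> Ck_real k (I \<union> J) f"
proof (induction k arbitrary: f)
  case (Suc k)
  obtain f1 where f1: "\<And>x. x \<in> I \<Longrightarrow> (f has_real_derivative f1 x) (at x)" "Ck_real k I f1"
    using Ck_real_SucD[OF Suc.prems(3)] by blast
  obtain f2 where f2: "\<And>x. x \<in> J \<Longrightarrow> (f has_real_derivative f2 x) (at x)" "Ck_real k J f2"
    using Ck_real_SucD[OF Suc.prems(4)] by blast
  have 1: "Ck_real k I (deriv f)" by (rule Ck_real_cong[OF Suc.prems(1) _ f1(2)]) (use f1(1) DERIV_imp_deriv in force)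
  have 2: "Ck_real k J (deriv f)" by (rule Ck_real_cong[OF Suc.prems(2) _ f2(2)]) (use f2(1) DERIV_imp_deriv in force)
  have "(f has_real_derivative deriv f x) (at x)" if "x \<in> I \<union> J" for x
    using that f1(1)[of x] f2(1)[of x] DERIV_imp_deriv[of f _ x] by auto
  then show ?case by (rule Ck_real_SucI[OF _ Suc.IH[OF Suc.prems(1,2) 1 2]])
qed (simp add: continuous_on_open_Un)

text \<open>The derivative in direction \<open>v\<close> is again of this form, with factor
  \<open>c (v \<bullet> e)\<close>; carrying the factor makes the induction close.\<close>

lemma Ck_on_inner:
  fixes e :: "'a::euclidean_space"
  assumes "Ck_real k I f"
  shows "Ck_on k {x. x \<bullet> e \<in> I} (\<lambda>x. c * f (x \<bullet> e))"
  using assms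
proof (induction k arbitrary: f c)
  case 0
  then show ?case by (auto intro!: continuous_intros continuous_on_compose2[of I f])
next
  case (Suc k)
  obtain f' where f': "\<And>x. x \<in> I \<Longrightarrow> (f has_real_derivative f' x) (at x)" "Ck_real k I f'"
    using Ck_real_SucD[OF Suc.prems] by blast
  show ?case
    unfolding Ck_on.simps
  proof (intro exI[of _ "\<lambda>x v. c * (v \<bullet> e) * f' (x \<bullet> e)"] conjI ballI allI)
    fix x assume x: "x \<in> {x. x \<bullet> e \<in> I}"
    have "(f has_derivative (\<lambda>t. t * f' (x \<bullet> e))) (at (x \<bullet> e))"
      using f'(1) x by (auto simp: has_field_derivative_def mult_commute_abs)
    then have "((\<lambda>x. f (x \<bullet> e)) has_derivative (\<lambda>v. (v \<bullet> e) * f' (x \<bullet> e))) (at x)"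
      by (rule has_derivative_compose[rotated]) (auto intro!: derivative_eq_intros)
    then have "((\<lambda>x. c * f (x \<bullet> e)) has_derivative (\<lambda>v. c * ((v \<bullet> e) * f' (x \<bullet> e)))) (at x)"
      by (rule has_derivative_mult_right)
    then show "((\<lambda>x. c * f (x \<bullet> e)) has_derivative (\<lambda>v. c * (v \<bullet> e) * f' (x \<bullet> e))) (at x)"
      by (simp add: mult.assoc)
  next
    fix v show "Ck_on k {x. x \<bullet> e \<in> I} (\<lambda>x. c * (v \<bullet> e) * f' (x \<bullet> e))"
      by (rule Suc.IH[OF f'(2)])
  qed
qed

text \<open>For an integrand \<open>cos t F (sin^2 t)\<close> and \<open>u = sin^2 \<theta>\<close>,
  the substitution \<open>sin t = x sin \<theta>\<close> turns \<open>sin_avg\<close> into this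
  integral with \<open>m = n - 1\<close>, which has no denominator and makes sense for both signs of
  \<open>u\<close>.\<close>

definition radial_avg :: "nat \<Rightarrow> (real \<Rightarrow> real) \<Rightarrow> real \<Rightarrow> real" where
  "radial_avg m F u = integral {0..1} (\<lambda>x. x ^ m * F (x\<^sup>2 * u))"

lemma square_mult_in_Ioo:
  fixes u x d :: real
  assumes "\<bar>u\<bar> < d" "x \<in> {0..1}"
  shows "\<bar>x\<^sup>2 * u\<bar> < d"
proof -
  have "\<bar>x\<^sup>2 * u\<bar> \<le> 1 * \<bar>u\<bar>"
    unfolding abs_mult using assms by (intro mult_right_mono) (auto simp: power_le_one)
  then show ?thesis using assms by simp
qed

lemma radial_avg_integrand_cont:
  fixes F :: "real \<Rightarrow> real" and S :: "real set"
  assumes F: "continuous_on S F" and star: "\<And>u x. u \<in> S \<Longrightarrow> x \<in> {0..1} \<Longrightarrow> x\<^sup>2 * u \<in> S"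
  shows "continuous_on (S \<times> {0..1}) (\<lambda>(u, x). x ^ m * F (x\<^sup>2 * u))"
proof -
  have "continuous_on (S \<times> {0..1}) (\<lambda>z. F ((snd z)\<^sup>2 * fst z))"
  proof (rule continuous_on_compose2[OF F])
    show "(\<lambda>z. (snd z)\<^sup>2 * fst z) ` (S \<times> {0..1}) \<subseteq> S" using star by auto
  qed (intro continuous_intros)
  then have "continuous_on (S \<times> {0..1}) (\<lambda>z. snd z ^ m * F ((snd z)\<^sup>2 * fst z))"
    by (intro continuous_intros)
  then show ?thesis by (simp add: split_beta)
qed

lemma Ioo_star: "u \<in> {-d<..<d} \<Longrightarrow> x \<in> {0..1} \<Longrightarrow> x\<^sup>2 * u \<in> {-d<..<d}" for u x d :: real
  using square_mult_in_Ioo[of u d x] by (simp add: abs_less_iff)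

lemma radial_avg_cont:
  fixes F :: "real \<Rightarrow> real" and S :: "real set"
  assumes F: "continuous_on S F" and star: "\<And>u x. u \<in> S \<Longrightarrow> x \<in> {0..1} \<Longrightarrow> x\<^sup>2 * u \<in> S"
  shows "continuous_on S (radial_avg m F)"
  using integral_continuous_on_param[of S 0 1 "\<lambda>u x. x ^ m * F (x\<^sup>2 * u)"] radial_avg_integrand_cont[OF F star]
  by (simp add: radial_avg_def[abs_def])

lemma radial_avg_integrable:
  fixes F :: "real \<Rightarrow> real" and S :: "real set"
  assumes F: "continuous_on S F" and star: "\<And>x. x \<in> {0..1} \<Longrightarrow> x\<^sup>2 * u \<in> S"
  shows "continuous_on {0..1} (\<lambda>x. x ^ m * F (x\<^sup>2 * u))"
proof -
  have "continuous_on {0..1} (\<lambda>x. F (x\<^sup>2 * u))"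
    by (rule continuous_on_compose2[OF F]) (use star in \<open>auto intro!: continuous_intros\<close>)
  then show ?thesis by (intro continuous_intros)
qed

text \<open>Differentiation under the integral only raises the weight from \<open>m\<close> to
  \<open>m + 2\<close>, so derivatives stay in the same family and smoothness of the average follows
  by induction.\<close>

lemma radial_avg_deriv:
  assumes F: "\<And>x. x \<in> {-d<..<d} \<Longrightarrow> (F has_real_derivative F' x) (at x)" and F': "continuous_on {-d<..<d} F'"
    and u: "u \<in> {-d<..<d}"
  shows "(radial_avg m F has_real_derivative radial_avg (m + 2) F' u) (at u)"
proof -
  have cF: "continuous_on {-d<..<d} F"
    by (rule DERIV_continuous_on, rule has_field_derivative_at_within, rule F)
  have "((\<lambda>u. integral (cbox 0 1) (\<lambda>x. x ^ m * F (x\<^sup>2 * u))) has_real_derivative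
      integral (cbox 0 1) (\<lambda>x. x ^ (m + 2) * F' (x\<^sup>2 * u))) (at u within {-d<..<d})"
  proof (rule leibniz_rule_field_derivative[OF _ _ _ u])
    fix y t :: real assume y: "y \<in> {-d<..<d}" and t: "t \<in> cbox 0 1"
    have "\<bar>t\<^sup>2 * y\<bar> < d" by (rule square_mult_in_Ioo) (use y t in auto)
    then have "t\<^sup>2 * y \<in> {-d<..<d}" by auto
    then have "((\<lambda>u. F (t\<^sup>2 * u)) has_real_derivative F' (t\<^sup>2 * y) * t\<^sup>2) (at y)"
      by (rule DERIV_chain2[OF F]) (auto intro!: derivative_eq_intros)
    then have "((\<lambda>u. t ^ m * F (t\<^sup>2 * u)) has_real_derivative t ^ m * (F' (t\<^sup>2 * y) * t\<^sup>2)) (at y)"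
      by (rule DERIV_cmult)
    then show "((\<lambda>u. t ^ m * F (t\<^sup>2 * u)) has_real_derivative t ^ (m + 2) * F' (t\<^sup>2 * y)) (at y within {-d<..<d})"
      by (rule has_field_derivative_at_within[THEN DERIV_cong]) (simp add: power_add mult_ac power2_eq_square)
  next
    fix y :: real assume y: "y \<in> {-d<..<d}"
    show "(\<lambda>x. x ^ m * F (x\<^sup>2 * y)) integrable_on cbox 0 1"
      using integrable_continuous_real[OF radial_avg_integrable[OF cF Ioo_star[OF y]]] by simp
  next
    show "continuous_on ({-d<..<d} \<times> cbox 0 1) (\<lambda>(u, x). x ^ (m + 2) * F' (x\<^sup>2 * u))"
      unfolding cbox_interval by (rule radial_avg_integrand_cont[OF F' Ioo_star])
  qed simp
  then show ?thesis
    using u by (simp add: radial_avg_def[abs_def] at_within_open[OF u])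
qed

lemma Ck_real_radial_avg: "Ck_real k {-d<..<d} F \<Longrightarrow> Ck_real k {-d<..<d} (radial_avg m F)"
proof (induction k arbitrary: m F)
  case 0 then show ?case using radial_avg_cont[OF _ Ioo_star, of d F m] by simp
next
  case (Suc k)
  obtain F' where F': "\<And>x. x \<in> {-d<..<d} \<Longrightarrow> (F has_real_derivative F' x) (at x)" "Ck_real k {-d<..<d} F'"
    using Ck_real_SucD[OF Suc.prems] by blast
  have "(radial_avg m F has_real_derivative radial_avg (m + 2) F' x) (at x)" if "x \<in> {-d<..<d}" for x
    using radial_avg_deriv[of d F F', OF F'(1) Ck_real_continuous[OF F'(2)] that] by blast
  then show ?case by (rule Ck_real_SucI[OF _ Suc.IH[OF F'(2)]])
qed

lemma DERIV_at_limit: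
  fixes f f' :: "real \<Rightarrow> real"
  assumes d: "0 < d" and cf: "isCont f 0" and cf': "isCont f' 0"
    and f: "\<And>x. x \<noteq> 0 \<Longrightarrow> \<bar>x\<bar> < d \<Longrightarrow> (f has_real_derivative f' x) (at x)"
  shows "(f has_real_derivative f' 0) (at 0)"
proof -
  have ev: "eventually (\<lambda>x. x \<noteq> 0 \<and> \<bar>x\<bar> < d) (at (0::real))"
    unfolding eventually_at by (rule exI[of _ d]) (use d in \<open>auto simp: dist_real_def\<close>)
  have "((\<lambda>x. (f x - f 0) / x) \<longlongrightarrow> f' 0) (at 0)"
  proof (rule lhopital[where f'=f' and g'="\<lambda>_. 1"])
    show "((\<lambda>x. f x - f 0) \<longlongrightarrow> 0) (at 0)" using cf by (simp add: isCont_def LIM_zero)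
    show "eventually (\<lambda>x. ((\<lambda>x. f x - f 0) has_real_derivative f' x) (at x)) (at 0)"
      using ev by eventually_elim (auto intro!: derivative_eq_intros f)
    show "((\<lambda>x. f' x / 1) \<longlongrightarrow> f' 0) (at 0)" using cf' by (simp add: isCont_def)
  qed (auto intro!: tendsto_eq_intros eventually_neq_at_within simp: eventually_at_filter)
  then show ?thesis by (simp add: DERIV_def)
qed

context sphere_profile begin

text \<open>The pole equation in the variable \<open>u = sin^2\<close> makes sense for negative \<open>u\<close> as well; solving it there
  extends the profile smoothly across the pole.\<close>

lemma pole_extension:
  fixes a :: real
  assumes a: "0 < a"
  obtains d e where "0 < d" "d < 1" "continuous_on {0..<d} e" "e 0 = a"
    "\<And>t. 0 \<le> t \<Longrightarrow> t < d \<Longrightarrow> 0 < e t"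
    "\<And>t. 0 \<le> t \<Longrightarrow> t < d \<Longrightarrow> 0 < n * radial_avg (n - 1) (\<lambda>w. (e w * (1 + w) powr (1/2)) powr (p - 1)) t"
    "\<And>t. 0 < t \<Longrightarrow> t < d \<Longrightarrow> (e has_real_derivative
        - ((n * radial_avg (n - 1) (\<lambda>w. (e w * (1 + w) powr (1/2)) powr (p - 1)) t) powr (1 / n) * (1 + t) powr (- 3 / 2) / 2)) (at t)"
proof -
  define \<epsilon> where "\<epsilon> = min a (a powr (p - 1)) / 2"
  have \<epsilon>: "0 < \<epsilon>" "\<epsilon> < a" "\<epsilon> < a powr (p - 1)" using a by (auto simp: \<epsilon>_def min_def)
  define F where "F u w = max (u w * (1 + w) powr (1/2)) \<epsilon> powr (p - 1)" for u :: "real \<Rightarrow> real" and w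
  define A where "A u t = n * radial_avg (n - 1) (F u) t" for u t
  \<comment> \<open>\<open>t\<close> is \<open>- u\<close>, whence the sign and the factor
    \<open>1 + t\<close>. Both bases are truncated at \<open>\<epsilon>\<close>, which is inactive
    near \<open>t = 0\<close> because \<open>\<epsilon>\<close> lies below the values
    \<open>a\<close> and \<open>a^(p - 1)\<close> there.\<close>
  define \<Psi> where "\<Psi> u t = - (max (A u t) \<epsilon> powr (1 / n) * (1 + t) powr (- 3 / 2) / 2)" for u t
  have star: "x\<^sup>2 * t \<in> {0..b}" if "t \<in> {0..b}" "x \<in> {0..1}" for x t b :: real
    using that mult_right_mono[of "x\<^sup>2" 1 t] by (auto simp: power_le_one)
  have cF: "continuous_on {0..b} (F u)" if "continuous_on {0..b} u" for u b
    unfolding F_def using \<epsilon> by (intro continuous_intros that) auto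
  have cA: "continuous_on {0..b} (A u)" if "continuous_on {0..b} u" for u b
    unfolding A_def by (intro continuous_intros radial_avg_cont[OF cF[OF that] star])
  have c\<Psi>: "continuous_on {0..b} (\<Psi> u)" if "continuous_on {0..b} u" for u b
    unfolding \<Psi>_def using \<epsilon> by (intro continuous_intros cA that) auto
  define l1 where "l1 = \<bar>p - 1\<bar> * \<epsilon> powr (p - 1 - 1)"
  define l2 where "l2 = \<bar>1 / real n\<bar> * \<epsilon> powr (1 / real n - 1)"
  have l: "0 \<le> l1" "0 \<le> l2" by (auto simp: l1_def l2_def)
  have wc: "\<exists>\<kappa>. weight_contraction (\<lambda>u t. a + integral {0..t} (\<Psi> u)) \<kappa> b" if b: "0 < b" "b < 1" for b
  proof -
    have "\<exists>\<kappa>. \<forall>a. weight_contraction (\<lambda>u t. a + integral {0..t} (\<Psi> u)) \<kappa> b"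
    proof (rule integral_contraction[OF b(1), of "l2 * (n * (2 * l1))"])
      fix u v :: "real \<Rightarrow> real" and M \<kappa> t :: real
      assume u: "continuous_on {0..b} u" and v: "continuous_on {0..b} v" and \<kappa>: "0 \<le> \<kappa>" and M: "0 \<le> M"
        and uv: "\<And>t. t \<in> {0..b} \<Longrightarrow> \<bar>u t - v t\<bar> \<le> M * exp (\<kappa> * t)" and t: "t \<in> {0..b}"
      define B where "B = 2 * l1 * (M * exp (\<kappa> * t))"
      have Fb: "\<bar>F u w - F v w\<bar> \<le> B" if w: "w \<in> {0..t}" for w
      proof -
        have 1: "\<bar>F u w - F v w\<bar> \<le> l1 * \<bar>u w * (1 + w) powr (1/2) - v w * (1 + w) powr (1/2)\<bar>"
          unfolding F_def l1_def by (rule max_powr_lipschitz) (use \<epsilon> p in auto)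
        have "\<bar>u w * (1 + w) powr (1/2) - v w * (1 + w) powr (1/2)\<bar> = \<bar>u w - v w\<bar> * (1 + w) powr (1/2)"
          by (simp add: abs_mult left_diff_distrib[symmetric])
        also have "\<dots> \<le> (M * exp (\<kappa> * t)) * 2"
        proof (rule mult_mono)
          have "\<bar>u w - v w\<bar> \<le> M * exp (\<kappa> * w)" using uv w t by auto
          also have "\<dots> \<le> M * exp (\<kappa> * t)" using w \<kappa> M by (intro mult_left_mono) (auto intro: mult_left_mono)
          finally show "\<bar>u w - v w\<bar> \<le> M * exp (\<kappa> * t)" .
          have "(1 + w) powr (1/2) \<le> (1 + w) powr 1" using w by (intro powr_mono) auto
          then show "(1 + w) powr (1/2) \<le> 2" using w t b by simp
        qed (use M in auto)
        finally have "l1 * \<bar>u w * (1 + w) powr (1/2) - v w * (1 + w) powr (1/2)\<bar> \<le> l1 * ((M * exp (\<kappa> * t)) * 2)"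
          using l by (intro mult_left_mono)
        then show ?thesis using 1 by (simp add: B_def)
      qed
      have B0: "0 \<le> B" using l M by (simp add: B_def)
      have ci: "continuous_on {0..1} (\<lambda>x. x ^ (n - 1) * F w (x\<^sup>2 * t))" if "continuous_on {0..b} w" for w
        by (rule radial_avg_integrable[OF cF[OF that] star[OF t]])
      have "\<bar>radial_avg (n - 1) (F u) t - radial_avg (n - 1) (F v) t\<bar>
          = norm (integral {0..1} (\<lambda>x. x ^ (n - 1) * F u (x\<^sup>2 * t) - x ^ (n - 1) * F v (x\<^sup>2 * t)))"
        using Henstock_Kurzweil_Integration.integral_diff[OF integrable_continuous_real[OF ci[OF u]] integrable_continuous_real[OF ci[OF v]]]
        unfolding radial_avg_def real_norm_def by (simp only:)
      also have "\<dots> \<le> B * (1 - 0)"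
      proof (rule integral_bound)
        fix x :: real assume x: "x \<in> {0..1}"
        have "x\<^sup>2 * t \<in> {0..t}" using star[of t t x] x t by auto
        then have "\<bar>x ^ (n - 1)\<bar> * \<bar>F u (x\<^sup>2 * t) - F v (x\<^sup>2 * t)\<bar> \<le> 1 * B"
          using Fb x by (intro mult_mono) (auto simp: power_le_one)
        then show "norm (x ^ (n - 1) * F u (x\<^sup>2 * t) - x ^ (n - 1) * F v (x\<^sup>2 * t)) \<le> B"
          by (simp add: abs_mult right_diff_distrib[symmetric])
      next
        show "continuous_on {0..1} (\<lambda>x. x ^ (n - 1) * F u (x\<^sup>2 * t) - x ^ (n - 1) * F v (x\<^sup>2 * t))"
          by (intro continuous_on_diff ci u v)
      qed simp
      finally have "\<bar>A u t - A v t\<bar> \<le> n * B"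
        unfolding A_def right_diff_distrib[symmetric] abs_mult by (simp add: mult_left_mono)
      then have "l2 * \<bar>A u t - A v t\<bar> \<le> l2 * (n * B)" using l by (intro mult_left_mono)
      moreover have "\<bar>max (A u t) \<epsilon> powr (1 / n) - max (A v t) \<epsilon> powr (1 / n)\<bar> \<le> l2 * \<bar>A u t - A v t\<bar>"
        unfolding l2_def by (rule max_powr_lipschitz) (use \<epsilon> n in auto)
      ultimately have m: "\<bar>max (A u t) \<epsilon> powr (1 / n) - max (A v t) \<epsilon> powr (1 / n)\<bar> \<le> l2 * (n * B)" by linarith
      have "(1 + t) powr (- 3 / 2) \<le> (1 + t) powr 0" using t by (intro powr_mono) auto
      then have w1: "(1 + t) powr (- 3 / 2) / 2 \<le> 1" using t by simp
      have "\<Psi> u t - \<Psi> v t = - ((max (A u t) \<epsilon> powr (1 / n) - max (A v t) \<epsilon> powr (1 / n)) * ((1 + t) powr (- 3 / 2) / 2))"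
        by (simp add: \<Psi>_def left_diff_distrib diff_divide_distrib)
      also have "\<bar>\<dots>\<bar> = \<bar>max (A u t) \<epsilon> powr (1 / n) - max (A v t) \<epsilon> powr (1 / n)\<bar> * ((1 + t) powr (- 3 / 2) / 2)"
        unfolding abs_minus_cancel abs_mult by simp
      also have "\<dots> \<le> (l2 * (n * B)) * 1" using m w1 l B0 by (intro mult_mono) auto
      finally show "\<bar>\<Psi> u t - \<Psi> v t\<bar> \<le> l2 * (n * (2 * l1)) * M * exp (\<kappa> * t)" by (simp add: B_def mult_ac)
    qed (use l c\<Psi> in auto)
    then show ?thesis by blast
  qed
  have cT: "continuous_on {0..<1} (\<lambda>t. a + integral {0..t} (\<Psi> u))" if u: "continuous_on {0..<1} u" for u
  proof (rule continuous_on_Ico_if_Icc)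
    fix b :: real assume b: "0 < b" "b < 1"
    have "continuous_on {0..b} (\<Psi> u)" by (rule c\<Psi>, rule continuous_on_subset[OF u]) (use b in auto)
    then show "continuous_on {0..b} (\<lambda>t. a + integral {0..t} (\<Psi> u))"
      by (intro continuous_intros indefinite_integral_continuous_1 integrable_continuous_real)
  qed
  obtain e where ce: "continuous_on {0..<1} e" and fe: "\<And>t. t \<in> {0..<1} \<Longrightarrow> a + integral {0..t} (\<Psi> e) = e t"
    by (rule weight_contraction_fixpoint[of 1 "\<lambda>u t. a + integral {0..t} (\<Psi> u)", OF cT wc])
       (assumption+, rule that, auto)
  have ce': "continuous_on {0..b} e" if "b < 1" for b by (rule continuous_on_subset[OF ce]) (use that in auto)
  have e0: "e 0 = a" using fe[of 0] by simp
  have de: "(e has_real_derivative \<Psi> e t) (at t)" if t: "0 < t" "t < 1" for t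
  proof -
    define b where "b = (t + 1) / 2"
    have b: "0 < b" "t < b" "b < 1" using t by (auto simp: b_def)
    have "((\<lambda>y. a + integral {0..y} (\<Psi> e)) has_real_derivative 0 + \<Psi> e t) (at t within {0..b})"
      by (intro DERIV_add DERIV_const integral_has_real_derivative c\<Psi> ce' b) (use t b in auto)
    then have "((\<lambda>y. a + integral {0..y} (\<Psi> e)) has_real_derivative \<Psi> e t) (at t)"
      using b t by (simp add: at_within_Icc_at)
    then show ?thesis
      by (rule has_field_derivative_transform_within_open[where S="{0<..<1}"]) (use t fe in auto)
  qed
  \<comment> \<open>The weight \<open>n x^(n - 1)\<close> has integral 1.\<close>
  have A0: "A e 0 = a powr (p - 1)"
  proof -
    have "integral {0..1} (\<lambda>x::real. x ^ (n - 1) * F e 0) = 1 / n * F e 0"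
    proof -
      have "integral {0..1} (\<lambda>x::real. x ^ (n - 1)) = 1 / n"
      proof (rule integral_unique)
        have "((\<lambda>x::real. x ^ (n - 1)) has_integral 1 ^ n / n - 0 ^ n / n) {0..1}"
          by (rule fundamental_theorem_of_calculus)
             (use n in \<open>auto simp: has_real_derivative_iff_has_vector_derivative[symmetric] intro!: derivative_eq_intros\<close>)
        then show "((\<lambda>x::real. x ^ (n - 1)) has_integral 1 / n) {0..1}" using n by (simp add: zero_power)
      qed
      then show ?thesis by simp
    qed
    then show ?thesis using n \<epsilon> by (simp add: A_def radial_avg_def F_def e0 max_def)
  qed
  have "continuous_on {0..1/2} (\<lambda>t. e t * (1 + t) powr (1/2))" "continuous_on {0..1/2} (A e)"
    by (auto intro!: continuous_intros ce' cA)
  then have "((\<lambda>t. e t * (1 + t) powr (1/2)) \<longlongrightarrow> a) (at_right 0)" "(A e \<longlongrightarrow> a powr (p - 1)) (at_right 0)"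
    using e0 A0 by (auto simp: continuous_on_def at_within_Icc_at_right dest!: bspec[of _ _ 0])
  then have "eventually (\<lambda>t. \<epsilon> < e t * (1 + t) powr (1/2)) (at_right 0)" "eventually (\<lambda>t. \<epsilon> < A e t) (at_right 0)"
    using \<epsilon> by (auto dest: order_tendstoD(1))
  then have "eventually (\<lambda>t. \<epsilon> < e t * (1 + t) powr (1/2) \<and> \<epsilon> < A e t) (at_right 0)"
    by (rule eventually_conj)
  then obtain d0 where d0: "0 < d0" "\<And>t. 0 < t \<Longrightarrow> t < d0 \<Longrightarrow> \<epsilon> < e t * (1 + t) powr (1/2) \<and> \<epsilon> < A e t"
    unfolding eventually_at_right_field by blast
  define d where "d = min d0 (1 / 2)"
  have d: "0 < d" "d < 1" "d \<le> d0" using d0 by (auto simp: d_def)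
  have big: "\<epsilon> < e t * (1 + t) powr (1/2)" "\<epsilon> < A e t" if "0 \<le> t" "t < d" for t
    using d0(2)[of t] that d e0 A0 \<epsilon> by (cases "t = 0"; simp)+
  have Feq: "F e w = (e w * (1 + w) powr (1/2)) powr (p - 1)" if "0 \<le> w" "w < d" for w
    using big(1)[OF that] by (simp add: F_def max_def)
  have avg: "radial_avg (n - 1) (\<lambda>w. (e w * (1 + w) powr (1/2)) powr (p - 1)) t = radial_avg (n - 1) (F e) t"
    if t: "0 \<le> t" "t < d" for t
    unfolding radial_avg_def
  proof (rule integral_cong)
    fix x :: real assume x: "x \<in> {0..1}"
    have "x\<^sup>2 * t \<in> {0..t}" using star[of t t x] x t by auto
    then show "x ^ (n - 1) * (e (x\<^sup>2 * t) * (1 + x\<^sup>2 * t) powr (1/2)) powr (p - 1) = x ^ (n - 1) * F e (x\<^sup>2 * t)"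
      using Feq[of "x\<^sup>2 * t"] t by simp
  qed
  show ?thesis
  proof (rule that[of d e, OF d(1,2) _ e0])
    show "continuous_on {0..<d} e" by (rule continuous_on_subset[OF ce]) (use d in auto)
    show "0 < e t" if "0 \<le> t" "t < d" for t
    proof -
      have "0 < e t * (1 + t) powr (1/2)" using big(1)[OF that] \<epsilon> by simp
      then show ?thesis by (simp add: zero_less_mult_iff)
    qed
    show "0 < n * radial_avg (n - 1) (\<lambda>w. (e w * (1 + w) powr (1/2)) powr (p - 1)) t" if "0 \<le> t" "t < d" for t
      unfolding avg[OF that] using big(2)[OF that] \<epsilon> by (simp add: A_def)
    show "(e has_real_derivative
        - ((n * radial_avg (n - 1) (\<lambda>w. (e w * (1 + w) powr (1/2)) powr (p - 1)) t) powr (1 / n) * (1 + t) powr (- 3 / 2) / 2)) (at t)"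
      if t: "0 < t" "t < d" for t
    proof -
      have "max (A e t) \<epsilon> = A e t" using big(2)[of t] t by simp
      then show ?thesis
        using de[of t] t d avg[of t] by (simp add: \<Psi>_def A_def)
    qed
  qed
qed

text \<open>With \<open>u = sin^2\<close> and \<open>E = h / cos\<close>, \<open>pole_fun E\<close> is \<open>g^n\<close>, and the system becomes
  \<open>E' = g (1 - u)^(-3/2) / 2\<close> without a singularity.\<close>

definition pole_fun :: "(real \<Rightarrow> real) \<Rightarrow> real \<Rightarrow> real" where
  "pole_fun E u = n * radial_avg (n - 1) (\<lambda>w. (E w * (1 - w) powr (1/2)) powr (p - 1)) u"

text \<open>The right-hand side contains \<open>E\<close> only through its radial average and smooth
  functions, so it is as smooth as \<open>E\<close>, and the equation gains one derivative at a
  time. At \<open>u = 0\<close> the equation holds because both sides are continuous there.\<close>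

lemma pole_bootstrap:
  assumes d: "0 < d" "d < 1" and cE: "continuous_on {-d<..<d} E"
    and E0: "\<And>u. u \<in> {-d<..<d} \<Longrightarrow> 0 < E u" and A0: "\<And>u. u \<in> {-d<..<d} \<Longrightarrow> 0 < pole_fun E u"
    and dE: "\<And>u. u \<noteq> 0 \<Longrightarrow> u \<in> {-d<..<d} \<Longrightarrow>
      (E has_real_derivative pole_fun E u powr (1 / n) * (1 - u) powr (- 3 / 2) / 2) (at u)"
  shows "Ck_real k {-d<..<d} E"
proof -
  define E' where "E' u = pole_fun E u powr (1 / n) * (1 - u) powr (- 3 / 2) * (1 / 2)" for u
  have ck_sqrt: "Ck_real k {-d<..<d} (\<lambda>u. (1 - u) powr r)" for k r
    by (intro Ck_real_powr Ck_real_diff Ck_real_const Ck_real_ident) (use d in auto)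
  have ck_A: "Ck_real k {-d<..<d} (pole_fun E)" if "Ck_real k {-d<..<d} E" for k
    unfolding pole_fun_def[abs_def]
    by (intro Ck_real_mult Ck_real_const Ck_real_radial_avg Ck_real_powr ck_sqrt that)
       (use d E0 in \<open>auto intro!: mult_pos_pos\<close>)
  have ck_E': "Ck_real k {-d<..<d} E'" if "Ck_real k {-d<..<d} E" for k
    unfolding E'_def[abs_def] by (intro Ck_real_mult Ck_real_const Ck_real_powr[OF ck_A[OF that] A0] ck_sqrt)
  have cE': "continuous_on {-d<..<d} E'" using ck_E'[of 0] cE by simp
  have in0: "0 \<in> {-d<..<d}" using d by auto
  have dE0: "(E has_real_derivative E' 0) (at 0)"
  proof (rule DERIV_at_limit[OF d(1)])
    show "isCont E 0" "isCont E' 0"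
      using cE cE' in0 by (auto simp: continuous_on_eq_continuous_at)
    show "(E has_real_derivative E' x) (at x)" if "x \<noteq> 0" "\<bar>x\<bar> < d" for x
      using dE[of x] that by (auto simp: E'_def abs_less_iff)
  qed
  have dEall: "(E has_real_derivative E' u) (at u)" if "u \<in> {-d<..<d}" for u
  proof (cases "u = 0")
    case False
    then show ?thesis using dE[OF False that] by (simp add: E'_def)
  qed (use dE0 in simp)
  show ?thesis
  proof (induction k)
    case 0
    show ?case using cE by simp
  next
    case (Suc k)
    show ?case by (rule Ck_real_SucI[OF dEall ck_E'[OF Suc]])
  qed
qed

text \<open>Only bounds are assumed near the pole, not continuity of \<open>h\<close> and
  \<open>q\<close>; this lets it apply to the south pole after reflection. In
  \<open>u = sin^2\<close> the bounds make \<open>h / cos\<close> Lipschitz near the pole, so that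
  it has a limit, from which the equation is solved for negative \<open>u\<close> as well.\<close>

lemma pole_regularity:
  assumes dh: "\<And>\<theta>. 0 < \<theta> \<Longrightarrow> \<theta> < pi \<Longrightarrow> (h has_real_derivative q \<theta> * sin \<theta>) (at \<theta>)"
    and dq: "\<And>\<theta>. 0 < \<theta> \<Longrightarrow> \<theta> < pi \<Longrightarrow> (q has_real_derivative slope_rhs h q \<theta>) (at \<theta>)"
    and c: "0 < c"
    and bounds: "\<And>\<theta>. 0 < \<theta> \<Longrightarrow> \<theta> < pi \<Longrightarrow> c \<le> h \<theta> \<and> c \<le> radius h q \<theta> \<and> radius h q \<theta> \<le> C"
  obtains d f where "0 < d" "d < 1" "\<And>k. Ck_real k {1 - d<..<1 + d} f"
    "\<And>\<theta>. 0 < \<theta> \<Longrightarrow> \<theta> < pi \<Longrightarrow> 1 - d < cos \<theta> \<Longrightarrow> f (cos \<theta>) = h \<theta>"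
proof -
  define T where "T u = arcsin (sqrt u)" for u
  define g where "g \<theta> = radius h q \<theta>" for \<theta>
  define e0 where "e0 u = h (T u) / (1 - u) powr (1/2)" for u
  have T: "0 < T u" "T u < pi / 2" "sin (T u) = sqrt u" "cos (T u) = (1 - u) powr (1/2)" if u: "0 < u" "u < 1" for u
  proof -
    have s: "0 < sqrt u" "sqrt u < 1" using u by auto
    then have m1: "-1 \<le> sqrt u" by linarith
    show "0 < T u" using arcsin_less_arcsin[of 0 "sqrt u"] s by (simp add: T_def)
    show "T u < pi / 2" using arcsin_less_arcsin[of "sqrt u" 1] s by (simp add: T_def)
    show "sin (T u) = sqrt u" unfolding T_def by (rule sin_arcsin) (use s in linarith)+
    show "cos (T u) = (1 - u) powr (1/2)" using s u cos_arcsin[OF m1] by (simp add: T_def powr_half_sqrt)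
  qed
  have de0: "(e0 has_real_derivative g (T u) * (1 - u) powr (- 3 / 2) / 2) (at u)" if u: "0 < u" "u < 1" for u
  proof -
    define r where "r = sqrt (1 - u)"
    have r: "0 < r" "r * r = 1 - u" using u by (auto simp: r_def)
    have su: "0 < sqrt u" "sqrt u < 1" "(sqrt u)\<^sup>2 = u" using u by auto
    have dT: "(T has_real_derivative inverse r * (inverse (sqrt u) / 2)) (at u)"
    proof -
      have "(arcsin has_real_derivative inverse (sqrt (1 - (sqrt u)\<^sup>2))) (at (sqrt u))"
        by (rule DERIV_arcsin) (use su in linarith)+
      then have "(arcsin has_real_derivative inverse r) (at (sqrt u))" using su by (simp add: r_def)
      from DERIV_chain2[OF this DERIV_real_sqrt[OF u(1)]] show ?thesis unfolding T_def[abs_def] .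
    qed
    have Tu: "0 < T u" "T u < pi" using T(1,2)[OF u] pi_gt_zero by linarith+
    have dhT: "((\<lambda>u. h (T u)) has_real_derivative q (T u) * sqrt u * (inverse r * (inverse (sqrt u) / 2))) (at u)"
      using DERIV_chain2[OF dh[OF Tu] dT] T(3)[OF u] by simp
    have dr: "((\<lambda>u. sqrt (1 - u)) has_real_derivative - (inverse r / 2)) (at u)"
      unfolding r_def by (rule derivative_eq_intros refl | use u in simp)+
    have "((\<lambda>u. h (T u) / sqrt (1 - u)) has_real_derivative
       (q (T u) * sqrt u * (inverse r * (inverse (sqrt u) / 2)) * sqrt (1 - u) - h (T u) * - (inverse r / 2)) / (sqrt (1 - u) * sqrt (1 - u))) (at u)"
      by (rule DERIV_divide[OF dhT dr]) (use u in auto)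
    moreover have "(q (T u) * sqrt u * (inverse r * (inverse (sqrt u) / 2)) * sqrt (1 - u) - h (T u) * - (inverse r / 2)) / (sqrt (1 - u) * sqrt (1 - u))
        = (h (T u) + q (T u) * r) / (r * (1 - u)) / 2"
      using r su unfolding r_def[symmetric] r(2) by (simp add: field_simps)
    moreover have "h (T u) + q (T u) * r = g (T u)"
      using T(4)[OF u] u by (simp add: g_def r_def powr_half_sqrt)
    moreover have "1 / (r * (1 - u)) = (1 - u) powr (- 3 / 2)"
    proof -
      have "r * (1 - u) = (1 - u) powr (1/2) * (1 - u) powr 1" using u by (simp add: r_def powr_half_sqrt)
      also have "\<dots> = (1 - u) powr (3/2)" unfolding powr_add[symmetric] by simp
      finally show ?thesis by (simp add: powr_minus_divide)
    qed
    ultimately have d: "((\<lambda>u. h (T u) / sqrt (1 - u)) has_real_derivative g (T u) * (1 - u) powr (- 3 / 2) / 2) (at u)"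
      by (metis (no_types, lifting) times_divide_eq_right mult.right_neutral)
    show ?thesis
      by (rule has_field_derivative_transform_within_open[OF d, of "{0<..<1}"])
         (use u in \<open>auto simp: e0_def powr_half_sqrt\<close>)
  qed
  have gb: "c \<le> g (T u)" "g (T u) \<le> C" "c \<le> h (T u)" if u: "0 < u" "u < 1" for u
  proof -
    have "0 < T u" "T u < pi" using T(1,2)[OF u] pi_gt_zero by linarith+
    from bounds[OF this] show "c \<le> g (T u)" "g (T u) \<le> C" "c \<le> h (T u)" by (auto simp: g_def)
  qed
  have e0c: "c \<le> e0 u" if u: "0 < u" "u < 1" for u
  proof -
    have "(1 - u) powr (1/2) \<le> 1" using u by (intro powr_le1) auto
    then have "h (T u) / 1 \<le> e0 u" unfolding e0_def using gb(3)[OF u] c u by (intro divide_left_mono) auto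
    then show ?thesis using gb(3)[OF u] by simp
  qed
  obtain a where a: "(e0 \<longlongrightarrow> a) (at_right 0)"
  proof -
    define B where "B = C * (1/2) powr (- 3 / 2) / 2"
    have "B-lipschitz_on {0<..<1/2} e0"
    proof (rule lipschitz_onI)
      have C0: "0 \<le> C" using gb(1,2)[of "1/2"] c by simp
      show "0 \<le> B" using C0 by (simp add: B_def)
      fix x y :: real assume xy: "x \<in> {0<..<1/2}" "y \<in> {0<..<1/2}"
      have "norm (e0 x - e0 y) \<le> B * norm (x - y)"
      proof (rule field_differentiable_bound[where f'="\<lambda>u. g (T u) * (1 - u) powr (- 3 / 2) / 2"])
        fix z :: real assume z: "z \<in> {0<..<1/2}"
        show "(e0 has_real_derivative g (T z) * (1 - z) powr (- 3 / 2) / 2) (at z within {0<..<1/2})"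
          by (rule has_field_derivative_at_within[OF de0]) (use z in auto)
        have g0: "0 \<le> g (T z)" using gb(1)[of z] c z by simp
        have "g (T z) * (1 - z) powr (- 3 / 2) \<le> C * (1/2) powr (- 3 / 2)"
          using gb(2)[of z] g0 C0 z by (intro mult_mono powr_mono2') auto
        then show "norm (g (T z) * (1 - z) powr (- 3 / 2) / 2) \<le> B" using g0 by (simp add: B_def abs_mult)
      qed (use xy in auto)
      then show "dist (e0 x) (e0 y) \<le> B * dist x y" by (simp add: dist_norm)
    qed
    then have "uniformly_continuous_on {0<..<1/2} e0" by (rule lipschitz_on_uniformly_continuous)
    moreover have "(0::real) \<in> closure {0<..<1/2}" by simp
    ultimately obtain a where "(e0 \<longlongrightarrow> a) (at 0 within {0<..<1/2})"
      using uniformly_continuous_on_extension_at_closure by blast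
    moreover have "at 0 within {0<..<1/2} = at_right (0::real)"
      by (rule at_within_nhd[of _ "{..<1/2}"]) auto
    ultimately show ?thesis using that by simp
  qed
  have "c \<le> a"
    by (rule tendsto_lowerbound[OF a])
       (use eventually_at_right_real[of 0 1] e0c in \<open>auto elim!: eventually_mono\<close>)
  then have apos: "0 < a" using c by simp
  obtain d e where d: "0 < d" "d < 1" and ce: "continuous_on {0..<d} e" and ea: "e 0 = a"
    and e_pos: "\<And>t. 0 \<le> t \<Longrightarrow> t < d \<Longrightarrow> 0 < e t"
    and A_pos: "\<And>t. 0 \<le> t \<Longrightarrow> t < d \<Longrightarrow> 0 < n * radial_avg (n - 1) (\<lambda>w. (e w * (1 + w) powr (1/2)) powr (p - 1)) t"
    and de: "\<And>t. 0 < t \<Longrightarrow> t < d \<Longrightarrow> (e has_real_derivative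
        - ((n * radial_avg (n - 1) (\<lambda>w. (e w * (1 + w) powr (1/2)) powr (p - 1)) t) powr (1 / n) * (1 + t) powr (- 3 / 2) / 2)) (at t)"
    using pole_extension[OF apos] by blast
  \<comment> \<open>Glues the profile for \<open>u > 0\<close> to the solution of the extended
    equation for \<open>u \<le> 0\<close>.\<close>
  define E where "E u = (if u \<le> 0 then e (- u) else e0 u)" for u
  have E_pos: "0 < E u" if "u \<in> {-d<..<d}" for u
    using that e_pos[of "- u"] e0c[of u] c d by (auto simp: E_def)
  have A_neg: "pole_fun E u = n * radial_avg (n - 1) (\<lambda>w. (e w * (1 + w) powr (1/2)) powr (p - 1)) (- u)" if u: "u \<le> 0" for u
  proof -
    have "E (x\<^sup>2 * u) = e (- (x\<^sup>2 * u))" for x using u by (simp add: E_def mult_nonneg_nonpos)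
    then show ?thesis unfolding pole_fun_def radial_avg_def by simp
  qed
  have E_neg: "(E has_real_derivative pole_fun E u powr (1 / n) * (1 - u) powr (- 3 / 2) / 2) (at u)"
    if u: "-d < u" "u < 0" for u
  proof -
    have "((\<lambda>u. e (- u)) has_real_derivative
       - ((n * radial_avg (n - 1) (\<lambda>w. (e w * (1 + w) powr (1/2)) powr (p - 1)) (- u)) powr (1 / n) * (1 + - u) powr (- 3 / 2) / 2) * - 1) (at u)"
      by (rule DERIV_chain2[OF de]) (use u in \<open>auto intro!: derivative_eq_intros\<close>)
    then have "((\<lambda>u. e (- u)) has_real_derivative pole_fun E u powr (1 / n) * (1 - u) powr (- 3 / 2) / 2) (at u)"
      using A_neg[of u] u by simp
    then show ?thesis
      by (rule has_field_derivative_transform_within_open[of _ _ _ "{..<0}"]) (use u in \<open>auto simp: E_def\<close>)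
  qed
  have E_pos_d: "(E has_real_derivative g (T u) * (1 - u) powr (- 3 / 2) / 2) (at u)" if u: "0 < u" "u < d" for u
    by (rule has_field_derivative_transform_within_open[OF de0, of _ "{0<..}"]) (use u d in \<open>auto simp: E_def\<close>)
  have E0: "isCont E 0"
  proof -
    have "eventually (\<lambda>x. e0 x = E x) (at_right 0)"
      using eventually_at_right_less[of 0] by eventually_elim (simp add: E_def)
    with a have "(E \<longlongrightarrow> a) (at_right 0)" by (rule Lim_transform_eventually)
    moreover have "(E \<longlongrightarrow> a) (at_left 0)"
    proof -
      have "continuous_on {0..d/2} e" by (rule continuous_on_subset[OF ce]) (use d in auto)
      then have "(e \<longlongrightarrow> a) (at_right 0)" using d ea by (auto simp: continuous_on_def at_within_Icc_at_right dest!: bspec[of _ _ 0])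
      then have "((\<lambda>u. e (- u)) \<longlongrightarrow> a) (at_left 0)" by (simp add: filterlim_at_left_to_right)
      then show ?thesis
        by (rule Lim_transform_eventually) (auto simp: E_def eventually_at_filter)
    qed
    ultimately show ?thesis using ea by (simp add: isCont_def filterlim_split_at E_def)
  qed
  have cE: "continuous_on {-d<..<d} E"
  proof (rule continuous_at_imp_continuous_on, rule ballI)
    fix u assume u: "u \<in> {-d<..<d}"
    consider "u < 0" | "u = 0" | "0 < u" by linarith
    then show "isCont E u"
    proof cases
      case 1 then show ?thesis using E_neg[of u] u DERIV_isCont by auto
    next
      case 2 then show ?thesis using E0 by simp
    next
      case 3 then show ?thesis using E_pos_d[of u] u DERIV_isCont by auto
    qed
  qed
  \<comment> \<open>Integrate the identity for \<open>(g sin)^n\<close> from the pole in the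
    variable \<open>x = sin \<theta>\<close>. That \<open>(g sin)^n\<close> tends to
    \<open>0\<close> at the pole follows from the bound on \<open>g\<close>, and scaling
    \<open>{0..x0}\<close> to \<open>{0..1}\<close> gives the radial average.\<close>
  have A_eq: "pole_fun E u = g (T u) ^ n" if u: "0 < u" "u < d" for u
  proof -
    define F where "F w = (E w * (1 - w) powr (1/2)) powr (p - 1)" for w
    define x0 where "x0 = sqrt u"
    have x0: "0 < x0" "x0 < 1" "x0\<^sup>2 = u" using u d by (auto simp: x0_def)
    have F: "F (x\<^sup>2) = h (arcsin x) powr (p - 1)" if x: "0 < x" "x < 1" for x
    proof -
      have x2: "0 < x\<^sup>2" "x\<^sup>2 < 1" using x by (auto simp: power_less_one_iff abs_square_less_1)
      have "E (x\<^sup>2) * (1 - x\<^sup>2) powr (1/2) = h (arcsin x)" using x2 x by (simp add: E_def e0_def T_def)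
      then show ?thesis by (simp add: F_def)
    qed
    have cF: "continuous_on {-d<..<d} F"
      unfolding F_def using E_pos d by (intro continuous_intros cE) (auto simp: less_imp_neq[THEN not_sym])
    define f where "f t = real n * t ^ (n - 1) * F (t\<^sup>2)" for t
    have cf: "continuous_on {0..x0} f"
    proof -
      have "continuous_on {0..x0} (\<lambda>t. F (t\<^sup>2))"
      proof (rule continuous_on_compose2[OF cF])
        show "(\<lambda>t. t\<^sup>2) ` {0..x0} \<subseteq> {-d<..<d}"
        proof (rule image_subsetI)
          fix t assume t: "t \<in> {0..x0}"
          have "t\<^sup>2 \<le> x0\<^sup>2" using t by (intro power_mono) auto
          moreover have "0 \<le> t\<^sup>2" by simp
          ultimately have "- d < t\<^sup>2" "t\<^sup>2 < d" using x0(3) u d by linarith+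
          then show "t\<^sup>2 \<in> {-d<..<d}" by simp
        qed
      qed (intro continuous_intros)
      then show ?thesis unfolding f_def by (intro continuous_intros)
    qed
    define J where "J x = x ^ n * g (arcsin x) ^ n" for x
    define K where "K x = integral {0..x} f" for x
    define D where "D x = (if x = 0 then 0 else J x - K x)" for x
    have dJ: "(J has_real_derivative f x) (at x)" if x: "0 < x" "x < 1" for x
    proof -
      define t where "t = arcsin x"
      have t: "0 < t" "t < pi / 2" "sin t = x"
        using x arcsin_less_arcsin[of 0 x] arcsin_less_arcsin[of x 1] by (auto simp: t_def)
      have tp: "t < pi" using t pi_gt_zero by linarith
      have ct: "0 < cos t" using t by (intro cos_gt_zero)
      have "((\<lambda>y. sin y ^ n * g y ^ n) has_real_derivative sin t ^ (n - 1) * (n * cos t * h t powr (p - 1))) (at t)"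
        unfolding g_def
        by (rule radius_power_deriv_at[OF t(1) tp dh[OF t(1) tp] dq[OF t(1) tp]]) (use bounds[OF t(1) tp] c in simp)
      moreover have "(arcsin has_real_derivative inverse (cos t)) (at x)"
        using DERIV_arcsin[of x] x by (simp add: t_def cos_arcsin)
      ultimately have "((\<lambda>x. sin (arcsin x) ^ n * g (arcsin x) ^ n) has_real_derivative
          sin t ^ (n - 1) * (n * cos t * h t powr (p - 1)) * inverse (cos t)) (at x)"
        unfolding t_def by (rule DERIV_chain2)
      moreover have "sin t ^ (n - 1) * (n * cos t * h t powr (p - 1)) * inverse (cos t) = f x"
        using ct F[OF x] t by (simp add: f_def t_def[symmetric])
      ultimately have "((\<lambda>x. sin (arcsin x) ^ n * g (arcsin x) ^ n) has_real_derivative f x) (at x)" by simp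
      then show ?thesis
        by (rule has_field_derivative_transform_within_open[of _ _ _ "{0<..<1}"]) (use x in \<open>auto simp: J_def\<close>)
    qed
    have dK: "(K has_real_derivative f x) (at x)" if x: "0 < x" "x < x0" for x
      using integral_has_real_derivative[OF cf, of x] x by (simp add: K_def[abs_def] at_within_Icc_at)
    have cK: "continuous_on {0..x0} K"
      unfolding K_def by (intro indefinite_integral_continuous_1 integrable_continuous_real cf)
    have cD: "continuous_on {0..x0} D"
      unfolding continuous_on_eq_continuous_within
    proof
      fix x assume x: "x \<in> {0..x0}"
      show "continuous (at x within {0..x0}) D"
      proof (cases "x = 0")
        case False
        have "continuous (at x within {0..x0}) J"
          using DERIV_isCont[OF dJ[of x]] x False x0 by (auto intro: continuous_at_imp_continuous_at_within)
        moreover have "continuous (at x within {0..x0}) K"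
          using cK x by (auto simp: continuous_on_eq_continuous_within)
        ultimately have "((\<lambda>x. J x - K x) \<longlongrightarrow> J x - K x) (at x within {0..x0})"
          unfolding continuous_within by (rule tendsto_diff)
        moreover have "eventually (\<lambda>y. J y - K y = D y) (at x within {0..x0})"
          unfolding eventually_at by (rule exI[of _ x]) (use x False in \<open>auto simp: D_def dist_real_def\<close>)
        ultimately have "(D \<longlongrightarrow> J x - K x) (at x within {0..x0})" by (rule Lim_transform_eventually)
        then show ?thesis using False by (simp add: continuous_within D_def)
      next
        case True
        have at: "at 0 within {0..x0} = at_right 0" using x0 by (simp add: at_within_Icc_at_right)
        have K0: "(K \<longlongrightarrow> 0) (at_right 0)"
        proof -
          have "K 0 = 0" by (simp add: K_def)
          then show ?thesis using cK x0 by (auto simp: continuous_on_def at[symmetric] dest!: bspec[of _ _ 0])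
        qed
        have J0: "(J \<longlongrightarrow> 0) (at_right 0)"
        proof (rule Lim_null_comparison)
          show "eventually (\<lambda>x. norm (J x) \<le> x ^ n * C ^ n) (at_right 0)"
            using eventually_at_right_real[OF zero_less_one]
          proof eventually_elim
            case (elim x)
            have x2: "0 < x\<^sup>2" "x\<^sup>2 < 1" using elim by (auto simp: power_less_one_iff abs_square_less_1)
            have Tx: "T (x\<^sup>2) = arcsin x" using elim by (simp add: T_def)
            have "0 \<le> g (arcsin x)" "g (arcsin x) \<le> C" using gb(1,2)[OF x2] c unfolding Tx by auto
            then have "x ^ n * g (arcsin x) ^ n \<le> x ^ n * C ^ n" using elim by (intro mult_left_mono power_mono) auto
            then show ?case using \<open>0 \<le> g (arcsin x)\<close> elim by (simp add: J_def)
          qed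
          show "((\<lambda>x. x ^ n * C ^ n) \<longlongrightarrow> 0) (at_right 0)"
            by (rule tendsto_eq_intros refl)+ (use n in auto)
        qed
        have "((\<lambda>x. J x - K x) \<longlongrightarrow> 0) (at_right 0)" using tendsto_diff[OF J0 K0] by simp
        moreover have "eventually (\<lambda>x. J x - K x = D x) (at_right 0)"
          using eventually_at_right_less[of 0] by eventually_elim (simp add: D_def)
        ultimately have "(D \<longlongrightarrow> 0) (at_right 0)" by (rule Lim_transform_eventually)
        then show ?thesis using True by (simp add: continuous_within D_def at)
      qed
    qed
    have "D x0 = D 0"
    proof (rule DERIV_isconst2[OF x0(1) cD])
      fix x assume x: "0 < x" "x < x0"
      have "((\<lambda>x. J x - K x) has_real_derivative f x - f x) (at x)"
        by (rule DERIV_diff[OF dJ dK]) (use x x0 in auto)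
      then have "((\<lambda>x. J x - K x) has_real_derivative 0) (at x)" by simp
      then show "DERIV D x :> 0"
        by (rule has_field_derivative_transform_within_open[of _ _ _ "{0<..}"]) (use x in \<open>auto simp: D_def\<close>)
    qed (use x0 in auto)
    then have JK: "J x0 = K x0" using x0 by (simp add: D_def)
    have "(f has_integral K x0) {0..x0}"
      unfolding K_def using integrable_continuous_real[OF cf] by (rule integrable_integral)
    then have "((\<lambda>x. f (x0 * x)) has_integral (1 / \<bar>x0\<bar>) *\<^sub>R K x0) ((\<lambda>x. x / x0) ` {0..x0})"
      by (rule has_integral_stretch_real) (use x0 in simp)
    moreover have "(\<lambda>x. x / x0) ` {0..x0} = {0..1}"
    proof -
      have "y \<in> (\<lambda>x. x / x0) ` {0..x0}" if "y \<in> {0..1}" for y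
        by (rule image_eqI[of _ _ "y * x0"]) (use that x0 mult_right_mono[of y 1 x0] in auto)
      then show ?thesis using x0 by (auto simp: divide_le_eq_1)
    qed
    ultimately have "integral {0..1} (\<lambda>x. f (x0 * x)) = K x0 / x0" using x0 by (simp add: integral_unique)
    moreover have "(\<lambda>x. f (x0 * x)) = (\<lambda>x. n * x0 ^ (n - 1) * (x ^ (n - 1) * F (x\<^sup>2 * u)))"
      using x0(3) by (auto simp: f_def power_mult_distrib mult_ac)
    ultimately have "n * x0 ^ (n - 1) * radial_avg (n - 1) F u = K x0 / x0"
      by (simp add: radial_avg_def)
    then have "K x0 = x0 * x0 ^ (n - 1) * (n * radial_avg (n - 1) F u)" using x0 by (simp add: field_simps)
    also have "x0 * x0 ^ (n - 1) = x0 ^ n" using n by (cases n) auto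
    finally have "x0 ^ n * g (arcsin x0) ^ n = x0 ^ n * (n * radial_avg (n - 1) F u)" using JK by (simp add: J_def)
    then have "g (arcsin x0) ^ n = n * radial_avg (n - 1) F u" using x0 by simp
    then show ?thesis by (simp add: pole_fun_def F_def[abs_def] T_def x0_def)
  qed
  have ck: "Ck_real k {-d<..<d} E" for k
  proof (rule pole_bootstrap[OF d cE E_pos])
    show "0 < pole_fun E u" if "u \<in> {-d<..<d}" for u
    proof (cases "u \<le> 0")
      case True
      then show ?thesis using A_neg[OF True] A_pos[of "- u"] that by simp
    next
      case False
      then show ?thesis using A_eq[of u] gb(1)[of u] c d that by simp
    qed
    show "(E has_real_derivative pole_fun E u powr (1 / n) * (1 - u) powr (- 3 / 2) / 2) (at u)"
      if "u \<noteq> 0" "u \<in> {-d<..<d}" for u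
    proof (cases "u < 0")
      case True
      then show ?thesis using E_neg that by simp
    next
      case False
      then have u: "0 < u" "u < d" using that by auto
      have "pole_fun E u powr (1 / n) = g (T u)"
        using A_eq[OF u] root_powr(1)[of "g (T u)"] gb(1)[of u] c d u by simp
      then show ?thesis using E_pos_d[OF u] by simp
    qed
  qed
  \<comment> \<open>In \<open>s = cos \<theta>\<close> one has \<open>u = 1 - s^2\<close> and
    \<open>h = cos \<theta> E u\<close>.\<close>
  define f where "f s = s * E (1 - s\<^sup>2)" for s
  \<comment> \<open>\<open>d / 3\<close> because \<open>|1 - s^2| = |1 - s| |1 + s|\<close> and the
    second factor stays below 3.\<close>
  have small: "1 - s\<^sup>2 \<in> {-d<..<d}" if s: "s \<in> {1 - d/3<..<1 + d/3}" for s
  proof -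
    have 1: "\<bar>1 - s\<bar> \<le> d / 3" "\<bar>1 + s\<bar> \<le> 2 + d / 3" using s d by (simp_all add: abs_if)
    have "\<bar>1 - s\<^sup>2\<bar> = \<bar>1 - s\<bar> * \<bar>1 + s\<bar>"
      unfolding abs_mult[symmetric] by (simp add: power2_eq_square algebra_simps)
    also have "\<dots> \<le> d / 3 * (2 + d / 3)"
      using d by (intro mult_mono 1) auto
    also have "\<dots> < d / 3 * 3" using d by (intro mult_strict_left_mono) auto
    finally show ?thesis by (simp add: abs_less_iff)
  qed
  show ?thesis
  proof (rule that[of "d / 3" f])
    show "0 < d / 3" "d / 3 < 1" using d by auto
    show "Ck_real k {1 - d / 3<..<1 + d / 3} f" for k
      unfolding f_def[abs_def]
    proof (intro Ck_real_mult Ck_real_ident Ck_real_compose[OF ck])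
      show "Ck_real k {1 - d / 3<..<1 + d / 3} (\<lambda>s. 1 - s\<^sup>2)"
        unfolding power2_eq_square by (intro Ck_real_diff Ck_real_mult Ck_real_ident Ck_real_const)
      show "(\<lambda>s. 1 - s\<^sup>2) ` {1 - d / 3<..<1 + d / 3} \<subseteq> {-d<..<d}" using small by blast
    qed
    fix \<theta> assume th: "0 < \<theta>" "\<theta> < pi" "1 - d / 3 < cos \<theta>"
    have cpos: "0 < cos \<theta>" using th(3) d by linarith
    have thp: "\<theta> < pi / 2"
    proof (rule ccontr)
      assume "\<not> \<theta> < pi / 2"
      then show False using cos_nonpos_south[of \<theta>] th cpos by simp
    qed
    have s0: "0 < sin \<theta>" using th by (intro sin_gt_zero) auto
    have sc: "1 - (cos \<theta>)\<^sup>2 = (sin \<theta>)\<^sup>2" by (simp add: sin_squared_eq)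
    have "E ((sin \<theta>)\<^sup>2) = e0 ((sin \<theta>)\<^sup>2)" using s0 by (simp add: E_def)
    also have "\<dots> = h \<theta> / cos \<theta>"
    proof -
      have "T ((sin \<theta>)\<^sup>2) = \<theta>" using s0 thp th by (simp add: T_def arcsin_sin)
      moreover have "(1 - (sin \<theta>)\<^sup>2) powr (1/2) = cos \<theta>"
        using cpos by (simp add: cos_squared_eq[symmetric] powr_half_sqrt)
      ultimately show ?thesis by (simp add: e0_def)
    qed
    finally show "f (cos \<theta>) = h \<theta>" using cpos by (simp add: f_def sc)
  qed
qed

text \<open>Near each pole the profile is a smooth function of \<open>s = cos \<theta>\<close> by
  \<open>pole_regularity\<close>, in between by bootstrapping the equation in \<open>s\<close>. The
  final equation is \<open>g^(n - 1) (h'' + h) = h^(p - 1)\<close>, written without division so that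
  it passes to \<open>s = 1\<close> and \<open>s = - 1\<close> by continuity.\<close>

lemma smooth_profile_exists:
  obtains d f f1 f2 where "0 < d" "\<And>k. Ck_real k {-1 - d<..<1 + d} f"
    "\<And>s. s \<in> {-1 - d<..<1 + d} \<Longrightarrow> (f has_real_derivative f1 s) (at s)"
    "\<And>s. s \<in> {-1 - d<..<1 + d} \<Longrightarrow> (f1 has_real_derivative f2 s) (at s)"
    "\<And>s. s \<in> {-1..1} \<Longrightarrow> 0 < f s" "\<not> (\<exists>c. \<forall>s\<in>{-1..1}. f s = c)"
    "\<And>s. s \<in> {-1..1} \<Longrightarrow> (f s - s * f1 s) ^ (n - 1) * (f s - s * f1 s + f2 s * (1 - s\<^sup>2)) = f s powr (p - 1)"
proof -
  obtain h q c C where c: "0 < c" and h01: "h 0 < 1" and sol: "\<And>b. b < pi \<Longrightarrow> is_sol b h q"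
    and bd: "\<And>\<theta>. 0 \<le> \<theta> \<Longrightarrow> \<theta> < pi \<Longrightarrow> c \<le> h \<theta> \<and> h \<theta> \<le> C \<and> c \<le> radius h q \<theta> \<and> radius h q \<theta> \<le> C"
    by (rule global_profile_exists) (rule that; assumption)
  have dh: "(h has_real_derivative q t * sin t) (at t)"
    and dq: "(q has_real_derivative slope_rhs h q t) (at t)"
    if t: "0 < t" "t < pi" for t
  proof -
    have s: "is_sol ((t + pi) / 2) h q" by (rule sol) (use t in simp)
    show "(h has_real_derivative q t * sin t) (at t)" by (rule is_solD(5)[OF s]) (use t in auto)
    show "(q has_real_derivative slope_rhs h q t) (at t)"
      by (rule is_solD(6)[OF s]) (use t in auto)
  qed
  have bd0: "c \<le> h t \<and> c \<le> radius h q t \<and> radius h q t \<le> C" if "0 < t" "t < pi" for t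
    using bd[of t] that by simp
  obtain dN fN where N: "0 < dN" "dN < 1" "\<And>k. Ck_real k {1 - dN<..<1 + dN} fN"
    "\<And>\<theta>. 0 < \<theta> \<Longrightarrow> \<theta> < pi \<Longrightarrow> 1 - dN < cos \<theta> \<Longrightarrow> fN (cos \<theta>) = h \<theta>"
    by (rule pole_regularity[OF dh dq c bd0]; (assumption | (rule that; assumption)))
  \<comment> \<open>Reflection in the equator preserves the system: \<open>q\<close> changes sign
    and so does \<open>cos\<close>, hence \<open>g\<close> is merely reflected.\<close>
  define h' where "h' t = h (pi - t)" for t
  define q' where "q' t = - q (pi - t)" for t
  have g': "radius h' q' t = h (pi - t) + q (pi - t) * cos (pi - t)" for t by (simp add: h'_def q'_def)
  have dpi: "((\<lambda>t. pi - t) has_real_derivative - 1) (at t)" for t by (auto intro!: derivative_eq_intros)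
  have dh': "(h' has_real_derivative q' t * sin t) (at t)" if t: "0 < t" "t < pi" for t
    unfolding h'_def[abs_def] q'_def using DERIV_chain2[OF dh dpi, of t] t by simp
  have dq': "(q' has_real_derivative slope_rhs h' q' t) (at t)"
    if t: "0 < t" "t < pi" for t
    unfolding g' unfolding q'_def[abs_def] h'_def using DERIV_minus[OF DERIV_chain2[OF dq dpi, of t]] t by simp
  have bd': "c \<le> h' t \<and> c \<le> radius h' q' t \<and> radius h' q' t \<le> C" if "0 < t" "t < pi" for t
    using bd[of "pi - t"] that unfolding g' by (simp add: h'_def)
  obtain dS fS where S: "0 < dS" "dS < 1" "\<And>k. Ck_real k {1 - dS<..<1 + dS} fS"
    "\<And>\<theta>. 0 < \<theta> \<Longrightarrow> \<theta> < pi \<Longrightarrow> 1 - dS < cos \<theta> \<Longrightarrow> fS (cos \<theta>) = h' \<theta>"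
    by (rule pole_regularity[OF dh' dq' c bd']; (assumption | (rule that; assumption)))
  define F where "F s = h (arccos s)" for s
  define F1 where "F1 s = - q (arccos s)" for s
  define G where "G s = F s - s * F1 s" for s
  \<comment> \<open>The equation for \<open>q'\<close> rewritten in \<open>s\<close>: the chain rule
    contributes a second factor \<open>1 / sin\<close>, and \<open>sin^2 = 1 - s^2\<close>.\<close>
  define F2 where "F2 s = (F s powr (p - 1) * G s powr (1 - real n) - G s) / (1 - s * s)" for s
  let ?I = "{-1<..<1::real}"
  have arc: "0 < arccos s" "arccos s < pi" "cos (arccos s) = s" "sin (arccos s) = sqrt (1 - s\<^sup>2)" "0 < sqrt (1 - s\<^sup>2)" if s: "s \<in> ?I" for s
  proof -
    have "s\<^sup>2 < 1" using s by (simp add: abs_square_less_1 abs_less_iff)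
    then show "0 < sqrt (1 - s\<^sup>2)" by simp
    show "0 < arccos s" "arccos s < pi" using arccos_lt_bounded[of s] s by auto
    show "cos (arccos s) = s" using s by simp
    show "sin (arccos s) = sqrt (1 - s\<^sup>2)" using s by (simp add: sin_arccos_abs abs_le_iff)
  qed
  have FG: "c \<le> F s" "c \<le> G s" if s: "s \<in> ?I" for s
    using bd[of "arccos s"] arc[OF s] by (auto simp: F_def G_def F1_def mult.commute)
  have dF: "(F has_real_derivative F1 s) (at s)" if s: "s \<in> ?I" for s
  proof -
    have "(F has_real_derivative q (arccos s) * sin (arccos s) * inverse (- sqrt (1 - s\<^sup>2))) (at s)"
      unfolding F_def[abs_def] by (rule DERIV_chain2[OF dh DERIV_arccos]) (use arc[OF s] s in auto)
    moreover have "q (arccos s) * sin (arccos s) * inverse (- sqrt (1 - s\<^sup>2)) = F1 s"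
      unfolding arc(4)[OF s] F1_def using arc(5)[OF s] by (auto simp: field_simps)
    ultimately show ?thesis by simp
  qed
  have dF1: "(F1 has_real_derivative F2 s) (at s)" if s: "s \<in> ?I" for s
  proof -
    define r where "r = sqrt (1 - s\<^sup>2)"
    have r: "0 < r" "r * r = 1 - s * s" using arc(5)[OF s] by (auto simp: r_def power2_eq_square)
    have "((\<lambda>s. q (arccos s)) has_real_derivative (F s powr (p - 1) * G s powr (1 - real n) - G s) / r * inverse (- r)) (at s)"
      using DERIV_chain2[OF dq DERIV_arccos, of s] arc[OF s] s
      by (simp add: F_def G_def F1_def r_def mult.commute)
    then have "(F1 has_real_derivative - ((F s powr (p - 1) * G s powr (1 - real n) - G s) / r * inverse (- r))) (at s)"
      unfolding F1_def[abs_def] by (rule DERIV_minus)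
    moreover have "- ((F s powr (p - 1) * G s powr (1 - real n) - G s) / r * inverse (- r)) = F2 s"
      unfolding F2_def r(2)[symmetric] using r by (simp add: field_simps)
    ultimately show ?thesis by simp
  qed
  \<comment> \<open>Joint induction: \<open>F' = F1\<close>, and \<open>F1' = F2\<close> is a smooth
    expression in \<open>F\<close>, \<open>F1\<close> and \<open>s\<close>, with
    \<open>1 - s^2 > 0\<close> on the open interval.\<close>
  have ckF: "Ck_real k ?I F \<and> Ck_real k ?I F1" for k
  proof (induction k)
    case 0
    show ?case
      using DERIV_isCont[OF dF] DERIV_isCont[OF dF1]
      by (simp add: continuous_at_imp_continuous_on)
  next
    case (Suc k)
    have ckG: "Ck_real k ?I G" unfolding G_def[abs_def] using Suc by (intro Ck_real_diff Ck_real_mult Ck_real_ident) auto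
    have "Ck_real k ?I F2"
      unfolding F2_def[abs_def]
    proof (rule Ck_real_divide)
      show "Ck_real k ?I (\<lambda>s. F s powr (p - 1) * G s powr (1 - real n) - G s)"
        using Suc FG c by (intro Ck_real_diff Ck_real_mult Ck_real_powr ckG) (auto intro: less_le_trans)
      show "Ck_real k ?I (\<lambda>s. 1 - s * s)" by (intro Ck_real_diff Ck_real_mult Ck_real_ident Ck_real_const)
      show "0 < 1 - s * s" if "s \<in> ?I" for s using arc(5)[OF that] by (simp add: power2_eq_square)
    qed simp
    then show ?case using Suc Ck_real_SucI[of ?I F F1 k, OF dF] Ck_real_SucI[of ?I F1 F2 k, OF dF1] by blast
  qed
  define f where "f s = (if 1 \<le> s then fN s else if s \<le> -1 then fS (- s) else F s)" for s
  have fN: "f s = fN s" if s: "s \<in> {1 - dN<..<1 + dN}" for s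
  proof (cases "1 \<le> s")
    case False
    then have i: "s \<in> ?I" using s N by auto
    show ?thesis using N(4)[of "arccos s"] arc[OF i] s i False by (simp add: f_def F_def)
  qed (simp add: f_def)
  have fS: "f s = fS (- s)" if s: "s \<in> {-1 - dS<..<-1 + dS}" for s
  proof (cases "s \<le> -1")
    case True then show ?thesis by (simp add: f_def)
  next
    case False
    then have i: "s \<in> ?I" using s S by auto
    show ?thesis using S(4)[of "pi - arccos s"] arc[OF i] s i by (simp add: f_def F_def h'_def)
  qed
  have fF: "f s = F s" if "s \<in> ?I" for s using that by (simp add: f_def)
  define d where "d = min dN dS"
  have d: "0 < d" using N S by (simp add: d_def)
  have ck: "Ck_real k {-1 - d<..<1 + d} f" for k
  proof -
    have 1: "Ck_real k {1 - dN<..<1 + dN} f" by (rule Ck_real_cong[OF _ _ N(3)]) (use fN in auto)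
    have 2: "Ck_real k ?I f" by (rule Ck_real_cong[of _ F]) (use fF ckF in auto)
    have 3: "Ck_real k {-1 - dS<..<-1 + dS} f"
    proof (rule Ck_real_cong[of _ "\<lambda>s. fS (- s)"])
      have "Ck_real k {-1 - dS<..<-1 + dS} (\<lambda>s. 0 - s)" by (intro Ck_real_diff Ck_real_const Ck_real_ident)
      then show "Ck_real k {-1 - dS<..<-1 + dS} (\<lambda>s. fS (- s))"
        by (intro Ck_real_compose[OF S(3)]) auto
    qed (use fS in auto)
    have "Ck_real k (({1 - dN<..<1 + dN} \<union> ?I) \<union> {-1 - dS<..<-1 + dS}) f"
      by (intro Ck_real_Un open_Un 1 2 3) auto
    then show ?thesis by (rule Ck_real_subset) (use N S in \<open>auto simp: d_def\<close>)
  qed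
  obtain f1 where f1: "\<And>s. s \<in> {-1 - d<..<1 + d} \<Longrightarrow> (f has_real_derivative f1 s) (at s)" "Ck_real 1 {-1 - d<..<1 + d} f1"
    using Ck_real_SucD[OF ck[of "Suc 1"]] by blast
  obtain f2 where f2: "\<And>s. s \<in> {-1 - d<..<1 + d} \<Longrightarrow> (f1 has_real_derivative f2 s) (at s)" "Ck_real 0 {-1 - d<..<1 + d} f2"
    using Ck_real_SucD[of 0 _ f1] f1(2) unfolding One_nat_def by blast
  have sub: "continuous_on {-1..1} w" if "continuous_on {-1 - d<..<1 + d} w" for w :: "real \<Rightarrow> real"
    by (rule continuous_on_subset[OF that]) (use d in auto)
  have cf: "continuous_on {-1..1} f" "continuous_on {-1..1} f1" "continuous_on {-1..1} f2"
    using sub Ck_real_continuous[OF ck[of 0]] Ck_real_continuous[OF f1(2)] Ck_real_continuous[OF f2(2)] by auto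
  have cl: "closure ?I = {-1..1}" by simp
  have fc: "c \<le> f s" if "s \<in> {-1..1}" for s
    by (rule continuous_ge_on_closure[of ?I f]) (use cf that FG fF in \<open>auto simp: cl\<close>)
  have f1F: "f1 s = F1 s" if s: "s \<in> ?I" for s
  proof -
    have "(f has_real_derivative F1 s) (at s)"
      by (rule has_field_derivative_transform_within_open[OF dF[OF s], of ?I]) (use s fF in auto)
    then show ?thesis using f1(1)[of s] s d DERIV_unique by force
  qed
  have f2F: "f2 s = F2 s" if s: "s \<in> ?I" for s
  proof -
    have "(f1 has_real_derivative F2 s) (at s)"
      by (rule has_field_derivative_transform_within_open[OF dF1[OF s], of ?I]) (use s f1F in auto)
    then show ?thesis using f2(1)[of s] s d DERIV_unique by force
  qed
  have eq: "(f s - s * f1 s) ^ (n - 1) * (f s - s * f1 s + f2 s * (1 - s\<^sup>2)) - f s powr (p - 1) = 0" if s: "s \<in> {-1..1}" for s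
  proof (rule continuous_constant_on_closure[of ?I "\<lambda>s. (f s - s * f1 s) ^ (n - 1) * (f s - s * f1 s + f2 s * (1 - s\<^sup>2)) - f s powr (p - 1)"])
    have "f x \<noteq> 0" if "x \<in> {-1..1}" for x using fc[OF that] c by auto
    then show "continuous_on (closure ?I) (\<lambda>s. (f s - s * f1 s) ^ (n - 1) * (f s - s * f1 s + f2 s * (1 - s\<^sup>2)) - f s powr (p - 1))"
      unfolding cl by (intro continuous_intros cf) auto
    show "s \<in> closure ?I" using s by simp
    fix x assume x: "x \<in> ?I"
    have g: "f x - x * f1 x = G x" using x by (simp add: fF f1F G_def)
    have G0: "0 < G x" using FG(2)[OF x] c by simp
    have x2: "1 - x\<^sup>2 \<noteq> 0" using arc(5)[OF x] by auto
    have "f2 x * (1 - x\<^sup>2) = F x powr (p - 1) * G x powr (1 - real n) - G x"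
      using x2 by (simp add: f2F[OF x] F2_def power2_eq_square)
    then have "G x + f2 x * (1 - x\<^sup>2) = F x powr (p - 1) * G x powr (1 - real n)" by simp
    moreover have "G x ^ (n - 1) * G x powr (1 - real n) = 1"
      using G0 n by (simp add: powr_realpow[symmetric] powr_add[symmetric] of_nat_diff)
    ultimately show "(f x - x * f1 x) ^ (n - 1) * (f x - x * f1 x + f2 x * (1 - x\<^sup>2)) - f x powr (p - 1) = 0"
      unfolding g by (simp add: fF[OF x])
  qed
  \<comment> \<open>A constant profile would have height below 1, and by
    \<open>crit_slope_deriv\<close> a positive \<open>q'\<close> at angle 1, although
    \<open>q\<close> would vanish identically.\<close>
  have nc: "\<not> (\<exists>k. \<forall>s\<in>{-1..1}. f s = k)"
  proof
    assume "\<exists>k. \<forall>s\<in>{-1..1}. f s = k"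
    then obtain k where k: "\<And>s. s \<in> {-1..1} \<Longrightarrow> f s = k" by blast
    have hk: "h t = k" if t: "0 < t" "t < pi" for t
    proof -
      have "cos t \<noteq> 1" "cos t \<noteq> -1"
        using cos_monotone_0_pi[of 0 t] cos_monotone_0_pi[of t pi] t by auto
      then have "cos t \<in> ?I" using cos_ge_minus_one[of t] cos_le_one[of t] by (auto simp: less_le)
      then show ?thesis using k[of "cos t"] fF[of "cos t"] t by (simp add: F_def arccos_cos)
    qed
    have s1: "is_sol 2 h q" by (rule sol) (use pi_gt3 in simp)
    have "continuous_on (closure {0<..<2}) h" using is_solD(1)[OF s1] by simp
    then have "h 0 = k" by (rule continuous_constant_on_closure) (use hk pi_gt3 in auto)
    then have k1: "k < 1" using h01 by simp
    have q0: "q t = 0" if t: "0 < t" "t < pi" for t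
    proof -
      have "(h has_real_derivative 0) (at t)"
        by (rule has_field_derivative_transform_within_open[of "\<lambda>_. k" _ _ "{0<..<pi}"]) (use t hk in auto)
      then have "q t * sin t = 0" using DERIV_unique dh[OF t] by blast
      then show ?thesis using sin_gt_zero[OF t] by simp
    qed
    obtain D where D: "(q has_real_derivative D) (at 1)" "h 1 < 1 \<Longrightarrow> 0 < D"
      using crit_slope_deriv[OF s1, of 1] q0[of 1] pi_gt3 by auto
    have "(q has_real_derivative 0) (at 1)"
      by (rule has_field_derivative_transform_within_open[of "\<lambda>_. 0" _ _ "{0<..<pi}"]) (use q0 pi_gt3 in auto)
    then have "D = 0" using DERIV_unique D(1) by blast
    then show False using D(2) hk[of 1] k1 pi_gt3 by simp
  qed
  show ?thesis
  proof (rule that[of d f f1 f2, OF d ck f1(1) f2(1) _ nc])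
    show "0 < f s" if "s \<in> {-1..1}" for s using fc[OF that] c by simp
    show "(f s - s * f1 s) ^ (n - 1) * (f s - s * f1 s + f2 s * (1 - s\<^sup>2)) = f s powr (p - 1)" if "s \<in> {-1..1}" for s
      using eq[OF that] by simp
  qed
qed

end

section \<open>The Hessian of a zonal function\<close>

lemma det_diagonal_axis:
  fixes B :: real
  shows "det (\<chi> i j. if i = j then g + (if i = k then B else 0) else 0 :: real^'n^'n) = g ^ (CARD('n) - 1) * (g + B)"
proof -
  have "det (\<chi> i j. if i = j then g + (if i = k then B else 0) else 0 :: real^'n^'n)
      = (\<Prod>i\<in>UNIV. g + (if i = k then B else 0))"
    by (subst det_diagonal) auto
  also have "\<dots> = (g + B) * (\<Prod>i\<in>UNIV - {k}. g + (if i = k then B else 0))"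
    by (subst prod.remove[of _ k]) auto
  also have "(\<Prod>i\<in>UNIV - {k}. g + (if i = k then B else 0)) = (\<Prod>i\<in>UNIV - {k}. g)"
    by (rule prod.cong) auto
  finally show ?thesis by (simp add: mult.commute)
qed

text \<open>Rotate \<open>c\<close> onto a coordinate axis: with an orthogonal \<open>P\<close>
  whose \<open>k\<close>-th column is \<open>c / |c|\<close>, the matrix becomes diagonal with one
  exceptional entry. For \<open>c = 0\<close> the identity will do; \<open>k\<close> is an arbitrary
  index.\<close>

lemma det_rank_one_update:
  fixes c :: "real^'n" and A g :: real
  shows "det (\<chi> i j. A * c $ i * c $ j + (if i = j then g else 0) :: real^'n^'n) = g ^ (CARD('n) - 1) * (g + A * (c \<bullet> c))"
proof -
  define k where "k = (undefined :: 'n)"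
  define B where "B = A * (c \<bullet> c)"
  obtain P :: "real^'n^'n" where P: "orthogonal_matrix P" and Pc: "\<And>i. norm c * P $ i $ k = c $ i"
  proof (cases "c = 0")
    case True
    then show ?thesis using that[of "mat 1"] by (simp add: orthogonal_matrix_id)
  next
    case False
    define a where "a = c /\<^sub>R norm c"
    have "norm a = 1" using False by (simp add: a_def)
    then obtain P where P: "orthogonal_matrix P" "P *v axis k 1 = a" using orthogonal_matrix_exists_basis by blast
    have "P $ i $ k = a $ i" for i
      using P(2) by (simp add: matrix_vector_mult_basis column_def vec_eq_iff)
    then show ?thesis using that[OF P(1)] False by (simp add: a_def)
  qed
  define D :: "real^'n^'n" where "D = (\<chi> i j. if i = j then g + (if i = k then B else 0) else 0)"
  have PP: "(\<Sum>l\<in>UNIV. P $ i $ l * P $ j $ l) = (if i = j then 1 else 0)" for i j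
  proof -
    have "P ** transpose P = mat 1" using P by (simp add: orthogonal_matrix_def)
    then have "(P ** transpose P) $ i $ j = (if i = j then 1 else 0)" by (simp add: mat_def)
    then show ?thesis by (simp add: matrix_matrix_mult_def transpose_def)
  qed
  have "(P ** D ** transpose P) $ i $ j = A * c $ i * c $ j + (if i = j then g else 0)" for i j
  proof -
    have 1: "(P ** D) $ i $ l = P $ i $ l * (g + (if l = k then B else 0))" for l
      by (simp add: matrix_matrix_mult_def D_def if_distrib[of "\<lambda>x. _ * x"] cong: if_cong)
    have "(P ** D ** transpose P) $ i $ j = (\<Sum>l\<in>UNIV. (P ** D) $ i $ l * P $ j $ l)"
      by (simp add: matrix_matrix_mult_def[of "P ** D"] transpose_def)
    also have "\<dots> = (\<Sum>l\<in>UNIV. g * (P $ i $ l * P $ j $ l) + (if l = k then B * (P $ i $ k * P $ j $ k) else 0))"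
      unfolding 1 by (rule sum.cong) (auto simp: algebra_simps)
    also have "\<dots> = g * (\<Sum>l\<in>UNIV. P $ i $ l * P $ j $ l) + B * (P $ i $ k * P $ j $ k)"
      by (simp add: sum.distrib sum_distrib_left)
    also have "B * (P $ i $ k * P $ j $ k) = A * c $ i * c $ j"
    proof -
      have "B * (P $ i $ k * P $ j $ k) = A * (norm c * P $ i $ k) * (norm c * P $ j $ k)"
        by (simp add: B_def power2_norm_eq_inner[symmetric] power2_eq_square)
      then show ?thesis unfolding Pc .
    qed
    finally show ?thesis unfolding PP by simp
  qed
  then have eq: "(\<chi> i j. A * c $ i * c $ j + (if i = j then g else 0) :: real^'n^'n) = P ** D ** transpose P"
    by (simp add: vec_eq_iff)
  have "det P * det P = 1" using det_orthogonal_matrix[OF P] by auto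
  then have "det (P ** D ** transpose P) = det D" by (simp add: det_mul det_transpose)
  then show ?thesis unfolding eq using det_diagonal_axis[of g k B] by (simp add: D_def B_def)
qed

text \<open>By the dimension count \<open>x\<close> and the frame form an orthonormal basis, and
  this is Parseval's identity. For the unit axis vector it gives \<open>1 - s^2\<close> as the
  squared length of the tangential part.\<close>

lemma frame_parseval:
  fixes x e :: "real^'m" and v :: "'n::finite \<Rightarrow> real^'m"
  assumes dim: "CARD('m) = CARD('n) + 1" and x: "norm x = 1" and v: "tangent_orthonormal_frame x v"
  shows "e \<bullet> e = (x \<bullet> e)\<^sup>2 + (\<Sum>i\<in>UNIV. (v i \<bullet> e)\<^sup>2)"
proof -
  have vx: "v i \<bullet> x = 0" and vv: "v i \<bullet> v j = (if i = j then 1 else 0)" for i j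
    using v by (auto simp: tangent_orthonormal_frame_def)
  have xx: "x \<bullet> x = 1" using x by (simp add: norm_eq_1)
  have inj: "inj v"
  proof (rule injI, rule ccontr)
    fix i j assume "v i = v j" "i \<noteq> j"
    then show False using vv[of i j] vv[of j j] by simp
  qed
  have nx: "x \<notin> range v" using vx xx by (metis rangeE zero_neq_one)
  define B where "B = insert x (range v)"
  have fB: "finite B" by (simp add: B_def)
  have cB: "card B = DIM(real^'m)"
    using nx inj dim by (simp add: B_def card_image)
  have oB: "pairwise orthogonal B"
    unfolding B_def pairwise_def orthogonal_def using vx vv by (auto simp: inner_commute)
  have n1: "norm b = 1" if "b \<in> B" for b
    using that x vv by (auto simp: B_def norm_eq_1)
  have "0 \<notin> B" using n1 by force
  then have iB: "independent B" by (rule pairwise_orthogonal_independent[OF oB])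
  have "span B = UNIV"
    using card_ge_dim_independent[of B UNIV] iB cB by (auto simp: dim_UNIV)
  then have "e \<in> span B" by simp
  then have "e = (\<Sum>b\<in>B. (b \<bullet> e) *\<^sub>R b)"
    using orthonormal_basis_expand[OF oB n1 _ fB, of e] by (simp add: inner_commute)
  then have "e \<bullet> e = (\<Sum>b\<in>B. (b \<bullet> e) *\<^sub>R b) \<bullet> e" by simp
  also have "\<dots> = (\<Sum>b\<in>B. (b \<bullet> e)\<^sup>2)" by (simp add: inner_sum_left power2_eq_square)
  also have "\<dots> = (x \<bullet> e)\<^sup>2 + (\<Sum>b\<in>range v. (b \<bullet> e)\<^sup>2)" unfolding B_def using nx by simp
  also have "(\<Sum>b\<in>range v. (b \<bullet> e)\<^sup>2) = (\<Sum>i\<in>UNIV. (v i \<bullet> e)\<^sup>2)"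
    using sum.reindex[OF inj, of "\<lambda>b. (b \<bullet> e)\<^sup>2"] by simp
  finally show ?thesis .
qed

text \<open>Along the geodesic the argument of \<open>f\<close> is
  \<open>cos (t \<omega>) a + sin (t \<omega>) b\<close>, with first derivative
  \<open>w \<bullet> e\<close> and second derivative \<open>- \<omega>^2 a\<close> at
  \<open>0\<close>. Only values near \<open>0\<close> matter, so differentiability on
  \<open>I\<close> suffices.\<close>

lemma sphere_hess_quad_axial:
  fixes e x w :: "'a::euclidean_space"
  assumes I: "open I" "x \<bullet> e \<in> I"
    and f1: "\<And>s. s \<in> I \<Longrightarrow> (f has_real_derivative f1 s) (at s)"
    and f2: "\<And>s. s \<in> I \<Longrightarrow> (f1 has_real_derivative f2 s) (at s)"
  shows "sphere_hess_quad (\<lambda>y. f (y \<bullet> e)) x w = f2 (x \<bullet> e) * (w \<bullet> e)\<^sup>2 - (w \<bullet> w) * ((x \<bullet> e) * f1 (x \<bullet> e))"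
proof -
  define \<omega> where "\<omega> = norm w"
  define a where "a = x \<bullet> e"
  define b where "b = (w \<bullet> e) / \<omega>"
  define \<sigma> where "\<sigma> t = cos (t * \<omega>) * a + sin (t * \<omega>) * b" for t
  define \<sigma>1 where "\<sigma>1 t = - \<omega> * sin (t * \<omega>) * a + \<omega> * cos (t * \<omega>) * b" for t
  \<comment> \<open>For \<open>w = 0\<close> division by zero makes \<open>b = 0\<close>, and the
    equation still holds.\<close>
  have wb: "\<omega> * b = w \<bullet> e" by (cases "w = 0") (auto simp: b_def \<omega>_def)
  have eq: "(\<lambda>t. f (sphere_exp x w t \<bullet> e)) = (\<lambda>t. f (\<sigma> t))"
    by (simp add: sphere_exp_def \<sigma>_def inner_add_left a_def b_def \<omega>_def divide_inverse mult_ac)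
  have d\<sigma>: "(\<sigma> has_real_derivative \<sigma>1 t) (at t)" for t
    unfolding \<sigma>_def[abs_def] \<sigma>1_def by (rule derivative_eq_intros refl)+ simp
  have d\<sigma>1: "(\<sigma>1 has_real_derivative - \<omega> * \<omega> * a) (at 0)"
    unfolding \<sigma>1_def[abs_def] by (rule derivative_eq_intros refl)+ simp
  have \<sigma>0: "\<sigma> 0 = a" "\<sigma>1 0 = w \<bullet> e" using wb by (simp_all add: \<sigma>_def \<sigma>1_def)
  have "isCont \<sigma> 0" using d\<sigma> DERIV_isCont by blast
  then have "eventually (\<lambda>t. \<sigma> t \<in> I) (nhds 0)"
    using I \<sigma>0 by (auto simp: a_def isCont_def tendsto_def eventually_at_filter elim!: allE[of _ I] eventually_mono)
  then have ev: "eventually (\<lambda>t. deriv (\<lambda>t. f (\<sigma> t)) t = f1 (\<sigma> t) * \<sigma>1 t) (nhds 0)"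
  proof eventually_elim
    case (elim t)
    show ?case by (rule DERIV_imp_deriv[OF DERIV_chain2[OF f1[OF elim] d\<sigma>]])
  qed
  have aI: "a \<in> I" using I by (simp add: a_def)
  have "((\<lambda>t. f1 (\<sigma> t)) has_real_derivative f2 a * (w \<bullet> e)) (at 0)"
    using DERIV_chain2[OF f2 d\<sigma>, of 0] aI \<sigma>0 by simp
  then have "((\<lambda>t. f1 (\<sigma> t) * \<sigma>1 t) has_real_derivative f2 a * (w \<bullet> e) * \<sigma>1 0 + - \<omega> * \<omega> * a * f1 (\<sigma> 0)) (at 0)"
    by (rule DERIV_mult[OF _ d\<sigma>1])
  then have "deriv (\<lambda>t. f1 (\<sigma> t) * \<sigma>1 t) 0 = f2 a * (w \<bullet> e) * \<sigma>1 0 + - \<omega> * \<omega> * a * f1 (\<sigma> 0)"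
    by (rule DERIV_imp_deriv)
  moreover have "deriv (deriv (\<lambda>t. f (\<sigma> t))) 0 = deriv (\<lambda>t. f1 (\<sigma> t) * \<sigma>1 t) 0"
    by (rule deriv_cong_ev[OF ev refl])
  moreover have "\<omega> * \<omega> = w \<bullet> w" by (simp add: \<omega>_def power2_eq_square[symmetric] power2_norm_eq_inner)
  ultimately show ?thesis
    unfolding sphere_hess_quad_def eq by (simp add: \<sigma>0 a_def power2_eq_square mult.assoc)
qed

lemma sphere_hess_axial:
  fixes e x u v :: "'a::euclidean_space"
  assumes "open I" "x \<bullet> e \<in> I"
    and "\<And>s. s \<in> I \<Longrightarrow> (f has_real_derivative f1 s) (at s)"
    and "\<And>s. s \<in> I \<Longrightarrow> (f1 has_real_derivative f2 s) (at s)"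
  shows "sphere_hess (\<lambda>y. f (y \<bullet> e)) x u v = f2 (x \<bullet> e) * (u \<bullet> e) * (v \<bullet> e) - (u \<bullet> v) * ((x \<bullet> e) * f1 (x \<bullet> e))"
proof -
  have q: "sphere_hess_quad (\<lambda>y. f (y \<bullet> e)) x w = f2 (x \<bullet> e) * (w \<bullet> e)\<^sup>2 - (w \<bullet> w) * ((x \<bullet> e) * f1 (x \<bullet> e))" for w
    by (rule sphere_hess_quad_axial[OF assms])
  show ?thesis
    unfolding sphere_hess_def q
    by (simp add: inner_add_left inner_diff_left inner_add_right inner_diff_right power2_eq_square inner_commute[of v u] add_divide_distrib diff_divide_distrib algebra_simps)
qed

theorem theorem1p3:
  fixes p :: real
  assumes dim: "CARD('m::finite) = CARD('n::finite) + 1"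
    and p: "p < - 2 * real CARD('n) - 5"
  shows "\<exists>h :: real^'m \<Rightarrow> real.
           smooth_on_sphere h
         \<and> (\<forall>x\<in>sphere 0 1. h x > 0)
         \<and> \<not> (\<exists>c. \<forall>x\<in>sphere 0 1. h x = c)
         \<and> (\<forall>x\<in>sphere 0 1. \<forall>e :: 'n \<Rightarrow> real^'m. tangent_orthonormal_frame x e \<longrightarrow>
               det (hess_plus_id_matrix h x e) = h x powr (p - 1))"
proof -
  interpret sphere_profile "CARD('n)" p by unfold_locales (use p in \<open>auto simp: Suc_leI\<close>)
  obtain d f f1 f2 where d: "0 < d" and ck: "\<And>k. Ck_real k {-1 - d<..<1 + d} f"
    and f1: "\<And>s. s \<in> {-1 - d<..<1 + d} \<Longrightarrow> (f has_real_derivative f1 s) (at s)"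
    and f2: "\<And>s. s \<in> {-1 - d<..<1 + d} \<Longrightarrow> (f1 has_real_derivative f2 s) (at s)"
    and pos: "\<And>s. s \<in> {-1..1} \<Longrightarrow> 0 < f s" and nc: "\<not> (\<exists>c. \<forall>s\<in>{-1..1}. f s = c)"
    and ode: "\<And>s. s \<in> {-1..1} \<Longrightarrow>
      (f s - s * f1 s) ^ (CARD('n) - 1) * (f s - s * f1 s + f2 s * (1 - s\<^sup>2)) = f s powr (p - 1)"
    by (rule smooth_profile_exists) (rule that; assumption)
  let ?I = "{-1 - d<..<1 + d}"
  \<comment> \<open>Two distinct coordinates exist since \<open>n + 1 \<ge> 2\<close>; the second is
    needed to realise every \<open>s\<close> in \<open>{-1..1}\<close> as
    \<open>x \<bullet> a\<close> on the sphere.\<close>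
  obtain k k' :: 'm where kk: "k \<noteq> k'"
  proof -
    have "1 < CARD('m)" using dim by simp
    then show ?thesis
      using card_le_Suc0_iff_eq[OF finite, of "UNIV :: 'm set"] that by (metis One_nat_def leD)
  qed
  define a a' :: "real^'m" where "a = axis k 1" and "a' = axis k' 1"
  have aa: "a \<bullet> a = 1" "a' \<bullet> a' = 1" "a' \<bullet> a = 0" "a \<bullet> a' = 0" "norm a = 1"
    using kk by (auto simp: a_def a'_def inner_axis_axis norm_eq_1)
  have sph: "x \<bullet> a \<in> {-1..1}" if "x \<in> sphere 0 1" for x :: "real^'m"
    using Cauchy_Schwarz_ineq2[of x a] that aa(5) by (auto simp: abs_le_iff)
  have sphI: "x \<bullet> a \<in> ?I" if "x \<in> sphere 0 1" for x :: "real^'m"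
    using sph[OF that] d by auto
  have smooth: "smooth_on_sphere (\<lambda>x. f (x \<bullet> a))"
    unfolding smooth_on_sphere_def smooth_on_def
  proof (intro exI conjI allI ballI)
    show "open {x. x \<bullet> a \<in> ?I}"
      unfolding greaterThanLessThan_iff by (intro open_Collect_conj open_Collect_less continuous_intros)
    show "sphere 0 1 \<subseteq> {x. x \<bullet> a \<in> ?I}" using sphI by blast
    show "Ck_on j {x. x \<bullet> a \<in> ?I} (\<lambda>x. f (x \<bullet> a))" for j
      using Ck_on_inner[OF ck, of j a 1] by simp
  qed simp
  have nonconst: "\<not> (\<exists>c. \<forall>x\<in>sphere 0 1. f (x \<bullet> a) = c)"
  proof
    assume "\<exists>c. \<forall>x\<in>sphere 0 1. f (x \<bullet> a) = c"
    then obtain c where c: "\<And>x. x \<in> sphere 0 1 \<Longrightarrow> f (x \<bullet> a) = c" by blast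
    have "f s = c" if s: "s \<in> {-1..1}" for s
    proof -
      define x where "x = s *\<^sub>R a + sqrt (1 - s\<^sup>2) *\<^sub>R a'"
      have "0 \<le> 1 - s\<^sup>2" using s by (simp add: abs_square_le_1 abs_le_iff)
      then have "x \<bullet> x = 1" by (simp add: x_def inner_add_left inner_add_right aa power2_eq_square)
      moreover have "x \<bullet> a = s" by (simp add: x_def inner_add_left aa)
      ultimately show ?thesis using c[of x] by (simp add: norm_eq_1)
    qed
    then show False using nc by blast
  qed
  have "det (hess_plus_id_matrix (\<lambda>x. f (x \<bullet> a)) x e) = f (x \<bullet> a) powr (p - 1)"
    if x: "x \<in> sphere 0 1" and e: "tangent_orthonormal_frame x e" for x and e :: "'n \<Rightarrow> real^'m"
  proof -
    define s where "s = x \<bullet> a"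
    \<comment> \<open>Components of the axis in the frame: the matrix is
      \<open>(f - s f1) I + f2 c c^T\<close> with \<open>|c|^2 = 1 - s^2\<close>, so its determinant
      is the left-hand side of the profile equation.\<close>
    define c :: "real^'n" where "c = (\<chi> i. e i \<bullet> a)"
    have H: "sphere_hess (\<lambda>y. f (y \<bullet> a)) x (e i) (e j) = f2 s * (e i \<bullet> a) * (e j \<bullet> a) - (e i \<bullet> e j) * (s * f1 s)" for i j
      unfolding s_def by (rule sphere_hess_axial[OF _ sphI[OF x] f1 f2]) auto
    have "hess_plus_id_matrix (\<lambda>x. f (x \<bullet> a)) x e
        = (\<chi> i j. f2 s * c $ i * c $ j + (if i = j then f s - s * f1 s else 0))"
      using e unfolding hess_plus_id_matrix_def H
      by (simp add: vec_eq_iff tangent_orthonormal_frame_def c_def s_def)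
    moreover have "c \<bullet> c = 1 - s\<^sup>2"
      using frame_parseval[OF dim _ e, of a] x aa(1) by (simp add: c_def s_def inner_vec_def power2_eq_square)
    ultimately show ?thesis using ode[of s] sph[OF x] by (simp add: det_rank_one_update s_def)
  qed
  then show ?thesis using smooth pos sph nonconst by blast
qed

end
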